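(* Let $(M,J)$ be a compact connected Fano toric Kähler manifold for the torus $\mathbb{T}^n$, let $g$ be a $\mathbb{T}^n$-invariant Kähler metric on $(M,J)$ with Kähler form $\omega$ and moment map $\mu$, let $a\in\mathfrak{t}$ and let $\lambda\in\mathbb{R}$. Then $(g,a)$ is a Kähler-Ricci soliton with Einstein constant $\lambda$ if and only if, up to additive constants, $$\forall b\in\mathfrak{t},\quad 2\lambda\langle\mu,b\rangle=\Delta^{g,a}\langle\mu,b\rangle,$$ that is, if and only if for every $b\in\mathfrak{t}$ there is a constant $c_b$ such that $\Delta^{g,a}(\langle\mu,b\rangle+c_b)=2\lambda(\langle\mu,b\rangle+c_b)$ on $M$.
   Context: $\mathbb{T}^n$ is an $n$-dimensional real torus with Lie algebra $\mathfrak{t}$. A toric Kähler manifold is a compact connected Kähler manifold $(M,\omega,J)$ of real dimension $2n$ with an effective Hamiltonian action of $\mathbb{T}^n$ preserving $J$ and $\omega$. For $b\in\mathfrak{t}$, $X_b(z)=\frac{d}{ds}|_{s=0}\exp(sb)\cdot z$ is the fundamental vector field. The Kähler form $\omega$ of $g$ satisfies $g=\omega(\cdot,J\cdot)$; the moment map $\mu:M\to\mathfrak{t}^*$ of $\omega$ is $\mathbb{T}^n$-invariant and satisfies $-d\langle\mu,b\rangle=i_{X_b}\omega$ for all $b\in\mathfrak{t}$. $(g,a)$ is a Kähler-Ricci soliton with Einstein constant $\lambda$ if $\operatorname{Ric}(\omega)-\lambda\omega=\mathcal{L}_X\omega$, where $X=JX_a+\sqrt{-1}X_a$, $\operatorname{Ric}(\omega)$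 is the Ricci form and $\mathcal{L}_X$ is the Lie derivative (extended $\mathbb{C}$-linearly in $X$). The weighted Laplacian is $\Delta^{g,a}v=\Delta^gv+dv(\nabla_g\langle\mu,2a\rangle)$ for $v\in C^\infty(M,\mathbb{R})$, where $\Delta^g$ is the nonnegative Laplacian of $g$ and $\nabla_g$ the Riemannian gradient. *)

theory Defs
  imports "HOL-Analysis.Analysis"
begin

section \<open>Smooth maps between normed spaces\<close>

text \<open>The two notions below are meant for open sets \<open>S\<close>.\<close>

primrec Ck_on :: "nat \<Rightarrow> 'a::real_normed_vector set \<Rightarrow> ('a \<Rightarrow> 'b::real_normed_vector) \<Rightarrow> bool" where
  "Ck_on 0 S f \<longleftrightarrow> continuous_on S f"
| "Ck_on (Suc k) S f \<longleftrightarrow>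
     (\<forall>x\<in>S. f differentiable at x) \<and> (\<forall>v. Ck_on k S (\<lambda>x. frechet_derivative f (at x) v))"

definition smooth_on :: "'a::real_normed_vector set \<Rightarrow> ('a \<Rightarrow> 'b::real_normed_vector) \<Rightarrow> bool" where
  "smooth_on S f \<longleftrightarrow> (\<forall>k. Ck_on k S f)"

definition holomorphic_map_on :: "(complex^'n) set \<Rightarrow> (complex^'n \<Rightarrow> complex^'n) \<Rightarrow> bool" where
  "holomorphic_map_on S f \<longleftrightarrow> smooth_on S f \<and>
     (\<forall>x\<in>S. \<forall>v. frechet_derivative f (at x) (\<i> *s v) = \<i> *s frechet_derivative f (at x) v)"

section \<open>Complex manifolds\<close>

text \<open>
  The underlying Hausdorff space is the type \<open>'m\<close>. A chart is a pair of an open domain and a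
  coordinate map into \<open>complex^'n\<close>; a complex manifold is given by a holomorphic atlas.
\<close>

type_synonym ('m, 'n) chart = "'m set \<times> ('m \<Rightarrow> complex^'n)"

abbreviation cdom :: "('m, 'n) chart \<Rightarrow> 'm set" where "cdom c \<equiv> fst c"
abbreviation coord :: "('m, 'n) chart \<Rightarrow> 'm \<Rightarrow> complex^'n" where "coord c \<equiv> snd c"
abbreviation cran :: "('m, 'n) chart \<Rightarrow> (complex^'n) set" where "cran c \<equiv> coord c ` cdom c"
abbreviation cinv :: "('m, 'n) chart \<Rightarrow> complex^'n \<Rightarrow> 'm" where "cinv c \<equiv> inv_into (cdom c) (coord c)"

definition complex_atlas :: "('m::t2_space, 'n::finite) chart set \<Rightarrow> bool" where
  "complex_atlas A \<longleftrightarrow>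
     (\<Union>c\<in>A. cdom c) = UNIV \<and>
     (\<forall>c\<in>A. open (cdom c) \<and> open (cran c) \<and> homeomorphism (cdom c) (cran c) (coord c) (cinv c)) \<and>
     (\<forall>c\<in>A. \<forall>c'\<in>A. holomorphic_map_on (coord c ` (cdom c \<inter> cdom c')) (coord c' \<circ> cinv c))"

definition charts_at :: "('m, 'n) chart set \<Rightarrow> 'm \<Rightarrow> ('m, 'n) chart set" where
  "charts_at A p = {c \<in> A. p \<in> cdom c}"

definition chart_at :: "('m, 'n) chart set \<Rightarrow> 'm \<Rightarrow> ('m, 'n) chart" where
  "chart_at A p = (SOME c. c \<in> charts_at A p)"

text \<open>
  A (real) tangent vector at \<open>p\<close> is the family of its components in all charts around \<open>p\<close>, related
  by the differentials of the coordinate changes (and set to 0 for charts not containing \<open>p\<close>).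
  Each component determines the whole vector, via \<open>chart_vec\<close>. Tensors take such vectors
  as arguments; their values on families that are not tangent vectors are irrelevant.
\<close>

type_synonym ('m, 'n) tvec = "('m, 'n) chart \<Rightarrow> complex^'n"
type_synonym ('m, 'n) vfield = "'m \<Rightarrow> ('m, 'n) tvec"
type_synonym ('m, 'n) tensor1 = "'m \<Rightarrow> ('m, 'n) tvec \<Rightarrow> real"
type_synonym ('m, 'n) tensor2 = "'m \<Rightarrow> ('m, 'n) tvec \<Rightarrow> ('m, 'n) tvec \<Rightarrow> real"

definition tangent_space :: "('m, 'n::finite) chart set \<Rightarrow> 'm \<Rightarrow> ('m, 'n) tvec set" where
  "tangent_space A p = {v.
     (\<forall>c\<in>charts_at A p. \<forall>c'\<in>charts_at A p.
        v c' = frechet_derivative (coord c' \<circ> cinv c) (at (coord c p)) (v c)) \<and>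
     (\<forall>c. c \<notin> charts_at A p \<longrightarrow> v c = 0)}"

definition chart_vec :: "('m, 'n::finite) chart set \<Rightarrow> 'm \<Rightarrow> ('m, 'n) chart \<Rightarrow> complex^'n \<Rightarrow> ('m, 'n) tvec" where
  "chart_vec A p c u = (\<lambda>c'. if c' \<in> charts_at A p
     then frechet_derivative (coord c' \<circ> cinv c) (at (coord c p)) u else 0)"

definition cplx_struct :: "('m, 'n::finite) tvec \<Rightarrow> ('m, 'n) tvec" where
  "cplx_struct v = (\<lambda>c. \<i> *s v c)"

text \<open>Local representatives in a chart \<open>c\<close>, as functions of the coordinate point \<open>x\<close>.\<close>

definition loc_vec :: "('m, 'n) chart \<Rightarrow> ('m, 'n) vfield \<Rightarrow> complex^'n \<Rightarrow> complex^'n" where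
  "loc_vec c X x = X (cinv c x) c"

definition loc1 :: "('m, 'n::finite) chart set \<Rightarrow> ('m, 'n) chart \<Rightarrow> ('m, 'n) tensor1 \<Rightarrow>
    complex^'n \<Rightarrow> complex^'n \<Rightarrow> real" where
  "loc1 A c \<alpha> x u = \<alpha> (cinv c x) (chart_vec A (cinv c x) c u)"

definition loc2 :: "('m, 'n::finite) chart set \<Rightarrow> ('m, 'n) chart \<Rightarrow> ('m, 'n) tensor2 \<Rightarrow>
    complex^'n \<Rightarrow> complex^'n \<Rightarrow> complex^'n \<Rightarrow> real" where
  "loc2 A c \<tau> x u v = \<tau> (cinv c x) (chart_vec A (cinv c x) c u) (chart_vec A (cinv c x) c v)"

definition smooth_fun :: "('m, 'n::finite) chart set \<Rightarrow> ('m \<Rightarrow> 'b::real_normed_vector) \<Rightarrow> bool" where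
  "smooth_fun A f \<longleftrightarrow> (\<forall>c\<in>A. smooth_on (cran c) (f \<circ> cinv c))"

definition smooth_form1 :: "('m, 'n::finite) chart set \<Rightarrow> ('m, 'n) tensor1 \<Rightarrow> bool" where
  "smooth_form1 A \<alpha> \<longleftrightarrow> (\<forall>c\<in>A.
     (\<forall>x\<in>cran c. linear (loc1 A c \<alpha> x)) \<and>
     (\<forall>u. smooth_on (cran c) (\<lambda>x. loc1 A c \<alpha> x u)))"

definition smooth_tensor2 :: "('m, 'n::finite) chart set \<Rightarrow> ('m, 'n) tensor2 \<Rightarrow> bool" where
  "smooth_tensor2 A \<tau> \<longleftrightarrow> (\<forall>c\<in>A.
     (\<forall>x\<in>cran c. bilinear (loc2 A c \<tau> x)) \<and>
     (\<forall>u v. smooth_on (cran c) (\<lambda>x. loc2 A c \<tau> x u v)))"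

text \<open>Differential of a function, and of a self-map of the manifold.\<close>

definition differential :: "('m, 'n::finite) chart set \<Rightarrow> ('m \<Rightarrow> real) \<Rightarrow> ('m, 'n) tensor1" where
  "differential A f p v =
     (let c = chart_at A p in frechet_derivative (f \<circ> cinv c) (at (coord c p)) (v c))"

definition pushforward :: "('m, 'n::finite) chart set \<Rightarrow> ('m \<Rightarrow> 'm) \<Rightarrow> 'm \<Rightarrow> ('m, 'n) tvec \<Rightarrow> ('m, 'n) tvec" where
  "pushforward A F p v = (let c = chart_at A p in
     (\<lambda>c'. if c' \<in> charts_at A (F p)
       then frechet_derivative (coord c' \<circ> F \<circ> cinv c) (at (coord c p)) (v c) else 0))"

text \<open>
  Exterior and Lie derivatives, by their coordinate expressions: \<open>u\<close>, \<open>v\<close>, \<open>w\<close> are extended to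
  vector fields with constant components in the chart, so that their mutual brackets vanish and
  \<open>[X, u] = - D\<^sub>u X\<close>.
\<close>

definition ext_deriv1 :: "('m, 'n::finite) chart set \<Rightarrow> ('m, 'n) tensor1 \<Rightarrow> ('m, 'n) tensor2" where
  "ext_deriv1 A \<alpha> p u v = (let c = chart_at A p; x = coord c p in
     frechet_derivative (\<lambda>y. loc1 A c \<alpha> y (v c)) (at x) (u c)
   - frechet_derivative (\<lambda>y. loc1 A c \<alpha> y (u c)) (at x) (v c))"

definition closed_form2 :: "('m, 'n::finite) chart set \<Rightarrow> ('m, 'n) tensor2 \<Rightarrow> bool" where
  "closed_form2 A \<omega> \<longleftrightarrow> (\<forall>c\<in>A. \<forall>x\<in>cran c. \<forall>u v w.
     frechet_derivative (\<lambda>y. loc2 A c \<omega> y v w) (at x) u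
   + frechet_derivative (\<lambda>y. loc2 A c \<omega> y w u) (at x) v
   + frechet_derivative (\<lambda>y. loc2 A c \<omega> y u v) (at x) w = 0)"

definition lie_deriv :: "('m, 'n::finite) chart set \<Rightarrow> ('m, 'n) vfield \<Rightarrow> ('m, 'n) tensor2 \<Rightarrow> ('m, 'n) tensor2" where
  "lie_deriv A X \<omega> p u v = (let c = chart_at A p; x = coord c p; DX = frechet_derivative (loc_vec c X) (at x) in
     frechet_derivative (\<lambda>y. loc2 A c \<omega> y (u c) (v c)) (at x) (X p c)
   + loc2 A c \<omega> x (DX (u c)) (v c) + loc2 A c \<omega> x (u c) (DX (v c)))"

text \<open>Lie derivative along the complex vector field \<open>X + \<i> Y\<close>, where \<open>X\<close> and \<open>Y\<close> are real.\<close>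

definition lie_deriv_complex :: "('m, 'n::finite) chart set \<Rightarrow> ('m, 'n) vfield \<Rightarrow> ('m, 'n) vfield \<Rightarrow>
    ('m, 'n) tensor2 \<Rightarrow> 'm \<Rightarrow> ('m, 'n) tvec \<Rightarrow> ('m, 'n) tvec \<Rightarrow> complex" where
  "lie_deriv_complex A X Y \<omega> p u v =
     complex_of_real (lie_deriv A X \<omega> p u v) + \<i> * complex_of_real (lie_deriv A Y \<omega> p u v)"

section \<open>Riemannian and Kaehler geometry\<close>

definition riemannian_metric :: "('m, 'n::finite) chart set \<Rightarrow> ('m, 'n) tensor2 \<Rightarrow> bool" where
  "riemannian_metric A g \<longleftrightarrow> smooth_tensor2 A g \<and>
     (\<forall>p. \<forall>u\<in>tangent_space A p. \<forall>v\<in>tangent_space A p. g p u v = g p v u) \<and>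
     (\<forall>p. \<forall>u\<in>tangent_space A p. u \<noteq> (\<lambda>_. 0) \<longrightarrow> g p u u > 0)"

definition kaehler :: "('m, 'n::finite) chart set \<Rightarrow> ('m, 'n) tensor2 \<Rightarrow> ('m, 'n) tensor2 \<Rightarrow> bool" where
  "kaehler A g \<omega> \<longleftrightarrow> riemannian_metric A g \<and>
     (\<forall>p. \<forall>u\<in>tangent_space A p. \<forall>v\<in>tangent_space A p.
        g p (cplx_struct u) (cplx_struct v) = g p u v) \<and>
     smooth_tensor2 A \<omega> \<and>
     (\<forall>p. \<forall>u\<in>tangent_space A p. \<forall>v\<in>tangent_space A p. \<omega> p u v = - \<omega> p v u) \<and>
     (\<forall>p. \<forall>u\<in>tangent_space A p. \<forall>v\<in>tangent_space A p. g p u v = \<omega> p u (cplx_struct v)) \<and>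
     closed_form2 A \<omega>"

text \<open>
  For a metric \<open>h\<close> on an open subset of \<open>complex^'n\<close>: \<open>christoffel h x u v\<close> is the Levi-Civita
  derivative at \<open>x\<close> of the constant vector field \<open>v\<close> in direction \<open>u\<close> (Koszul formula),
  \<open>curvature h x u v w\<close> is \<open>R(u,v)w = \<nabla>\<^sub>u \<nabla>\<^sub>v w - \<nabla>\<^sub>v \<nabla>\<^sub>u w\<close> for constant
  fields, and \<open>ricci_loc h x v w\<close> is the trace of \<open>u \<mapsto> R(u,v)w\<close>. The inner product with
  \<open>e \<in> Basis\<close> only extracts coefficients, for traces over the real vector space \<open>complex^'n\<close>.
\<close>

definition christoffel :: "('e::euclidean_space \<Rightarrow> 'e \<Rightarrow> 'e \<Rightarrow> real) \<Rightarrow> 'e \<Rightarrow> 'e \<Rightarrow> 'e \<Rightarrow> 'e" where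
  "christoffel h x u v = (THE z. \<forall>w. 2 * h x z w =
      frechet_derivative (\<lambda>y. h y v w) (at x) u
    + frechet_derivative (\<lambda>y. h y u w) (at x) v
    - frechet_derivative (\<lambda>y. h y u v) (at x) w)"

definition curvature :: "('e::euclidean_space \<Rightarrow> 'e \<Rightarrow> 'e \<Rightarrow> real) \<Rightarrow> 'e \<Rightarrow> 'e \<Rightarrow> 'e \<Rightarrow> 'e \<Rightarrow> 'e" where
  "curvature h x u v w =
      frechet_derivative (\<lambda>y. christoffel h y v w) (at x) u
    - frechet_derivative (\<lambda>y. christoffel h y u w) (at x) v
    + christoffel h x u (christoffel h x v w) - christoffel h x v (christoffel h x u w)"

definition ricci_loc :: "('e::euclidean_space \<Rightarrow> 'e \<Rightarrow> 'e \<Rightarrow> real) \<Rightarrow> 'e \<Rightarrow> 'e \<Rightarrow> 'e \<Rightarrow> real" where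
  "ricci_loc h x v w = (\<Sum>e\<in>Basis. curvature h x e v w \<bullet> e)"

definition ricci :: "('m, 'n::finite) chart set \<Rightarrow> ('m, 'n) tensor2 \<Rightarrow> ('m, 'n) tensor2" where
  "ricci A g p u v = (let c = chart_at A p in ricci_loc (loc2 A c g) (coord c p) (u c) (v c))"

definition ricci_form :: "('m, 'n::finite) chart set \<Rightarrow> ('m, 'n) tensor2 \<Rightarrow> ('m, 'n) tensor2" where
  "ricci_form A g p u v = ricci A g p (cplx_struct u) v"

definition grad :: "('m, 'n::finite) chart set \<Rightarrow> ('m, 'n) tensor2 \<Rightarrow> ('m \<Rightarrow> real) \<Rightarrow> ('m, 'n) vfield" where
  "grad A g f p = (THE v. v \<in> tangent_space A p \<and>
     (\<forall>w\<in>tangent_space A p. g p v w = differential A f p w))"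

text \<open>The divergence of \<open>X\<close> is the trace of its Levi-Civita covariant derivative.\<close>

definition divergence :: "('m, 'n::finite) chart set \<Rightarrow> ('m, 'n) tensor2 \<Rightarrow> ('m, 'n) vfield \<Rightarrow> 'm \<Rightarrow> real" where
  "divergence A g X p = (let c = chart_at A p; x = coord c p in
     \<Sum>e\<in>Basis. (frechet_derivative (loc_vec c X) (at x) e + christoffel (loc2 A c g) x e (X p c)) \<bullet> e)"

definition laplacian :: "('m, 'n::finite) chart set \<Rightarrow> ('m, 'n) tensor2 \<Rightarrow> ('m \<Rightarrow> real) \<Rightarrow> 'm \<Rightarrow> real" where
  "laplacian A g f p = - divergence A g (grad A g f) p"

text \<open>
  \<open>M\<close> is Fano iff \<open>c\<^sub>1(M) > 0\<close>, i.e. some Kaehler form \<open>\<eta>\<close> is cohomologous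
  to the Ricci form of a Kaehler metric; the Ricci form represents \<open>2 \<pi> c\<^sub>1(M)\<close>.
\<close>

definition fano :: "('m::t2_space, 'n::finite) chart set \<Rightarrow> bool" where
  "fano A \<longleftrightarrow> (\<exists>g \<omega> h \<eta> \<alpha>. kaehler A g \<omega> \<and> kaehler A h \<eta> \<and> smooth_form1 A \<alpha> \<and>
     (\<forall>p. \<forall>u\<in>tangent_space A p. \<forall>v\<in>tangent_space A p.
        \<eta> p u v = ricci_form A g p u v + ext_deriv1 A \<alpha> p u v))"

section \<open>Torus actions\<close>

text \<open>
  The torus is \<open>U(1)\<^sup>n\<close> with componentwise multiplication. Its Lie algebra is
  identified with \<open>real^'n\<close> so that the exponential map is \<open>torus_exp\<close>, and the dual of
  the Lie algebra is the space of bounded linear functionals on \<open>real^'n\<close>.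
\<close>

definition torus :: "(complex^'n) set" where
  "torus = {t. \<forall>i. cmod (t $ i) = 1}"

definition torus_exp :: "real^'n \<Rightarrow> complex^'n" where
  "torus_exp b = (\<chi> i. cis (b $ i))"

text \<open>
  Since \<open>torus_exp\<close> is a smooth covering, smoothness of the action \<open>T \<times> M \<rightarrow> M\<close> is
  expressed on the Lie algebra; continuity makes the domains in question open.
\<close>

definition smooth_torus_action :: "('m::t2_space, 'n::finite) chart set \<Rightarrow> (complex^'n \<Rightarrow> 'm \<Rightarrow> 'm) \<Rightarrow> bool" where
  "smooth_torus_action A act \<longleftrightarrow>
     (\<forall>p. act 1 p = p) \<and>
     (\<forall>s\<in>torus. \<forall>t\<in>torus. \<forall>p. act (s * t) p = act s (act t p)) \<and>
     continuous_on (torus \<times> UNIV) (\<lambda>(t, p). act t p) \<and>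
     (\<forall>c\<in>A. \<forall>c'\<in>A. smooth_on
        {(b, x). x \<in> cran c \<and> act (torus_exp b) (cinv c x) \<in> cdom c'}
        (\<lambda>(b, x). coord c' (act (torus_exp b) (cinv c x))))"

definition effective_action :: "(complex^'n::finite \<Rightarrow> 'm \<Rightarrow> 'm) \<Rightarrow> bool" where
  "effective_action act \<longleftrightarrow> (\<forall>t\<in>torus. (\<forall>p. act t p = p) \<longrightarrow> t = 1)"

definition preserves_cplx_struct :: "('m, 'n::finite) chart set \<Rightarrow> (complex^'n \<Rightarrow> 'm \<Rightarrow> 'm) \<Rightarrow> bool" where
  "preserves_cplx_struct A act \<longleftrightarrow> (\<forall>t\<in>torus. \<forall>p. \<forall>v\<in>tangent_space A p.
     pushforward A (act t) p (cplx_struct v) = cplx_struct (pushforward A (act t) p v))"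

definition invariant_tensor2 :: "('m, 'n::finite) chart set \<Rightarrow> (complex^'n \<Rightarrow> 'm \<Rightarrow> 'm) \<Rightarrow> ('m, 'n) tensor2 \<Rightarrow> bool" where
  "invariant_tensor2 A act \<tau> \<longleftrightarrow> (\<forall>t\<in>torus. \<forall>p. \<forall>u\<in>tangent_space A p. \<forall>v\<in>tangent_space A p.
     \<tau> (act t p) (pushforward A (act t) p u) (pushforward A (act t) p v) = \<tau> p u v)"

definition fundamental_field :: "('m, 'n::finite) chart set \<Rightarrow> (complex^'n \<Rightarrow> 'm \<Rightarrow> 'm) \<Rightarrow> real^'n \<Rightarrow> ('m, 'n) vfield" where
  "fundamental_field A act b p = (\<lambda>c. if c \<in> charts_at A p
     then vector_derivative (\<lambda>s. coord c (act (torus_exp (s *\<^sub>R b)) p)) (at 0) else 0)"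

definition moment_map :: "('m, 'n::finite) chart set \<Rightarrow> (complex^'n \<Rightarrow> 'm \<Rightarrow> 'm) \<Rightarrow> ('m, 'n) tensor2 \<Rightarrow>
    ('m \<Rightarrow> (real^'n) \<Rightarrow>\<^sub>L real) \<Rightarrow> bool" where
  "moment_map A act \<omega> \<mu> \<longleftrightarrow> smooth_fun A \<mu> \<and>
     (\<forall>t\<in>torus. \<forall>p. \<mu> (act t p) = \<mu> p) \<and>
     (\<forall>b p. \<forall>v\<in>tangent_space A p.
        - differential A (\<lambda>q. blinfun_apply (\<mu> q) b) p v = \<omega> p (fundamental_field A act b p) v)"

definition toric_kaehler_manifold :: "('m::t2_space, 'n::finite) chart set \<Rightarrow> (complex^'n \<Rightarrow> 'm \<Rightarrow> 'm) \<Rightarrow>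
    ('m, 'n) tensor2 \<Rightarrow> ('m, 'n) tensor2 \<Rightarrow> bool" where
  "toric_kaehler_manifold A act g \<omega> \<longleftrightarrow>
     compact (UNIV :: 'm set) \<and> connected (UNIV :: 'm set) \<and>
     complex_atlas A \<and> kaehler A g \<omega> \<and>
     smooth_torus_action A act \<and> effective_action act \<and>
     preserves_cplx_struct A act \<and> invariant_tensor2 A act \<omega> \<and>
     (\<exists>\<mu>. moment_map A act \<omega> \<mu>)"

section \<open>Weighted Laplacian and Kaehler-Ricci solitons\<close>

definition weighted_laplacian :: "('m, 'n::finite) chart set \<Rightarrow> ('m, 'n) tensor2 \<Rightarrow>
    ('m \<Rightarrow> (real^'n) \<Rightarrow>\<^sub>L real) \<Rightarrow> real^'n \<Rightarrow> ('m \<Rightarrow> real) \<Rightarrow> 'm \<Rightarrow> real" where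
  "weighted_laplacian A g \<mu> a f p = laplacian A g f p +
     differential A f p (grad A g (\<lambda>q. blinfun_apply (\<mu> q) (2 *\<^sub>R a)) p)"

definition kaehler_ricci_soliton :: "('m, 'n::finite) chart set \<Rightarrow> (complex^'n \<Rightarrow> 'm \<Rightarrow> 'm) \<Rightarrow>
    ('m, 'n) tensor2 \<Rightarrow> ('m, 'n) tensor2 \<Rightarrow> real^'n \<Rightarrow> real \<Rightarrow> bool" where
  "kaehler_ricci_soliton A act g \<omega> a lam \<longleftrightarrow>
     (\<forall>p. \<forall>u\<in>tangent_space A p. \<forall>v\<in>tangent_space A p.
        complex_of_real (ricci_form A g p u v - lam * \<omega> p u v) =
        lie_deriv_complex A (\<lambda>q. cplx_struct (fundamental_field A act a q)) (fundamental_field A act a) \<omega> p u v)"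

end

theory Submission
  imports Defs
begin

text \<open>
  In a holomorphic chart the Christoffel symbols \<open>\<Gamma>\<close> of a Kaehler metric are complex bilinear. The fundamental
  fields \<open>X\<^sub>b\<close> are commuting holomorphic Killing fields, and \<open>Y\<^sub>b = - J X\<^sub>b\<close> is the gradient of
  \<open>\<mu>\<^sub>b = \<langle>\<mu>, b\<rangle>\<close>. Differentiating both \<open>div Y\<^sub>b\<close> and \<open>div X\<^sub>b = 0\<close> in terms of the trace of \<open>\<Gamma>\<close>
  gives \<open>d (div Y\<^sub>b) = - 2 Ric(\<cdot>, Y\<^sub>b)\<close>; with \<open>[Y\<^sub>a, Y\<^sub>b] = 0\<close> it follows that
  \<open>d (\<Delta>\<^sup>g\<^sup>,\<^sup>a \<mu>\<^sub>b - 2 \<lambda> \<mu>\<^sub>b) = 2 S(\<cdot>, Y\<^sub>b)\<close> for \<open>S = Ric + 2 \<nabla>d\<mu>\<^sub>a - \<lambda> g\<close>, and the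
  soliton equation says exactly that \<open>S = 0\<close>.

  If \<open>S = 0\<close>, then \<open>\<Delta>\<^sup>g\<^sup>,\<^sup>a \<mu>\<^sub>b - 2 \<lambda> \<mu>\<^sub>b\<close> is constant; the constant is absorbed into \<open>\<mu>\<^sub>b\<close> if
  \<open>\<lambda> \<noteq> 0\<close>, and it vanishes by the maximum principle if \<open>\<lambda> = 0\<close>. Conversely, \<open>S\<close> is \<open>J\<close>-invariant and
  annihilates all \<open>Y\<^sub>b\<close>, so it vanishes wherever the \<open>X\<^sub>b\<close> are linearly independent. Such points are
  dense: where the rank is locally maximal but not full, some \<open>X\<^sub>b\<close> has trivial 1-jet, hence vanishes
  identically by rigidity of Killing fields, contradicting effectiveness.
\<close>

text \<open>The divergences of \<open>X\<^sub>b\<close> and \<open>Y\<^sub>b\<close> are twice the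
  real and the imaginary part of one complex trace. Differentiating the first in direction
  \<open>J w\<close>, the second in direction \<open>w\<close>, and adding is a Cauchy-Riemann
  combination: by holomorphy the second derivatives of \<open>X\<^sub>b\<close> disappear, and what
  survives is a derivative of the connection, that is, Ricci curvature. The obstacle in the converse
  is that \<open>S\<close> is only known to vanish on gradients, which become dependent where some
  \<open>X\<^sub>b\<close> vanishes. At such a point the linearization of \<open>X\<^sub>b\<close>
  is skew and, as the fields commute, kills every \<open>X\<^sub>c\<close>; so its image is
  orthogonal to the orbit. A nonzero vector \<open>w\<close> in this image is a new direction, and
  \<open>X\<^sub>b / t\<close> tends to \<open>w\<close> along a suitable line, so the rank would
  increase arbitrarily close by. This is impossible where the rank is maximal. Where the rank is
  full, the orbit is Lagrangian because \<open>\<mu>\<close> is invariant, hence the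
  \<open>X\<^sub>b\<close> and \<open>J X\<^sub>b\<close> together span the tangent space.\<close>

abbreviation \<D> where "\<D> f x \<equiv> frechet_derivative f (at x)"

section \<open>Calculus\<close>

lemma frechetI: "(f has_derivative f') (at x) \<Longrightarrow> \<D> f x = f'"
  by (rule frechet_derivative_at[symmetric])

text \<open>\<open>Ck_on\<close> differentiates with \<open>at x\<close>, which sees a neighbourhood
  of \<open>x\<close>, so agreement on \<open>S\<close> transfers only because \<open>S\<close> is
  open.\<close>

lemma Ck_on_cong:
  assumes "open S" "\<And>x. x \<in> S \<Longrightarrow> f x = g x"
  shows "Ck_on k S f \<longleftrightarrow> Ck_on k S g"
  using assms(2)
proof (induction k arbitrary: f g)
  case 0 then show ?case using continuous_on_cong[OF refl, of S f g] by simp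
next
  case (Suc k)
  have d: "f differentiable at x \<longleftrightarrow> g differentiable at x" if "x \<in> S" for x
  proof -
    have "(g has_derivative D) (at x)" if "(f has_derivative D) (at x)" for D
      by (rule has_derivative_transform_within_open[OF that assms(1) \<open>x \<in> S\<close>]) (auto simp: Suc.prems)
    moreover have "(f has_derivative D) (at x)" if "(g has_derivative D) (at x)" for D
      by (rule has_derivative_transform_within_open[OF that assms(1) \<open>x \<in> S\<close>]) (auto simp: Suc.prems)
    ultimately show ?thesis unfolding differentiable_def by blast
  qed
  have e: "\<D> f x = \<D> g x"
    if "x \<in> S" "f differentiable at x" for x
    by (rule frechet_derivative_transform_within_open[OF that(2) assms(1) that(1)]) (rule Suc.prems)
  show ?case
  proof (cases "\<forall>x\<in>S. f differentiable at x")
    case True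
    have "Ck_on k S (\<lambda>x. \<D> f x v) \<longleftrightarrow> Ck_on k S (\<lambda>x. \<D> g x v)" for v
      by (rule Suc.IH) (use e True in auto)
    then show ?thesis using d by auto
  next
    case False
    then show ?thesis using d by auto
  qed
qed

lemma smooth_on_has_derivative:
  "smooth_on S f \<Longrightarrow> x \<in> S \<Longrightarrow> (f has_derivative \<D> f x) (at x)"
  by (metis Ck_on.simps(2) frechet_derivative_works smooth_on_def)

lemma smooth_on_derivative:
  "smooth_on S f \<Longrightarrow> smooth_on S (\<lambda>x. \<D> f x v)"
  by (metis Ck_on.simps(2) smooth_on_def)

lemma smooth_on_continuous: "smooth_on S f \<Longrightarrow> continuous_on S f"
  by (metis Ck_on.simps(1) smooth_on_def)

lemma smooth_on_differentiable:
  "smooth_on S f \<Longrightarrow> x \<in> S \<Longrightarrow> f differentiable at x"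
  by (metis Ck_on.simps(2) smooth_on_def)

lemma smooth_on_subset: "smooth_on T f \<Longrightarrow> S \<subseteq> T \<Longrightarrow> smooth_on S f"
proof -
  have "Ck_on k T f \<Longrightarrow> S \<subseteq> T \<Longrightarrow> Ck_on k S f" for k
    by (induction k arbitrary: f) (auto intro: continuous_on_subset)
  then show "smooth_on T f \<Longrightarrow> S \<subseteq> T \<Longrightarrow> smooth_on S f" by (auto simp: smooth_on_def)
qed

lemma smooth_on_bounded_linear_comp:
  assumes "bounded_linear L" "open S" "smooth_on S f"
  shows "smooth_on S (\<lambda>x. L (f x))"
proof -
  have "Ck_on k S f \<Longrightarrow> Ck_on k S (\<lambda>x. L (f x))" for k
  proof (induction k arbitrary: f)
    case 0 then show ?case
      using assms(1) by (simp add: bounded_linear.continuous_on)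
  next
    case (Suc k)
    have hd: "((\<lambda>x. L (f x)) has_derivative (\<lambda>v. L (\<D> f x v))) (at x)" if "x \<in> S" for x
      by (rule bounded_linear.has_derivative[OF assms(1)]) (use Suc.prems that frechet_derivative_works in auto)
    have "Ck_on k S (\<lambda>x. \<D> (\<lambda>x. L (f x)) x v)" for v
      using Suc.IH[of "\<lambda>x. \<D> f x v"] Suc.prems
      by (subst Ck_on_cong[OF assms(2), where g="\<lambda>x. L (\<D> f x v)"])
        (auto simp: frechetI[OF hd])
    then show ?case using hd by (auto simp: differentiable_def)
  qed
  then show ?thesis using assms(3) by (auto simp: smooth_on_def)
qed

text \<open>For an affine inner map, a directional derivative of the composite is a derivative of
  \<open>f\<close> in the fixed direction \<open>L v\<close>, composed with the same map; the
  induction therefore closes without a product rule. The case needed later is the restriction of the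
  torus flow to time 0.\<close>

lemma smooth_on_affine_comp:
  assumes "bounded_linear L" "open S" "smooth_on T f" "\<And>x. x \<in> S \<Longrightarrow> c + L x \<in> T"
  shows "smooth_on S (\<lambda>x. f (c + L x))"
proof -
  have "Ck_on k T f \<Longrightarrow> Ck_on k S (\<lambda>x. f (c + L x))" for k
  proof (induction k arbitrary: f)
    case 0
    have "continuous_on S (\<lambda>x. c + L x)"
      by (intro continuous_intros bounded_linear.continuous_on[OF assms(1)])
    then show ?case using 0 assms(4) by (auto intro!: continuous_on_compose2[of T f])
  next
    case (Suc k)
    have hd: "((\<lambda>x. f (c + L x)) has_derivative (\<lambda>v. \<D> f (c + L x) (L v))) (at x)" if "x \<in> S" for x
    proof -
      have "((\<lambda>x. c + L x) has_derivative L) (at x)"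
        using bounded_linear_imp_has_derivative[OF assms(1)]
        by (auto intro!: derivative_eq_intros)
      then show ?thesis
        using has_derivative_compose[of "\<lambda>x. c + L x" L x UNIV f] Suc.prems assms(4)[OF that] frechet_derivative_works by auto
    qed
    have "Ck_on k S (\<lambda>x. \<D> (\<lambda>x. f (c + L x)) x v)" for v
      using Suc.IH[of "\<lambda>x. \<D> f x (L v)"] Suc.prems
      by (subst Ck_on_cong[OF assms(2), where g="\<lambda>x. \<D> f (c + L x) (L v)"])
        (auto simp: frechetI[OF hd])
    then show ?case using hd by (auto simp: differentiable_def)
  qed
  then show ?thesis using assms(3) by (auto simp: smooth_on_def)
qed

text \<open>The mean value theorem is applied twice, first along \<open>u\<close> to the difference
  in \<open>v\<close>, then along \<open>v\<close> to the difference of the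
  \<open>u\<close>-derivatives. The second difference on the left is symmetric in \<open>u\<close>
  and \<open>v\<close>, which the next lemma exploits.\<close>

lemma mixed_difference:
  fixes f :: "'a::real_normed_vector \<Rightarrow> real"
  assumes S: "\<And>s r. 0 \<le> s \<Longrightarrow> s \<le> t \<Longrightarrow> 0 \<le> r \<Longrightarrow> r \<le> t \<Longrightarrow> x + s *\<^sub>R u + r *\<^sub>R v \<in> S"
    and f: "\<And>y. y \<in> S \<Longrightarrow> (f has_derivative f' y) (at y)"
    and fu: "\<And>y. y \<in> S \<Longrightarrow> ((\<lambda>y. f' y u) has_derivative f'' y) (at y)"
    and t: "t > 0"
  shows "\<exists>s r. 0 \<le> s \<and> s \<le> t \<and> 0 \<le> r \<and> r \<le> t \<and>
    f (x + t *\<^sub>R u + t *\<^sub>R v) - f (x + t *\<^sub>R u) - f (x + t *\<^sub>R v) + f x = t * t * f'' (x + s *\<^sub>R u + r *\<^sub>R v) v"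
proof -
  let ?p = "\<lambda>s. f (x + s *\<^sub>R u + t *\<^sub>R v) - f (x + s *\<^sub>R u + 0 *\<^sub>R v)"
  have lin: "linear (f' y)" "linear (f'' y)" if "y \<in> S" for y
    using f fu that by (auto dest: has_derivative_linear)
  have d1: "((\<lambda>s. f (x + s *\<^sub>R u + r *\<^sub>R v)) has_real_derivative f' (x + s *\<^sub>R u + r *\<^sub>R v) u) (at s)"
    if "0 \<le> s" "s \<le> t" "0 \<le> r" "r \<le> t" for s r
  proof -
    have "((\<lambda>s. x + s *\<^sub>R u + r *\<^sub>R v) has_derivative (\<lambda>h. h *\<^sub>R u)) (at s)"
      by (auto intro!: derivative_eq_intros)
    from has_derivative_compose[OF this f[OF S[OF that]]]
    have "((\<lambda>s. f (x + s *\<^sub>R u + r *\<^sub>R v)) has_derivative (\<lambda>h. f' (x + s *\<^sub>R u + r *\<^sub>R v) (h *\<^sub>R u))) (at s)" .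
    then show ?thesis using lin(1)[OF S[OF that]]
      by (simp add: has_field_derivative_def linear_cmul mult.commute[of _ "f' _ _"])
  qed
  have "\<exists>s>0. s < t \<and> ?p t - ?p 0 = (t - 0) * (f' (x + s *\<^sub>R u + t *\<^sub>R v) u - f' (x + s *\<^sub>R u + 0 *\<^sub>R v) u)"
    by (rule MVT2[OF t]) (intro derivative_intros d1; use t in auto)
  then obtain s where s: "0 < s" "s < t"
    "?p t - ?p 0 = t * (f' (x + s *\<^sub>R u + t *\<^sub>R v) u - f' (x + s *\<^sub>R u + 0 *\<^sub>R v) u)" by auto
  have d2: "((\<lambda>r. f' (x + s *\<^sub>R u + r *\<^sub>R v) u) has_real_derivative f'' (x + s *\<^sub>R u + r *\<^sub>R v) v) (at r)"
    if "0 \<le> r" "r \<le> t" for r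
  proof -
    have i: "x + s *\<^sub>R u + r *\<^sub>R v \<in> S" using S s that by auto
    have "((\<lambda>r. x + s *\<^sub>R u + r *\<^sub>R v) has_derivative (\<lambda>h. h *\<^sub>R v)) (at r)"
      by (auto intro!: derivative_eq_intros)
    from has_derivative_compose[OF this fu[OF i]]
    show ?thesis using lin(2)[OF i]
      by (simp add: has_field_derivative_def linear_cmul mult.commute[of _ "f'' _ _"])
  qed
  have "\<exists>r>0. r < t \<and> f' (x + s *\<^sub>R u + t *\<^sub>R v) u - f' (x + s *\<^sub>R u + 0 *\<^sub>R v) u = (t - 0) * f'' (x + s *\<^sub>R u + r *\<^sub>R v) v"
    by (rule MVT2[OF t]) (rule d2; use t in auto)
  then obtain r where "0 < r" "r < t" "f' (x + s *\<^sub>R u + t *\<^sub>R v) u - f' (x + s *\<^sub>R u + 0 *\<^sub>R v) u = t * f'' (x + s *\<^sub>R u + r *\<^sub>R v) v" by auto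
  then show ?thesis using s by (intro exI[of _ s] exI[of _ r]) (auto simp: algebra_simps)
qed

text \<open>Schwarz's theorem: the same second difference equals \<open>t * t\<close> times either
  mixed derivative at some point near \<open>x\<close>, and continuity excludes a gap between the
  two at \<open>x\<close> itself.\<close>

lemma symmetric_second_derivative_real:
  fixes f :: "'a::real_normed_vector \<Rightarrow> real"
  assumes S: "open S" "x \<in> S"
    and f: "\<And>y. y \<in> S \<Longrightarrow> (f has_derivative f' y) (at y)"
    and fu: "\<And>y. y \<in> S \<Longrightarrow> ((\<lambda>y. f' y u) has_derivative fu y) (at y)"
    and fv: "\<And>y. y \<in> S \<Longrightarrow> ((\<lambda>y. f' y v) has_derivative fv y) (at y)"
    and cu: "continuous_on S (\<lambda>y. fu y v)" and cv: "continuous_on S (\<lambda>y. fv y u)"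
  shows "fu x v = fv x u"
proof (rule ccontr)
  assume ne: "fu x v \<noteq> fv x u"
  define e where "e = \<bar>fu x v - fv x u\<bar> / 2"
  have e: "e > 0" using ne by (simp add: e_def)
  have "isCont (\<lambda>y. fu y v) x" "isCont (\<lambda>y. fv y u) x"
    using cu cv S by (auto simp: continuous_on_eq_continuous_at)
  then obtain d1 d2 where d: "d1 > 0" "\<And>y. dist y x < d1 \<Longrightarrow> dist (fu y v) (fu x v) < e"
    "d2 > 0" "\<And>y. dist y x < d2 \<Longrightarrow> dist (fv y u) (fv x u) < e"
    using e unfolding continuous_at_eps_delta by metis
  obtain d3 where d3: "d3 > 0" "ball x d3 \<subseteq> S" using S openE by blast
  define d0 where "d0 = min d1 (min d2 d3)"
  have d0: "d0 > 0" using d d3 by (simp add: d0_def)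
  \<comment> \<open>The side \<open>t\<close> is chosen so that the parallelogram spanned by
    \<open>t *\<^sub>R u\<close> and \<open>t *\<^sub>R v\<close> stays within \<open>d0 / 2\<close>
    of \<open>x\<close>; the summand 1 keeps \<open>N\<close> positive when both vectors
    vanish.\<close>
  define N where "N = norm u + norm v + 1"
  define t where "t = d0 / (2 * N)"
  have pos: "N > 0" by (simp add: N_def add_nonneg_pos)
  have t: "t > 0" using d0 pos by (simp add: t_def)
  have near: "dist (x + s *\<^sub>R u + r *\<^sub>R v) x < d0" if "0 \<le> s" "s \<le> t" "0 \<le> r" "r \<le> t" for s r
  proof -
    have "dist (x + s *\<^sub>R u + r *\<^sub>R v) x \<le> s * norm u + r * norm v"
      using norm_triangle_ineq[of "s *\<^sub>R u" "r *\<^sub>R v"] that by (simp add: dist_norm add.assoc)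
    also have "\<dots> \<le> t * norm u + t * norm v" using that by (intro add_mono mult_right_mono) auto
    also have "\<dots> \<le> t * N" using t by (simp add: N_def algebra_simps)
    also have "\<dots> = d0 / 2" using pos by (simp add: t_def field_simps)
    finally show ?thesis using d0 by linarith
  qed
  have inS: "x + s *\<^sub>R u + r *\<^sub>R v \<in> S" if "0 \<le> s" "s \<le> t" "0 \<le> r" "r \<le> t" for s r
    using near[OF that] d3 by (auto simp: d0_def dist_commute subset_iff)
  obtain s r where 1: "0 \<le> s" "s \<le> t" "0 \<le> r" "r \<le> t" "f (x + t *\<^sub>R u + t *\<^sub>R v) - f (x + t *\<^sub>R u) - f (x + t *\<^sub>R v) + f x = t * t * fu (x + s *\<^sub>R u + r *\<^sub>R v) v"
    using mixed_difference[OF inS f fu t] by blast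
  have inS': "x + s *\<^sub>R v + r *\<^sub>R u \<in> S" if "0 \<le> s" "s \<le> t" "0 \<le> r" "r \<le> t" for s r
    using inS[of r s] that by (simp add: algebra_simps)
  obtain s' r' where 2: "0 \<le> s'" "s' \<le> t" "0 \<le> r'" "r' \<le> t" "f (x + t *\<^sub>R v + t *\<^sub>R u) - f (x + t *\<^sub>R v) - f (x + t *\<^sub>R u) + f x = t * t * fv (x + s' *\<^sub>R v + r' *\<^sub>R u) u"
    using mixed_difference[OF inS' f fv t] by blast
  have "t * t * fu (x + s *\<^sub>R u + r *\<^sub>R v) v = t * t * fv (x + s' *\<^sub>R v + r' *\<^sub>R u) u"
    using 1(5) 2(5) by (simp add: algebra_simps)
  then have "fu (x + s *\<^sub>R u + r *\<^sub>R v) v = fv (x + r' *\<^sub>R u + s' *\<^sub>R v) u" using t by (simp add: algebra_simps)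
  moreover have "dist (fu (x + s *\<^sub>R u + r *\<^sub>R v) v) (fu x v) < e"
    by (rule d) (use near[OF 1(1-4)] in \<open>simp add: d0_def\<close>)
  moreover have "dist (fv (x + r' *\<^sub>R u + s' *\<^sub>R v) u) (fv x u) < e"
    by (rule d) (use near[OF 2(3,4,1,2)] in \<open>simp add: d0_def\<close>)
  ultimately have "dist (fu x v) (fv x u) < e + e"
    by (metis dist_triangle_less_add dist_commute)
  then show False by (simp add: e_def dist_real_def)
qed

lemma symmetric_second_derivative:
  fixes f :: "'a::real_normed_vector \<Rightarrow> 'b::euclidean_space"
  assumes S: "open S" "x \<in> S" and f: "smooth_on S f"
  shows "\<D> (\<lambda>y. \<D> f y u) x v =
    \<D> (\<lambda>y. \<D> f y v) x u"
proof (rule euclidean_eqI)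
  fix b :: 'b assume "b \<in> Basis"
  note sd = smooth_on_derivative[OF f]
  show "\<D> (\<lambda>y. \<D> f y u) x v \<bullet> b =
    \<D> (\<lambda>y. \<D> f y v) x u \<bullet> b"
    by (rule symmetric_second_derivative_real[OF S, where f="\<lambda>y. f y \<bullet> b"
        and f'="\<lambda>y w. \<D> f y w \<bullet> b" and u=u and v=v
        and fu="\<lambda>y w. \<D> (\<lambda>y. \<D> f y u) y w \<bullet> b"
        and fv="\<lambda>y w. \<D> (\<lambda>y. \<D> f y v) y w \<bullet> b"])
      (intro has_derivative_inner_left continuous_on_inner continuous_on_const
        smooth_on_has_derivative[OF f] smooth_on_has_derivative[OF sd]
        smooth_on_continuous[OF smooth_on_derivative[OF sd]]; assumption)+
qed

section \<open>Derivatives of families of linear and bilinear maps\<close>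

lemma linear_derivative:
  fixes L :: "'a::real_normed_vector \<Rightarrow> 'e::real_vector \<Rightarrow> 'b::real_normed_vector"
  assumes S: "open S" "x \<in> S" and L: "\<And>y. y \<in> S \<Longrightarrow> linear (L y)"
    and L': "\<And>u. ((\<lambda>y. L y u) has_derivative (\<lambda>w. L' w u)) (at x)"
  shows "linear (L' w)"
proof (rule linearI)
  fix u v r
  have "((\<lambda>y. L y (u + v)) has_derivative (\<lambda>w. L' w u + L' w v)) (at x)"
    by (rule has_derivative_transform_within_open[OF has_derivative_add[OF L' L'] S]) (simp add: L linear_add)
  from fun_cong[OF has_derivative_unique[OF L' this]] show "L' w (u + v) = L' w u + L' w v" .
  have "((\<lambda>y. L y (r *\<^sub>R u)) has_derivative (\<lambda>w. r *\<^sub>R L' w u)) (at x)"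
    by (rule has_derivative_transform_within_open[OF has_derivative_scaleR_right[OF L'] S]) (simp add: L linear_scale)
  from fun_cong[OF has_derivative_unique[OF L' this]] show "L' w (r *\<^sub>R u) = r *\<^sub>R L' w u" .
qed

lemma bilinear_derivative:
  fixes B :: "'a::real_normed_vector \<Rightarrow> 'e::real_vector \<Rightarrow> 'f::real_vector \<Rightarrow> 'b::real_normed_vector"
  assumes S: "open S" "x \<in> S" and B: "\<And>y. y \<in> S \<Longrightarrow> bilinear (B y)"
    and B': "\<And>u v. ((\<lambda>y. B y u v) has_derivative (\<lambda>w. B' w u v)) (at x)"
  shows "bilinear (B' w)"
  unfolding bilinear_def
proof (intro conjI allI)
  show "linear (B' w u)" for u
    by (rule linear_derivative[OF S _ B']) (use B in \<open>simp add: bilinear_def\<close>)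
  show "linear (\<lambda>u. B' w u v)" for v
    by (rule linear_derivative[where L="\<lambda>y u. B y u v", OF S _ B']) (use B in \<open>simp add: bilinear_def\<close>)
qed

lemma linear_expand:
  fixes L :: "'e::euclidean_space \<Rightarrow> real"
  assumes "linear L" shows "L z = (\<Sum>i\<in>Basis. L i * (z \<bullet> i))"
proof -
  have "L z = L (\<Sum>i\<in>Basis. (z \<bullet> i) *\<^sub>R i)" by (simp add: euclidean_representation)
  also have "\<dots> = (\<Sum>i\<in>Basis. L i * (z \<bullet> i))"
    by (simp add: linear_sum[OF assms] linear_scale[OF assms] mult.commute)
  finally show ?thesis .
qed

lemma bilinear_expand:
  fixes B :: "'e::euclidean_space \<Rightarrow> 'f::euclidean_space \<Rightarrow> 'b::real_vector"
  assumes "bilinear B"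
  shows "B u v = (\<Sum>i\<in>Basis. \<Sum>j\<in>Basis. ((u \<bullet> i) * (v \<bullet> j)) *\<^sub>R B i j)"
proof -
  have "B u v = B (\<Sum>i\<in>Basis. (u \<bullet> i) *\<^sub>R i) (\<Sum>j\<in>Basis. (v \<bullet> j) *\<^sub>R j)"
    by (simp add: euclidean_representation)
  also have "\<dots> = (\<Sum>i\<in>Basis. \<Sum>j\<in>Basis. ((u \<bullet> i) * (v \<bullet> j)) *\<^sub>R B i j)"
    unfolding bilinear_sum[OF assms] sum.cartesian_product
    by (simp add: split_def bilinear_lmul[OF assms] bilinear_rmul[OF assms] mult.commute)
  finally show ?thesis .
qed

text \<open>Only the derivatives of \<open>B y u v\<close> for fixed \<open>u\<close> and
  \<open>v\<close> are given; expansion in the two finite bases reduces the three-term product rule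
  to sums of products of coefficient functions.\<close>

lemma has_derivative_bilinear_field:
  fixes B :: "'a::real_normed_vector \<Rightarrow> 'e::euclidean_space \<Rightarrow> 'f::euclidean_space \<Rightarrow> 'b::real_normed_vector"
  assumes S: "open S" "x \<in> S" and B: "\<And>y. y \<in> S \<Longrightarrow> bilinear (B y)"
    and B': "\<And>u v. ((\<lambda>y. B y u v) has_derivative (\<lambda>w. B' w u v)) (at x)"
    and Y: "(Y has_derivative Y') (at x)" and Z: "(Z has_derivative Z') (at x)"
  shows "((\<lambda>y. B y (Y y) (Z y)) has_derivative
    (\<lambda>w. B' w (Y x) (Z x) + B x (Y' w) (Z x) + B x (Y x) (Z' w))) (at x)"
proof -
  have bB': "bilinear (B' w)" for w by (rule bilinear_derivative[OF S B B'])
  have "((\<lambda>y. \<Sum>i\<in>Basis. \<Sum>j\<in>Basis. ((Y y \<bullet> i) * (Z y \<bullet> j)) *\<^sub>R B y i j) has_derivative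
     (\<lambda>w. \<Sum>i\<in>Basis. \<Sum>j\<in>Basis. ((Y x \<bullet> i) * (Z x \<bullet> j)) *\<^sub>R B' w i j +
         ((Y x \<bullet> i) * (Z' w \<bullet> j) + (Y' w \<bullet> i) * (Z x \<bullet> j)) *\<^sub>R B x i j)) (at x)"
    by (intro has_derivative_sum has_derivative_scaleR has_derivative_mult has_derivative_inner_left Y Z B')
  also have "(\<lambda>w. \<Sum>i\<in>Basis. \<Sum>j\<in>Basis. ((Y x \<bullet> i) * (Z x \<bullet> j)) *\<^sub>R B' w i j +
         ((Y x \<bullet> i) * (Z' w \<bullet> j) + (Y' w \<bullet> i) * (Z x \<bullet> j)) *\<^sub>R B x i j) =
      (\<lambda>w. B' w (Y x) (Z x) + B x (Y' w) (Z x) + B x (Y x) (Z' w))"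
    unfolding bilinear_expand[OF bB', of _ "Y x" "Z x"] bilinear_expand[OF B[OF S(2)], of "Y' _" "Z x"]
      bilinear_expand[OF B[OF S(2)], of "Y x" "Z' _"]
    by (auto simp: sum.distrib[symmetric] algebra_simps scaleR_add_left intro!: sum.cong)
  finally show ?thesis
    by (rule has_derivative_transform_within_open[OF _ S]) (simp add: bilinear_expand[OF B, symmetric])
qed

lemma has_derivative_linear_field:
  fixes L :: "'a::real_normed_vector \<Rightarrow> 'e::euclidean_space \<Rightarrow> 'b::real_normed_vector"
  assumes S: "open S" "x \<in> S" and L: "\<And>y. y \<in> S \<Longrightarrow> linear (L y)"
    and L': "\<And>u. ((\<lambda>y. L y u) has_derivative (\<lambda>w. L' w u)) (at x)"
    and Y: "(Y has_derivative Y') (at x)"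
  shows "((\<lambda>y. L y (Y y)) has_derivative (\<lambda>w. L' w (Y x) + L x (Y' w))) (at x)"
proof -
  \<comment> \<open>The dummy real factor turns the linear family into a bilinear one, evaluated at
    the constant 1, whose derivative is 0.\<close>
  define B where "B y u (r::real) = r *\<^sub>R L y u" for y u r
  have b: "bilinear (B y)" if "y \<in> S" for y
    using L[OF that] unfolding bilinear_def B_def
    by (auto intro!: linearI simp: linear_add linear_scale algebra_simps scaleR_add_left)
  have "((\<lambda>y. B y (Y y) 1) has_derivative (\<lambda>w. 1 *\<^sub>R L' w (Y x) + B x (Y' w) 1 + B x (Y x) 0)) (at x)"
    by (rule has_derivative_bilinear_field[OF S b]) (auto simp: B_def intro!: Y L' has_derivative_scaleR_right)
  then show ?thesis by (simp add: B_def)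
qed

section \<open>Traces and orthonormal frames\<close>

definition tr :: "('e::euclidean_space \<Rightarrow> 'e) \<Rightarrow> real" where
  "tr A = (\<Sum>e\<in>Basis. A e \<bullet> e)"

lemma tr_add: "tr (\<lambda>e. A e + B e) = tr A + tr B"
  by (simp add: tr_def inner_add_left sum.distrib)

lemma tr_diff: "tr (\<lambda>e. A e - B e) = tr A - tr B"
  by (simp add: tr_def inner_diff_left sum_subtractf)

lemma tr_minus: "tr (\<lambda>e. - A e) = - tr A"
  by (simp add: tr_def sum_negf)

lemma tr_scale: "tr (\<lambda>e. r *\<^sub>R A e) = r * tr A"
  by (simp add: tr_def sum_distrib_left)

lemma tr_commute:
  fixes A B :: "'e::euclidean_space \<Rightarrow> 'e"
  assumes "linear A" "linear B"
  shows "tr (\<lambda>e. A (B e)) = tr (\<lambda>e. B (A e))"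
proof -
  have x: "tr (\<lambda>e. P (Q e)) = (\<Sum>e\<in>Basis. \<Sum>f\<in>Basis. (Q e \<bullet> f) * (P f \<bullet> e))"
    if "linear P" for P Q :: "'e \<Rightarrow> 'e"
  proof -
    have "P (Q e) \<bullet> e = (\<Sum>f\<in>Basis. (Q e \<bullet> f) * (P f \<bullet> e))" for e
    proof -
      have "P (Q e) = P (\<Sum>f\<in>Basis. (Q e \<bullet> f) *\<^sub>R f)" by (simp add: euclidean_representation)
      also have "\<dots> = (\<Sum>f\<in>Basis. (Q e \<bullet> f) *\<^sub>R P f)" using that by (simp add: linear_sum linear_scale)
      finally show ?thesis by (simp add: inner_sum_left)
    qed
    then show ?thesis by (simp add: tr_def)
  qed
  show ?thesis unfolding x[OF assms(1)] x[OF assms(2)]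
    by (subst sum.swap) (simp add: mult.commute)
qed

lemma has_derivative_tr:
  assumes "\<And>e. e \<in> Basis \<Longrightarrow> ((\<lambda>y. A y e) has_derivative (\<lambda>w. A' w e)) (at x)"
  shows "((\<lambda>y. tr (A y)) has_derivative (\<lambda>w. tr (A' w))) (at x)"
  unfolding tr_def by (intro has_derivative_sum has_derivative_inner_left assms)

text \<open>Gram-Schmidt, packaged as a linear isometry \<open>P\<close> from the standard inner
  product to \<open>G\<close>, so that traces over \<open>Basis\<close> can be evaluated with
  \<open>G\<close>.\<close>

lemma orthonormal_frame:
  fixes G :: "'e::euclidean_space \<Rightarrow> 'e \<Rightarrow> real"
  assumes G: "bilinear G" and sym: "\<And>u v. G u v = G v u" and pos: "\<And>u. u \<noteq> 0 \<Longrightarrow> G u u > 0"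
  obtains P Q :: "'e \<Rightarrow> 'e" where "linear P" "linear Q" "\<And>u. P (Q u) = u" "\<And>u. Q (P u) = u" "\<And>u v. G (P u) (P v) = u \<bullet> v"
proof -
  \<comment> \<open>The vectors are indexed by a subset of \<open>Basis\<close>, so fewer than
    \<open>DIM('e)\<close> of them have been chosen before each step and a vector outside their span
    exists.\<close>
  have "\<exists>f. \<forall>i\<in>B. \<forall>j\<in>B. G (f i) (f j) = (if i = j then 1 else 0)" if "B \<subseteq> Basis" for B :: "'e set"
    using finite_subset[OF that finite_Basis] that
  proof (induction B rule: finite_induct)
    case empty show ?case by auto
  next
    case (insert b B)
    have "B \<subseteq> Basis" using insert.prems by blast
    from insert.IH[OF this] obtain f where f: "\<forall>i\<in>B. \<forall>j\<in>B. G (f i) (f j) = (if i = j then 1 else 0)" by blast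
    have "dim (span (f ` B)) \<le> card B"
      using dim_le_card'[of "f ` B"] card_image_le[OF insert.hyps(1), of f] insert.hyps(1) by simp
    also have "card B < card (insert b B)" using insert.hyps by simp
    also have "\<dots> \<le> DIM('e)" using insert.prems by (intro card_mono) auto
    finally have lt: "dim (span (f ` B)) < DIM('e)" .
    have "span (f ` B) \<noteq> UNIV"
    proof
      assume eq: "span (f ` B) = UNIV"
      show False using lt unfolding eq by simp
    qed
    then obtain w where w: "w \<notin> span (f ` B)" by auto
    define w1 where "w1 = w - (\<Sum>i\<in>B. G w (f i) *\<^sub>R f i)"
    have "(\<Sum>i\<in>B. G w (f i) *\<^sub>R f i) \<in> span (f ` B)"
      by (intro span_sum span_scale span_base) auto
    then have "w1 \<noteq> 0" using w unfolding w1_def by auto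
    then have p: "G w1 w1 > 0" by (rule pos)
    have o: "G w1 (f j) = 0" if j: "j \<in> B" for j
    proof -
      have "G w1 (f j) = G w (f j) - (\<Sum>i\<in>B. G w (f i) * G (f i) (f j))"
        unfolding w1_def using G
        by (simp add: bilinear_lsub bilinear_lmul linear_sum[of "\<lambda>u. G u (f j)"] bilinear_def linear_scale)
      also have "(\<Sum>i\<in>B. G w (f i) * G (f i) (f j)) = (\<Sum>i\<in>B. if i = j then G w (f j) else 0)"
        using f j by (intro sum.cong) auto
      finally show ?thesis using j insert.hyps by simp
    qed
    define w2 where "w2 = (1 / sqrt (G w1 w1)) *\<^sub>R w1"
    have w2: "G w2 w2 = 1" "\<And>j. j \<in> B \<Longrightarrow> G w2 (f j) = 0" "\<And>j. j \<in> B \<Longrightarrow> G (f j) w2 = 0"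
      using p o sym by (auto simp: w2_def bilinear_lmul[OF G] bilinear_rmul[OF G] real_div_sqrt divide_simps)
    show ?case
      by (rule exI[of _ "f(b := w2)"]) (use f w2 insert.hyps in auto)
  qed
  from this[OF subset_refl] obtain f :: "'e \<Rightarrow> 'e" where f: "\<And>i j. i \<in> Basis \<Longrightarrow> j \<in> Basis \<Longrightarrow> G (f i) (f j) = (if i = j then 1 else 0)"
    by blast
  define P where "P u = (\<Sum>i\<in>Basis. (u \<bullet> i) *\<^sub>R f i)" for u :: 'e
  have P: "linear P" unfolding P_def
    by (auto intro!: linearI simp: inner_add_left scaleR_add_left sum.distrib scaleR_sum_right)
  have GP: "G (P u) (P v) = u \<bullet> v" for u v
  proof -
    have "G (P u) (P v) = (\<Sum>i\<in>Basis. \<Sum>j\<in>Basis. (u \<bullet> i) * ((v \<bullet> j) * G (f i) (f j)))"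
      unfolding P_def bilinear_sum[OF G] sum.cartesian_product
      by (simp add: split_def bilinear_lmul[OF G] bilinear_rmul[OF G] mult.left_commute)
    also have "\<dots> = (\<Sum>i\<in>Basis. \<Sum>j\<in>Basis. if i = j then (u \<bullet> i) * (v \<bullet> j) else 0)"
      using f by (intro sum.cong) auto
    finally show ?thesis by (simp add: euclidean_inner[of u v])
  qed
  have "inj P"
  proof (rule linear_injective_0[THEN iffD2, OF P], safe)
    fix u assume "P u = 0"
    then show "u = 0" using GP[of u u] by (simp add: bilinear_lzero[OF G])
  qed
  then obtain Q where Q: "linear Q" "\<forall>x. Q (P x) = x" "\<forall>x. P (Q x) = x"
    using linear_injective_isomorphism[OF P] by blast
  show ?thesis by (rule that[OF P Q(1) _ _ GP]) (simp_all add: Q)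
qed

text \<open>Cyclicity of the trace moves \<open>P\<close> from one side of
  \<open>Q \<circ> A\<close> to the other, which exchanges the standard basis for the
  \<open>G\<close>-orthonormal frame \<open>P e\<close>.\<close>

lemma tr_orthonormal_frame:
  fixes P Q A :: "'e::euclidean_space \<Rightarrow> 'e"
  assumes "linear P" "linear Q" "\<And>u. P (Q u) = u" "\<And>u. Q (P u) = u" "\<And>u v. G (P u) (P v) = u \<bullet> v"
    and "linear A"
  shows "tr A = (\<Sum>e\<in>Basis. G (A (P e)) (P e))"
proof -
  have "tr A = tr (\<lambda>e. P (Q (A e)))" by (simp add: assms)
  also have "\<dots> = tr (\<lambda>e. (Q \<circ> A) (P e))"
    using tr_commute[OF assms(1), of "Q \<circ> A"] assms by (simp add: linear_compose)
  also have "\<dots> = (\<Sum>e\<in>Basis. G (A (P e)) (P e))" unfolding tr_def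
    by (intro sum.cong) (simp_all add: assms(5)[symmetric] assms(3))
  finally show ?thesis .
qed

lemma tr_conjugate:
  fixes P :: "'e::euclidean_space \<Rightarrow> 'e"
  assumes "linear P" "linear Q" "\<And>u. Q (P u) = u" "linear A" "\<And>u. B (P u) = P (A u)" "linear B" "\<And>u. P (Q u) = u"
  shows "tr B = tr A"
proof -
  have "B = (\<lambda>e. P ((A \<circ> Q) e))"
    using assms(5)[of "Q _"] unfolding assms(7) by auto
  then have "tr B = tr (\<lambda>e. P ((A \<circ> Q) e))" by simp
  also have "\<dots> = tr (\<lambda>e. (A \<circ> Q) (P e))" using tr_commute[OF assms(1), of "A \<circ> Q"] assms by (simp add: linear_compose)
  finally show ?thesis by (simp add: assms)
qed

section \<open>Riemannian metrics on open sets\<close>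

locale local_metric =
  fixes U :: "'e::euclidean_space set" and G :: "'e \<Rightarrow> 'e \<Rightarrow> 'e \<Rightarrow> real"
  assumes open_U: "open U"
    and G_bilinear: "x \<in> U \<Longrightarrow> bilinear (G x)"
    and G_smooth: "smooth_on U (\<lambda>x. G x u v)"
    and G_sym: "x \<in> U \<Longrightarrow> G x u v = G x v u"
    and G_pos: "x \<in> U \<Longrightarrow> u \<noteq> 0 \<Longrightarrow> G x u u > 0"
begin

definition dG :: "'e \<Rightarrow> 'e \<Rightarrow> 'e \<Rightarrow> 'e \<Rightarrow> real" where
  "dG x w u v = \<D> (\<lambda>y. G y u v) x w"

lemma dG: "x \<in> U \<Longrightarrow> ((\<lambda>y. G y u v) has_derivative (\<lambda>w. dG x w u v)) (at x)"
  using smooth_on_has_derivative[OF G_smooth] by (simp add: dG_def)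

lemma dG_bilinear: "x \<in> U \<Longrightarrow> bilinear (dG x w)"
  by (rule bilinear_derivative[OF open_U _ G_bilinear dG])

lemma dG_linear: "x \<in> U \<Longrightarrow> linear (\<lambda>w. dG x w u v)"
  using dG has_derivative_linear by blast

lemma frechet_cong_U:
  assumes "x \<in> U" "(f has_derivative f') (at x)" "\<And>y. y \<in> U \<Longrightarrow> f y = g y"
  shows "(g has_derivative f') (at x)"
  by (rule has_derivative_transform_within_open[OF assms(2) open_U assms(1)]) (rule assms(3))

lemma dG_sym: assumes "x \<in> U" shows "dG x w u v = dG x w v u"
  using fun_cong[OF has_derivative_unique[OF dG[OF assms, of u v] frechet_cong_U[OF assms dG[OF assms, of v u] G_sym]], of w]
  by simp

lemma dG_smooth: "smooth_on U (\<lambda>x. dG x w u v)"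
  unfolding dG_def by (rule smooth_on_derivative[OF G_smooth])

lemmas G_simps = bilinear_ladd[OF G_bilinear] bilinear_radd[OF G_bilinear]
  bilinear_lsub[OF G_bilinear] bilinear_rsub[OF G_bilinear]
  bilinear_lneg[OF G_bilinear] bilinear_rneg[OF G_bilinear]
  bilinear_lmul[OF G_bilinear] bilinear_rmul[OF G_bilinear]
  bilinear_lzero[OF G_bilinear] bilinear_rzero[OF G_bilinear]

lemmas dG_simps = bilinear_ladd[OF dG_bilinear] bilinear_radd[OF dG_bilinear]
  bilinear_lsub[OF dG_bilinear] bilinear_rsub[OF dG_bilinear]
  bilinear_lneg[OF dG_bilinear] bilinear_rneg[OF dG_bilinear]
  bilinear_lmul[OF dG_bilinear] bilinear_rmul[OF dG_bilinear]
  linear_add[OF dG_linear] linear_diff[OF dG_linear] linear_neg[OF dG_linear] linear_scale[OF dG_linear]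
  linear_0[OF dG_linear]

lemma G_eqI: assumes "x \<in> U" "\<And>w. G x z w = G x z' w" shows "z = z'"
proof (rule ccontr)
  assume "z \<noteq> z'"
  then have "G x (z - z') (z - z') > 0" using G_pos assms(1) by simp
  then show False using assms by (simp add: G_simps)
qed

text \<open>Riesz representation: the Gram map \<open>S\<close> is injective because
  \<open>G\<close> is positive, hence surjective in finite dimension.\<close>

lemma G_represent:
  assumes x: "x \<in> U" and k: "linear k"
  obtains z where "\<And>w. G x z w = k w"
proof -
  define S where "S u = (\<Sum>e\<in>Basis. G x u e *\<^sub>R e)" for u
  have S: "linear S" unfolding S_def
    by (auto intro!: linearI simp: G_simps x scaleR_add_left sum.distrib scaleR_sum_right)
  have Si: "S u \<bullet> w = G x u w" for u w
  proof -
    have l: "linear (G x u)" using G_bilinear[OF x] by (simp add: bilinear_def)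
    show ?thesis unfolding linear_expand[OF l, of w] by (simp add: S_def inner_sum_left inner_commute[of w])
  qed
  have "inj S"
  proof (rule linear_injective_0[THEN iffD2, OF S], safe)
    fix u assume "S u = 0"
    then have "G x u u = 0" using Si[of u u] by simp
    then show "u = 0" using G_pos[OF x] by (metis less_irrefl)
  qed
  then have "surj S" using linear_injective_imp_surjective[OF S] by simp
  then obtain z where z: "S z = (\<Sum>e\<in>Basis. k e *\<^sub>R e)" by (metis surjD)
  have "G x z w = k w" for w
  proof -
    have "G x z w = (\<Sum>e\<in>Basis. (w \<bullet> e) * k e)"
      unfolding Si[symmetric] z by (simp add: inner_sum_left inner_commute[of w] mult.commute)
    then show ?thesis by (simp add: linear_expand[OF k, of w] mult.commute)
  qed
  then show ?thesis using that by blast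
qed

text \<open>Apply the inverse function theorem to \<open>(y, u) \<mapsto> (y, G y u)\<close>.\<close>

lemma G_solution_differentiable:
  assumes k: "\<And>y w. y \<in> U \<Longrightarrow> (\<lambda>y. k y w) differentiable (at y)"
    and z: "\<And>y w. y \<in> U \<Longrightarrow> G y (z y) w = k y w" and x: "x \<in> U"
  shows "z differentiable (at x)"
proof -
  define S where "S = U \<times> (UNIV :: 'e set)"
  have S: "open S" unfolding S_def using open_U by (simp add: open_Times)
  define f where "f p = (fst p, \<Sum>e\<in>Basis. G (fst p) (snd p) e *\<^sub>R e)" for p :: "'e \<times> 'e"
  define f' where "f' p h = (fst h, \<Sum>e\<in>Basis. (dG (fst p) (fst h) (snd p) e + G (fst p) (snd h) e) *\<^sub>R e)" for p h :: "'e \<times> 'e"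
  have f': "(f has_derivative f' p) (at p)" if p: "p \<in> S" for p
  proof -
    have pU: "fst p \<in> U" using p by (auto simp: S_def)
    have "((\<lambda>q. G (fst q) (snd q) e) has_derivative (\<lambda>h. dG (fst p) (fst h) (snd p) e + G (fst p) (snd h) e)) (at p)" for e
    proof (rule has_derivative_linear_field[OF S p, where L="\<lambda>q u. G (fst q) u e" and Y=snd])
      show "linear (\<lambda>u. G (fst y) u e)" if "y \<in> S" for y
        using that G_bilinear[of "fst y"] by (auto simp: S_def bilinear_def)
      show "((\<lambda>y. G (fst y) u e) has_derivative (\<lambda>w. dG (fst p) (fst w) u e)) (at p)" for u
        using has_derivative_compose[OF has_derivative_fst[OF has_derivative_ident], of "\<lambda>y. G y u e" "\<lambda>w. dG (fst p) w u e" p UNIV]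
          dG[OF pU] by simp
    qed (auto intro!: derivative_eq_intros)
    then show ?thesis unfolding f_def f'_def
      by (intro has_derivative_Pair has_derivative_sum has_derivative_scaleR_left)
        (auto intro!: derivative_eq_intros)
  qed
  have comp: "(\<Sum>e\<in>Basis. h e *\<^sub>R e) \<bullet> e' = h e'" if "e' \<in> Basis" for h :: "'e \<Rightarrow> real" and e'
    using that by (simp add: inner_sum_left inner_Basis if_distrib cong: if_cong)
  have lin0: "u = 0" if "y \<in> U" "(\<Sum>e\<in>Basis. G y u e *\<^sub>R e) = 0" for y u
  proof -
    have b: "G y u e = 0" if "e \<in> Basis" for e
      using comp[OF that, of "G y u"] \<open>(\<Sum>e\<in>Basis. G y u e *\<^sub>R e) = 0\<close> by simp
    have l: "linear (G y u)" using G_bilinear[OF that(1)] by (simp add: bilinear_def)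
    have "G y u u = 0" using linear_expand[OF l, of u] by (simp add: b)
    then show ?thesis using G_pos[OF that(1)] by (metis less_irrefl)
  qed
  have inj: "inj_on f S"
  proof (rule inj_onI)
    fix p q assume pq: "p \<in> S" "q \<in> S" "f p = f q"
    then have a: "fst p = fst q" "(\<Sum>e\<in>Basis. G (fst p) (snd p) e *\<^sub>R e) = (\<Sum>e\<in>Basis. G (fst p) (snd q) e *\<^sub>R e)"
      by (auto simp: f_def)
    have pU: "fst p \<in> U" using pq by (auto simp: S_def)
    have "(\<Sum>e\<in>Basis. G (fst p) (snd p - snd q) e *\<^sub>R e) = 0"
      using a(2) by (simp add: G_simps pU scaleR_diff_left sum_subtractf)
    then have "snd p - snd q = 0" by (rule lin0[OF pU])
    then show "p = q" using a(1) by (simp add: prod_eq_iff)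
  qed
  define p where "p = (x, z x)"
  have p: "p \<in> S" using x by (simp add: p_def S_def)
  have l': "linear (f' p)" using f'[OF p] by (rule has_derivative_linear)
  have "inj (f' p)"
  proof (rule linear_injective_0[THEN iffD2, OF l'], safe)
    fix a b assume "f' p (a, b) = 0"
    then have "a = 0" "(\<Sum>e\<in>Basis. G x b e *\<^sub>R e) = 0"
      using x by (auto simp: f'_def p_def zero_prod_def dG_simps)
    then show "(a, b) = 0" using lin0[OF x] by (simp add: zero_prod_def)
  qed
  then obtain g' where g': "linear g'" "\<forall>v. f' p (g' v) = v"
    using linear_injective_isomorphism[OF l'] by blast
  have dg: "(inv_into S f has_derivative g') (at (f p))"
    by (rule has_derivative_inverse_on[OF S f' _ _ p]) (use g' inj in auto)
  \<comment> \<open>\<open>h\<close> is the image under \<open>f\<close> of the graph of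
    \<open>z\<close>, so \<open>z\<close> is recovered as the second component of the inverse of
    \<open>f\<close> applied to \<open>h\<close>.\<close>
  define h where "h y = (y, \<Sum>e\<in>Basis. k y e *\<^sub>R e)" for y
  have fz: "f (y, z y) = h y" if "y \<in> U" for y
    using z[OF that] by (simp add: f_def h_def)
  have "((\<lambda>y. k y e) has_derivative \<D> (\<lambda>y. k y e) x) (at x)" for e
    using k[OF x] frechet_derivative_works by blast
  then have hd: "(h has_derivative (\<lambda>w. (w, \<Sum>e\<in>Basis. \<D> (\<lambda>y. k y e) x w *\<^sub>R e))) (at x)"
    unfolding h_def by (intro has_derivative_Pair has_derivative_sum has_derivative_scaleR_left)
      (auto intro!: derivative_eq_intros)
  have "(\<lambda>y. snd (inv_into S f (h y))) differentiable (at x)"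
    using has_derivative_snd[OF has_derivative_compose[OF hd, of "inv_into S f" g']] dg fz[OF x]
    unfolding p_def differentiable_def by auto
  moreover have "snd (inv_into S f (h y)) = z y" if "y \<in> U" for y
    using inv_into_f_f[OF inj, of "(y, z y)"] fz[OF that] that by (simp add: S_def)
  ultimately show ?thesis unfolding differentiable_def
    using frechet_cong_U[OF x] by blast
qed

section \<open>The Levi-Civita connection in coordinates\<close>

abbreviation \<Gamma> :: "'e \<Rightarrow> 'e \<Rightarrow> 'e \<Rightarrow> 'e" where "\<Gamma> \<equiv> christoffel G"

text \<open>The description in \<open>christoffel\<close> denotes: the Koszul expression is linear
  in \<open>w\<close>, so some vector represents it, and positivity of the metric makes that vector
  unique.\<close>

lemma \<Gamma>_koszul:
  assumes x: "x \<in> U"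
  shows "2 * G x (\<Gamma> x u v) w = dG x u v w + dG x v u w - dG x w u v"
proof -
  have "linear (\<lambda>w. (dG x u v w + dG x v u w - dG x w u v) / 2)"
    by (rule linearI) (simp_all add: dG_simps x add_divide_distrib diff_divide_distrib algebra_simps)
  then obtain z where z: "\<And>w. G x z w = (dG x u v w + dG x v u w - dG x w u v) / 2"
    using G_represent[OF x] by blast
  have "\<forall>w. 2 * G x (\<Gamma> x u v) w =
      \<D> (\<lambda>y. G y v w) x u
    + \<D> (\<lambda>y. G y u w) x v
    - \<D> (\<lambda>y. G y u v) x w"
    unfolding christoffel_def
  proof (rule theI[of _ z])
    show "z' = z" if "\<forall>w. 2 * G x z' w =
      \<D> (\<lambda>y. G y v w) x u
    + \<D> (\<lambda>y. G y u w) x v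
    - \<D> (\<lambda>y. G y u v) x w" for z'
    proof (rule G_eqI[OF x])
      show "G x z' w = G x z w" for w
        using that[rule_format, of w] z[of w] by (simp add: dG_def)
    qed
  qed (simp add: z dG_def)
  then show ?thesis by (simp add: dG_def)
qed

lemma \<Gamma>_eqI:
  assumes "x \<in> U" "\<And>w. 2 * G x z w = dG x u v w + dG x v u w - dG x w u v"
  shows "\<Gamma> x u v = z"
proof (rule G_eqI[OF assms(1)])
  show "G x (\<Gamma> x u v) w = G x z w" for w
    using \<Gamma>_koszul[OF assms(1), of u v w] assms(2)[of w] by simp
qed

lemma \<Gamma>_sym: "x \<in> U \<Longrightarrow> \<Gamma> x u v = \<Gamma> x v u"
  by (rule \<Gamma>_eqI) (simp_all add: \<Gamma>_koszul dG_sym[of x _ u v])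

lemma \<Gamma>_bilinear: assumes x: "x \<in> U" shows "bilinear (\<Gamma> x)"
proof -
  have 1: "\<Gamma> x (u + u') v = \<Gamma> x u v + \<Gamma> x u' v" for u u' v
    by (rule \<Gamma>_eqI[OF x]) (simp add: G_simps dG_simps x \<Gamma>_koszul algebra_simps)
  have 2: "\<Gamma> x (r *\<^sub>R u) v = r *\<^sub>R \<Gamma> x u v" for r u v
  proof (rule \<Gamma>_eqI[OF x])
    have "2 * G x (r *\<^sub>R \<Gamma> x u v) w = r * (2 * G x (\<Gamma> x u v) w)" for w by (simp add: G_simps x)
    then show "2 * G x (r *\<^sub>R \<Gamma> x u v) w = dG x (r *\<^sub>R u) v w + dG x v (r *\<^sub>R u) w - dG x w (r *\<^sub>R u) v" for w
      by (simp add: dG_simps x \<Gamma>_koszul algebra_simps)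
  qed
  have "linear (\<lambda>u. \<Gamma> x u v)" for v by (rule linearI) (fact 1 2)+
  moreover from this have "linear (\<Gamma> x v)" for v
    unfolding \<Gamma>_sym[OF x, of v] .
  ultimately show ?thesis unfolding bilinear_def by blast
qed

lemmas \<Gamma>_simps = bilinear_ladd[OF \<Gamma>_bilinear] bilinear_radd[OF \<Gamma>_bilinear]
  bilinear_lsub[OF \<Gamma>_bilinear] bilinear_rsub[OF \<Gamma>_bilinear]
  bilinear_lneg[OF \<Gamma>_bilinear] bilinear_rneg[OF \<Gamma>_bilinear]
  bilinear_lmul[OF \<Gamma>_bilinear] bilinear_rmul[OF \<Gamma>_bilinear]
  bilinear_lzero[OF \<Gamma>_bilinear] bilinear_rzero[OF \<Gamma>_bilinear]

lemma metric_compatible: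
  assumes x: "x \<in> U"
  shows "dG x u v w = G x (\<Gamma> x u v) w + G x v (\<Gamma> x u w)"
  using \<Gamma>_koszul[OF x, of u v w] \<Gamma>_koszul[OF x, of u w v]
    dG_sym[OF x, of u w v] G_sym[OF x, of v "\<Gamma> x u w"] by linarith

lemma dG_differentiable: "y \<in> U \<Longrightarrow> (\<lambda>y. dG y a b c) differentiable (at y)"
  by (rule smooth_on_differentiable[OF dG_smooth])

text \<open>As \<open>\<Gamma>\<close> is given by a definite description, its regularity has to
  come from Koszul's formula, read as a linear system with smooth data.\<close>

lemma \<Gamma>_differentiable:
  assumes x: "x \<in> U" shows "(\<lambda>y. \<Gamma> y u v) differentiable (at x)"
proof (rule G_solution_differentiable[OF _ _ x])
  show "G y (\<Gamma> y u v) w = (dG y u v w + dG y v u w - dG y w u v) * (1/2)" if "y \<in> U" for y w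
    using \<Gamma>_koszul[OF that, of u v w] by simp
  show "(\<lambda>y. (dG y u v w + dG y v u w - dG y w u v) * (1/2)) differentiable (at y)" if "y \<in> U" for y w
    using that by (intro differentiable_mult differentiable_const differentiable_diff differentiable_add dG_differentiable)
qed

definition d\<Gamma> :: "'e \<Rightarrow> 'e \<Rightarrow> 'e \<Rightarrow> 'e \<Rightarrow> 'e" where
  "d\<Gamma> x w u v = \<D> (\<lambda>y. \<Gamma> y u v) x w"

lemma d\<Gamma>: "x \<in> U \<Longrightarrow> ((\<lambda>y. \<Gamma> y u v) has_derivative (\<lambda>w. d\<Gamma> x w u v)) (at x)"
  using \<Gamma>_differentiable frechet_derivative_works unfolding d\<Gamma>_def by blast

lemma d\<Gamma>_linear: "x \<in> U \<Longrightarrow> linear (\<lambda>w. d\<Gamma> x w u v)"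
  using d\<Gamma> has_derivative_linear by blast

lemma d\<Gamma>_bilinear: "x \<in> U \<Longrightarrow> bilinear (d\<Gamma> x w)"
  by (rule bilinear_derivative[OF open_U _ \<Gamma>_bilinear d\<Gamma>])

lemma d\<Gamma>_sym: assumes "x \<in> U" shows "d\<Gamma> x w u v = d\<Gamma> x w v u"
  using fun_cong[OF has_derivative_unique[OF d\<Gamma>[OF assms, of u v] frechet_cong_U[OF assms d\<Gamma>[OF assms, of v u] \<Gamma>_sym]], of w]
  by simp

lemma has_derivative_G:
  assumes x: "x \<in> U" and Y: "(Y has_derivative Y') (at x)" and Z: "(Z has_derivative Z') (at x)"
  shows "((\<lambda>y. G y (Y y) (Z y)) has_derivative (\<lambda>w. dG x w (Y x) (Z x) + G x (Y' w) (Z x) + G x (Y x) (Z' w))) (at x)"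
  by (rule has_derivative_bilinear_field[OF open_U x G_bilinear dG[OF x] Y Z])

lemma has_derivative_\<Gamma>:
  assumes x: "x \<in> U" and Y: "(Y has_derivative Y') (at x)" and Z: "(Z has_derivative Z') (at x)"
  shows "((\<lambda>y. \<Gamma> y (Y y) (Z y)) has_derivative (\<lambda>w. d\<Gamma> x w (Y x) (Z x) + \<Gamma> x (Y' w) (Z x) + \<Gamma> x (Y x) (Z' w))) (at x)"
  by (rule has_derivative_bilinear_field[OF open_U x \<Gamma>_bilinear d\<Gamma>[OF x] Y Z])

text \<open>\<open>d\<Gamma>\<close> solves an equation of the same form as \<open>\<Gamma>\<close>, so it is differentiable too.\<close>

lemma d\<Gamma>_continuous: "continuous_on U (\<lambda>x. d\<Gamma> x a u v)"
proof -
  have eq: "G x (d\<Gamma> x a u v) w = (\<D> (\<lambda>y. dG y u v w) x a + \<D> (\<lambda>y. dG y v u w) x a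
       - \<D> (\<lambda>y. dG y w u v) x a) * (1/2) - dG x a (\<Gamma> x u v) w" if x: "x \<in> U" for x w
  proof -
    have "((\<lambda>y. (dG y u v w + dG y v u w - dG y w u v) * (1/2)) has_derivative
      (\<lambda>a. (\<D> (\<lambda>y. dG y u v w) x a + \<D> (\<lambda>y. dG y v u w) x a
       - \<D> (\<lambda>y. dG y w u v) x a) * (1/2))) (at x)" (is "(_ has_derivative ?k') _")
      using x by (intro has_derivative_mult_left has_derivative_diff has_derivative_add smooth_on_has_derivative[OF dG_smooth])
    moreover have "(dG y u v w + dG y v u w - dG y w u v) * (1/2) = G y (\<Gamma> y u v) w" if "y \<in> U" for y
      using \<Gamma>_koszul[OF that, of u v w] by simp
    ultimately have "((\<lambda>y. G y (\<Gamma> y u v) w) has_derivative ?k') (at x)"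
      by (rule frechet_cong_U[OF x])
    from has_derivative_unique[OF this has_derivative_G[OF x d\<Gamma>[OF x] has_derivative_const]]
    have "?k' a = dG x a (\<Gamma> x u v) w + G x (d\<Gamma> x a u v) w + G x (\<Gamma> x u v) 0"
      by (rule fun_cong)
    then show ?thesis by (simp add: G_simps x field_simps)
  qed
  have d: "(\<lambda>y. dG y a (\<Gamma> y u v) w) differentiable (at x)" if x: "x \<in> U" for x w
  proof -
    have "((\<lambda>y. dG y a u v) has_derivative (\<lambda>b. \<D> (\<lambda>y. dG y a u v) x b)) (at x)" for u v
      by (rule smooth_on_has_derivative[OF dG_smooth x])
    from has_derivative_bilinear_field[OF open_U x dG_bilinear this d\<Gamma>[OF x] has_derivative_const]
    show ?thesis unfolding differentiable_def by blast
  qed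
  have "(\<lambda>x. d\<Gamma> x a u v) differentiable (at x)" if x: "x \<in> U" for x
    by (rule G_solution_differentiable[OF _ eq x])
      (intro differentiable_mult differentiable_const differentiable_diff differentiable_add d
       smooth_on_differentiable[OF smooth_on_derivative[OF dG_smooth]]; assumption)+
  then show ?thesis
    by (meson continuous_at_imp_continuous_on differentiable_imp_continuous_within)
qed

definition nabla :: "('e \<Rightarrow> 'e) \<Rightarrow> 'e \<Rightarrow> 'e \<Rightarrow> 'e" where
  "nabla X x u = \<D> X x u + \<Gamma> x u (X x)"

end

text \<open>Differentiating the isometry relation introduces second derivatives of
  \<open>\<psi>\<close>. In Koszul's combination they cancel in pairs by symmetry, except those in
  the arguments \<open>u\<close> and \<open>v\<close>, which form the inhomogeneous term of the
  transformation law.\<close>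

lemma chart_change_\<Gamma>:
  fixes U V :: "'e::euclidean_space set"
  assumes "local_metric U G" and "local_metric V G'"
    and \<psi>: "smooth_on U \<psi>" and maps: "\<And>y. y \<in> U \<Longrightarrow> \<psi> y \<in> V"
    and iso: "\<And>y u v. y \<in> U \<Longrightarrow> G y u v = G' (\<psi> y) (\<D> \<psi> y u) (\<D> \<psi> y v)"
    and surj: "surj (\<D> \<psi> x)" and x: "x \<in> U"
  shows "\<D> \<psi> x (christoffel G x u v) =
    christoffel G' (\<psi> x) (\<D> \<psi> x u) (\<D> \<psi> x v)
    + \<D> (\<lambda>y. \<D> \<psi> y v) x u"
proof -
  interpret A: local_metric U G by fact
  interpret B: local_metric V G' by fact
  define D where "D y u = \<D> \<psi> y u" for y u
  define D2 where "D2 u v = \<D> (\<lambda>y. D y v) x u" for u v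
  have D: "(\<psi> has_derivative D y) (at y)" if "y \<in> U" for y
    unfolding D_def using smooth_on_has_derivative[OF \<psi> that] by simp
  have D2: "((\<lambda>y. D y v) has_derivative (\<lambda>u. D2 u v)) (at x)" for v
    unfolding D_def D2_def by (rule smooth_on_has_derivative[OF smooth_on_derivative[OF \<psi>] x])
  have D2_sym: "D2 u v = D2 v u" for u v
    unfolding D2_def D_def by (rule symmetric_second_derivative[OF A.open_U x \<psi>])
  have \<psi>x: "\<psi> x \<in> V" using maps x by simp
  have dG: "A.dG x w u v = B.dG (\<psi> x) (D x w) (D x u) (D x v)
      + G' (\<psi> x) (D2 w u) (D x v) + G' (\<psi> x) (D x u) (D2 w v)" for w u v
  proof -
    have 1: "((\<lambda>y. G' (\<psi> y) (D y u) (D y v)) has_derivative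
        (\<lambda>w. B.dG (\<psi> x) (D x w) (D x u) (D x v)
          + G' (\<psi> x) (D2 w u) (D x v) + G' (\<psi> x) (D x u) (D2 w v))) (at x)"
    proof (rule has_derivative_bilinear_field[OF A.open_U x _ _ D2 D2, where B="\<lambda>y. G' (\<psi> y)"])
      show "bilinear (G' (\<psi> y))" if "y \<in> U" for y by (rule B.G_bilinear[OF maps[OF that]])
      show "((\<lambda>y. G' (\<psi> y) u v) has_derivative (\<lambda>w. B.dG (\<psi> x) (D x w) u v)) (at x)" for u v
        by (rule has_derivative_compose[OF D[OF x] B.dG[OF \<psi>x]])
    qed
    have "((\<lambda>y. G y u v) has_derivative
        (\<lambda>w. B.dG (\<psi> x) (D x w) (D x u) (D x v)
          + G' (\<psi> x) (D2 w u) (D x v) + G' (\<psi> x) (D x u) (D2 w v))) (at x)"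
      by (rule A.frechet_cong_U[OF x 1]) (simp add: iso D_def)
    from fun_cong[OF has_derivative_unique[OF A.dG[OF x] this], of w] show ?thesis .
  qed
  have "D x (christoffel G x u v) = christoffel G' (\<psi> x) (D x u) (D x v) + D2 u v"
  proof (rule B.G_eqI[OF \<psi>x])
    fix w' obtain w where w: "w' = D x w" using surj unfolding D_def by (metis surjD)
    have "2 * G' (\<psi> x) (D x (christoffel G x u v)) (D x w) = 2 * G x (christoffel G x u v) w"
      by (simp add: iso x D_def)
    also have "\<dots> = A.dG x u v w + A.dG x v u w - A.dG x w u v" by (rule A.\<Gamma>_koszul[OF x])
    also have "\<dots> = 2 * G' (\<psi> x) (christoffel G' (\<psi> x) (D x u) (D x v)) (D x w) + 2 * G' (\<psi> x) (D2 u v) (D x w)"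
      unfolding dG B.\<Gamma>_koszul[OF \<psi>x]
      using B.G_sym[OF \<psi>x, of "D x v" "D2 u w"] B.G_sym[OF \<psi>x, of "D x u" "D2 v w"]
      by (simp add: D2_sym[of v u] D2_sym[of w u] D2_sym[of w v])
    finally show "G' (\<psi> x) (D x (christoffel G x u v)) w' = G' (\<psi> x) (christoffel G' (\<psi> x) (D x u) (D x v) + D2 u v) w'"
      by (simp add: w B.G_simps \<psi>x)
  qed
  then show ?thesis by (simp add: D_def D2_def)
qed

text \<open>Differentiating \<open>X' (\<psi> y) = \<D> \<psi> y (X y)\<close> produces exactly the
  second derivative of \<open>\<psi>\<close> that occurs in \<open>chart_change_\<Gamma>\<close>.
  Hence the differential of \<open>\<psi>\<close> conjugates the two covariant derivatives, and the
  trace is unchanged.\<close>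

lemma chart_change_divergence:
  fixes U V :: "'e::euclidean_space set"
  assumes G: "local_metric U G" and G': "local_metric V G'"
    and \<psi>: "smooth_on U \<psi>" and maps: "\<And>y. y \<in> U \<Longrightarrow> \<psi> y \<in> V"
    and iso: "\<And>y u v. y \<in> U \<Longrightarrow> G y u v = G' (\<psi> y) (\<D> \<psi> y u) (\<D> \<psi> y v)"
    and Q: "linear Q" "\<And>u. \<D> \<psi> x (Q u) = u" "\<And>u. Q (\<D> \<psi> x u) = u"
    and x: "x \<in> U"
    and X: "X differentiable (at x)" and X': "X' differentiable (at (\<psi> x))"
    and rel: "\<And>y. y \<in> U \<Longrightarrow> X' (\<psi> y) = \<D> \<psi> y (X y)"
  shows "tr (local_metric.nabla G X x) = tr (local_metric.nabla G' X' (\<psi> x))"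
proof -
  interpret A: local_metric U G by fact
  interpret B: local_metric V G' by fact
  define D where "D y u = \<D> \<psi> y u" for y u
  define D2 where "D2 u v = \<D> (\<lambda>y. D y v) x u" for u v
  have D: "(\<psi> has_derivative D y) (at y)" if "y \<in> U" for y
    unfolding D_def using smooth_on_has_derivative[OF \<psi> that] by simp
  have D2: "((\<lambda>y. D y v) has_derivative (\<lambda>u. D2 u v)) (at x)" for v
    unfolding D_def D2_def by (rule smooth_on_has_derivative[OF smooth_on_derivative[OF \<psi>] x])
  have dX: "(X has_derivative \<D> X x) (at x)"
    and dX': "(X' has_derivative \<D> X' (\<psi> x)) (at (\<psi> x))"
    using X X' frechet_derivative_works by auto
  have \<psi>x: "\<psi> x \<in> V" using maps x by simp
  have 1: "((\<lambda>y. D y (X y)) has_derivative (\<lambda>w. D2 w (X x) + D x (\<D> X x w))) (at x)"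
    by (rule has_derivative_linear_field[OF A.open_U x _ D2 dX]) (rule has_derivative_linear[OF D])
  have "((\<lambda>y. X' (\<psi> y)) has_derivative (\<lambda>w. D2 w (X x) + D x (\<D> X x w))) (at x)"
    by (rule A.frechet_cong_U[OF x 1]) (simp add: rel D_def)
  from has_derivative_unique[OF has_derivative_compose[OF D[OF x] dX'] this]
  have d: "\<D> X' (\<psi> x) (D x w) = D2 w (X x) + D x (\<D> X x w)" for w
    by (rule fun_cong)
  have s: "surj (\<D> \<psi> x)" using Q(2) by (metis surjI)
  have lD: "linear (D x)" by (rule has_derivative_linear[OF D[OF x]])
  have "B.nabla X' (\<psi> x) (D x u) = D x (A.nabla X x u)" for u
  proof -
    have "D x (christoffel G x u (X x)) = christoffel G' (\<psi> x) (D x u) (D x (X x)) + D2 u (X x)"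
      using chart_change_\<Gamma>[OF G G' \<psi> maps iso s x] by (simp add: D_def D2_def)
    then show ?thesis
      unfolding A.nabla_def B.nabla_def d linear_add[OF lD] using rel[OF x] by (simp add: D_def)
  qed
  moreover have "linear (A.nabla X x)" unfolding A.nabla_def
    using has_derivative_linear[OF dX] A.\<Gamma>_bilinear[OF x] by (intro linear_compose_add) (auto simp: bilinear_def)
  moreover have "linear (B.nabla X' (\<psi> x))" unfolding B.nabla_def
    using has_derivative_linear[OF dX'] B.\<Gamma>_bilinear[OF \<psi>x] by (intro linear_compose_add) (auto simp: bilinear_def)
  ultimately show ?thesis
    using tr_conjugate[OF lD Q(1)] Q(2,3) unfolding D_def by metis
qed

section \<open>Kaehler metrics and holomorphic Killing fields on open sets\<close>

text \<open>Conjugation by \<open>J\<close> preserves the trace but changes the sign of an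
  antilinear map.\<close>

lemma tr_antilinear:
  fixes J :: "'e::euclidean_space \<Rightarrow> 'e"
  assumes "linear J" "\<And>u. J (J u) = - u" "linear A" "\<And>u. A (J u) = - J (A u)"
  shows "tr A = 0"
proof -
  have "tr A = tr (\<lambda>e. - J (J (A e)))" by (simp add: assms)
  also have "\<dots> = - tr (\<lambda>e. J ((J \<circ> A) e))" by (simp add: tr_minus)
  also have "\<dots> = - tr (\<lambda>e. (J \<circ> A) (J e))" using tr_commute[of J "J \<circ> A"] assms by (simp add: linear_compose)
  also have "\<dots> = - tr (\<lambda>e. A e)" by (simp add: assms linear_neg)
  finally show ?thesis by simp
qed

text \<open>In holomorphic coordinates \<open>J\<close> is constant, and \<open>G x (J u) v\<close>
  is the Kaehler form; the last assumption is its closedness.\<close>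

locale local_kaehler = local_metric U G
  for U :: "'e::euclidean_space set" and G +
  fixes J :: "'e \<Rightarrow> 'e"
  assumes J_linear: "linear J" and JJ: "J (J u) = - u"
    and G_J: "x \<in> U \<Longrightarrow> G x (J u) (J v) = G x u v"
    and closed: "x \<in> U \<Longrightarrow> \<D> (\<lambda>y. G y (J v) w) x u
      + \<D> (\<lambda>y. G y (J w) u) x v + \<D> (\<lambda>y. G y (J u) v) x w = 0"
begin

lemmas J_simps = linear_add[OF J_linear] linear_diff[OF J_linear] linear_neg[OF J_linear]
  linear_scale[OF J_linear] linear_0[OF J_linear] JJ

lemma J_bounded: "bounded_linear J"
  using J_linear by (simp add: linear_conv_bounded_linear)

lemma G_J_left: "x \<in> U \<Longrightarrow> G x (J u) v = - G x u (J v)"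
  using G_J[of x u "J v"] by (simp add: J_simps G_simps)

lemma dG_J: assumes "x \<in> U" shows "dG x w (J u) (J v) = dG x w u v"
  using fun_cong[OF has_derivative_unique[OF dG[OF assms] frechet_cong_U[OF assms dG[OF assms] G_J[symmetric]]], of w]
  by simp

lemma dG_J_left: "x \<in> U \<Longrightarrow> dG x w (J u) v = - dG x w u (J v)"
  using dG_J[of x w u "J v"] by (simp add: J_simps dG_simps)

text \<open>Closedness replaces the two Koszul terms differentiated along \<open>v\<close> and
  \<open>w\<close> by a single one differentiated along \<open>J u\<close>. All derivatives of the
  metric are now along \<open>u\<close> or \<open>J u\<close>, which exposes complex linearity in
  \<open>v\<close>.\<close>

lemma \<Gamma>_kaehler:
  assumes x: "x \<in> U" shows "2 * G x (\<Gamma> x u v) w = dG x u v w + dG x (J u) v (J w)"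
proof -
  have "dG x (J u) (J v) w + dG x v (J w) (J u) + dG x w (J (J u)) v = 0"
    using closed[OF x, of v w "J u"] by (simp add: dG_def)
  then have "dG x v u w - dG x w u v = dG x (J u) v (J w)"
    using dG_J_left[OF x, of "J u" v w] dG_J[OF x, of v w u] dG_sym[OF x, of v w u]
    by (simp add: JJ dG_simps x)
  then show ?thesis using \<Gamma>_koszul[OF x, of u v w] by simp
qed

text \<open>This is the parallelism of \<open>J\<close>, which has constant coefficients
  here.\<close>

lemma \<Gamma>_J: assumes x: "x \<in> U" shows "\<Gamma> x u (J v) = J (\<Gamma> x u v)"
proof (rule G_eqI[OF x])
  fix w
  have "2 * G x (\<Gamma> x u (J v)) w = - (2 * G x (\<Gamma> x u v) (J w))"
    using dG_J[OF x, of "J u" v w] dG_J_left[OF x, of u v w] dG_J_left[OF x, of "J u" v "J w"]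
    unfolding \<Gamma>_kaehler[OF x] by (simp add: JJ dG_simps x)
  then show "G x (\<Gamma> x u (J v)) w = G x (J (\<Gamma> x u v)) w" by (simp add: G_J_left x)
qed

lemma \<Gamma>_J_left: assumes x: "x \<in> U" shows "\<Gamma> x (J u) v = J (\<Gamma> x u v)"
  using \<Gamma>_J[OF x, of v u] \<Gamma>_sym[OF x, of v] by simp

lemma d\<Gamma>_J: assumes x: "x \<in> U" shows "d\<Gamma> x w u (J v) = J (d\<Gamma> x w u v)"
proof -
  have "((\<lambda>y. J (\<Gamma> y u v)) has_derivative (\<lambda>w. J (d\<Gamma> x w u v))) (at x)"
    by (rule bounded_linear.has_derivative[OF J_bounded d\<Gamma>[OF x]])
  from fun_cong[OF has_derivative_unique[OF d\<Gamma>[OF x] frechet_cong_U[OF x this \<Gamma>_J[symmetric]]], of w]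
  show ?thesis by simp
qed

lemma d\<Gamma>_J_left: assumes x: "x \<in> U" shows "d\<Gamma> x w (J u) v = J (d\<Gamma> x w u v)"
  using d\<Gamma>_J[OF x, of w v u] d\<Gamma>_sym[OF x, of w v] by simp

text \<open>The (1,0)-part \<open>d\<Gamma> x a - J (d\<Gamma> x (J a))\<close> of the derivative of the connection form
  satisfies \<open>\<partial>\<Gamma> = - \<Gamma> \<and> \<Gamma>\<close>, because the (2,0)-part of the Hessian of the metric is symmetric.\<close>

lemma curvature_20:
  assumes x: "x \<in> U"
  shows "2 *\<^sub>R \<Gamma> x a (\<Gamma> x u v) + d\<Gamma> x a u v - J (d\<Gamma> x (J a) u v)
    = 2 *\<^sub>R \<Gamma> x u (\<Gamma> x a v) + d\<Gamma> x u a v - J (d\<Gamma> x (J u) a v)"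
proof -
  define H where "H a u v w = \<D> (\<lambda>y. dG y u v w) x a" for a u v w
  have H: "((\<lambda>y. dG y u v w) has_derivative (\<lambda>a. H a u v w)) (at x)" for u v w
    unfolding H_def by (rule smooth_on_has_derivative[OF dG_smooth x])
  have H_sym: "H a u v w = H u a v w" for a u v w
    unfolding H_def dG_def by (rule symmetric_second_derivative[OF open_U x G_smooth])
  have "bilinear (H a u)" for a u
    by (rule bilinear_derivative[OF open_U x dG_bilinear H])
  note H_simps = bilinear_rneg[OF this]
  have 1: "2 * (dG x a (\<Gamma> x u v) w + G x (d\<Gamma> x a u v) w) = H a u v w + H a (J u) v (J w)" for a u w
  proof -
    have d1: "((\<lambda>y. 2 * G y (\<Gamma> y u v) w) has_derivative (\<lambda>a. 2 * (dG x a (\<Gamma> x u v) w + G x (d\<Gamma> x a u v) w + G x (\<Gamma> x u v) 0))) (at x)"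
      by (intro has_derivative_mult_right has_derivative_G x d\<Gamma> has_derivative_const)
    have d2: "((\<lambda>y. 2 * G y (\<Gamma> y u v) w) has_derivative (\<lambda>a. H a u v w + H a (J u) v (J w))) (at x)"
      by (rule frechet_cong_U[OF x _ \<Gamma>_kaehler[symmetric]]) (intro has_derivative_add H)
    have "2 * (dG x a (\<Gamma> x u v) w + G x (d\<Gamma> x a u v) w + G x (\<Gamma> x u v) 0) = H a u v w + H a (J u) v (J w)"
      using fun_cong[OF has_derivative_unique[OF d1 d2]] .
    then show ?thesis by (simp add: G_simps x)
  qed
  \<comment> \<open>The right side is symmetric in \<open>a\<close> and \<open>u\<close>: the first
    two Hessian terms are so separately, and the two terms in brackets are exchanged.\<close>
  have 2: "2 * G x (2 *\<^sub>R \<Gamma> x a (\<Gamma> x u v) + d\<Gamma> x a u v - J (d\<Gamma> x (J a) u v)) w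
    = H a u v w - H (J a) (J u) v w + (H a (J u) v (J w) + H (J a) u v (J w))" for a u w
  proof -
    have "2 * G x (2 *\<^sub>R \<Gamma> x a (\<Gamma> x u v) + d\<Gamma> x a u v - J (d\<Gamma> x (J a) u v)) w =
       2 * (dG x a (\<Gamma> x u v) w + G x (d\<Gamma> x a u v) w) + 2 * (dG x (J a) (\<Gamma> x u v) (J w) + G x (d\<Gamma> x (J a) u v) (J w))"
      using \<Gamma>_kaehler[OF x, of a "\<Gamma> x u v" w] by (simp add: G_simps x G_J_left algebra_simps)
    also have "\<dots> = H a u v w - H (J a) (J u) v w + (H a (J u) v (J w) + H (J a) u v (J w))"
      unfolding 1 by (simp add: JJ H_simps)
    finally show ?thesis .
  qed
  show ?thesis
  proof (rule G_eqI[OF x])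
    fix w show "G x (2 *\<^sub>R \<Gamma> x a (\<Gamma> x u v) + d\<Gamma> x a u v - J (d\<Gamma> x (J a) u v)) w =
      G x (2 *\<^sub>R \<Gamma> x u (\<Gamma> x a v) + d\<Gamma> x u a v - J (d\<Gamma> x (J u) a v)) w"
      using 2[of a u w] 2[of u a w] H_sym[of a u v w] H_sym[of "J a" "J u" v w]
        H_sym[of a "J u" v "J w"] H_sym[of "J a" u v "J w"] by linarith
  qed
qed

section \<open>The Ricci tensor of a Kaehler metric\<close>

abbreviation Ric :: "'e \<Rightarrow> 'e \<Rightarrow> 'e \<Rightarrow> real" where "Ric \<equiv> ricci_loc G"

text \<open>The contracted connection, which is the derivative of the logarithm of the volume
  density; \<open>tr (nabla X x)\<close> is \<open>tr (\<D> X x) + \<theta> x (X x)\<close>.\<close>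

definition \<theta> :: "'e \<Rightarrow> 'e \<Rightarrow> real" where "\<theta> x w = tr (\<lambda>e. \<Gamma> x e w)"

definition d\<theta> :: "'e \<Rightarrow> 'e \<Rightarrow> 'e \<Rightarrow> real" where "d\<theta> x a w = tr (\<lambda>e. d\<Gamma> x a e w)"

lemma \<theta>_linear: "x \<in> U \<Longrightarrow> linear (\<theta> x)"
  by (rule linearI) (simp_all add: \<theta>_def \<Gamma>_simps tr_add tr_scale)

lemma \<theta>: "x \<in> U \<Longrightarrow> ((\<lambda>y. \<theta> y w) has_derivative (\<lambda>a. d\<theta> x a w)) (at x)"
  unfolding \<theta>_def d\<theta>_def by (rule has_derivative_tr) (rule d\<Gamma>)

lemma Ric_eq:
  assumes x: "x \<in> U"
  shows "Ric x v w = tr (\<lambda>e. d\<Gamma> x e v w) - d\<theta> x v w + tr (\<lambda>e. \<Gamma> x e (\<Gamma> x v w)) - tr (\<lambda>e. \<Gamma> x v (\<Gamma> x e w))"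
  unfolding ricci_loc_def curvature_def d\<Gamma>_def[symmetric] tr_diff[symmetric] tr_add[symmetric] d\<theta>_def
  by (simp add: tr_def)

text \<open>A term that is complex linear in both \<open>v\<close> and \<open>w\<close> changes sign
  when both are multiplied by \<open>J\<close>. Only \<open>d\<theta>\<close> survives, where
  \<open>v\<close> is the direction of differentiation.\<close>

lemma Ric_sum_J:
  assumes x: "x \<in> U"
  shows "Ric x v w + Ric x (J v) (J w) = - (d\<theta> x v w + d\<theta> x (J v) (J w))"
  unfolding Ric_eq[OF x]
  by (simp add: \<Gamma>_J \<Gamma>_J_left d\<Gamma>_J d\<Gamma>_J_left x JJ \<Gamma>_simps tr_minus)

text \<open>Tracing \<open>curvature_20\<close> over \<open>a\<close> expresses the other terms of
  \<open>Ric_eq\<close> as half of \<open>d\<theta> x v w - d\<theta> x (J v) (J w)\<close>. So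
  \<open>Ric x v w\<close> is minus half of
  \<open>d\<theta> x v w + d\<theta> x (J v) (J w)\<close>, which is unchanged by
  \<open>J\<close>.\<close>

lemma Ric_J:
  assumes x: "x \<in> U"
  shows "Ric x (J v) (J w) = Ric x v w"
proof -
  \<comment> \<open>The two sides differ by the trace of twice the (0,1)-part in \<open>e\<close>,
    which is antilinear and hence traceless.\<close>
  have 1: "tr (\<lambda>e. d\<Gamma> x e v w) = - tr (\<lambda>e. J (d\<Gamma> x (J e) v w))"
  proof -
    have l: "linear (\<lambda>e. d\<Gamma> x e v w + J (d\<Gamma> x (J e) v w))"
      by (rule linearI) (simp_all add: J_simps linear_add[OF d\<Gamma>_linear[OF x]] linear_scale[OF d\<Gamma>_linear[OF x]] scaleR_add_right)
    have "tr (\<lambda>e. d\<Gamma> x e v w + J (d\<Gamma> x (J e) v w)) = 0"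
      by (rule tr_antilinear[OF J_linear JJ l]) (simp add: JJ J_simps linear_neg[OF d\<Gamma>_linear[OF x]])
    then show ?thesis unfolding tr_add by simp
  qed
  have "tr (\<lambda>e. 2 *\<^sub>R \<Gamma> x e (\<Gamma> x v w) + d\<Gamma> x e v w - J (d\<Gamma> x (J e) v w))
    = tr (\<lambda>e. 2 *\<^sub>R \<Gamma> x v (\<Gamma> x e w) + d\<Gamma> x v e w - J (d\<Gamma> x (J v) e w))"
    by (simp only: curvature_20[OF x])
  then have "2 * tr (\<lambda>e. \<Gamma> x e (\<Gamma> x v w)) + 2 * tr (\<lambda>e. d\<Gamma> x e v w)
    = 2 * tr (\<lambda>e. \<Gamma> x v (\<Gamma> x e w)) + d\<theta> x v w - d\<theta> x (J v) (J w)"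
    unfolding tr_add tr_diff tr_scale d\<theta>_def using 1 by (simp add: d\<Gamma>_J x)
  then show ?thesis unfolding Ric_eq[OF x]
    by (simp add: \<Gamma>_J \<Gamma>_J_left d\<Gamma>_J d\<Gamma>_J_left x JJ \<Gamma>_simps tr_minus)
qed

lemma Ric_continuous: "continuous_on U (\<lambda>x. Ric x v w)"
proof -
  have c: "continuous_on U (\<lambda>x. \<Gamma> x u v)" for u v
    using \<Gamma>_differentiable by (meson continuous_at_imp_continuous_on differentiable_imp_continuous_within)
  have cc: "continuous_on U (\<lambda>x. \<Gamma> x a (\<Gamma> x u v))" for a u v
  proof (rule continuous_at_imp_continuous_on, rule ballI)
    show "isCont (\<lambda>x. \<Gamma> x a (\<Gamma> x u v)) x" if "x \<in> U" for x
      using has_derivative_\<Gamma>[OF that has_derivative_const d\<Gamma>[OF that]] has_derivative_continuous by blast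
  qed
  have "continuous_on U (\<lambda>x. tr (\<lambda>e. d\<Gamma> x e v w) - d\<theta> x v w + tr (\<lambda>e. \<Gamma> x e (\<Gamma> x v w)) - tr (\<lambda>e. \<Gamma> x v (\<Gamma> x e w)))"
    unfolding tr_def d\<theta>_def by (intro continuous_intros d\<Gamma>_continuous cc)
  then show ?thesis by (rule continuous_on_eq) (simp add: Ric_eq)
qed

text \<open>The second clause is holomorphy of \<open>X\<close>, the third the coordinate form of a
  vanishing Lie derivative of \<open>G\<close> along \<open>X\<close>.\<close>

definition holomorphic_killing :: "('e \<Rightarrow> 'e) \<Rightarrow> bool" where
  "holomorphic_killing X \<longleftrightarrow> smooth_on U X \<and>
    (\<forall>x\<in>U. \<forall>v. \<D> X x (J v) = J (\<D> X x v)) \<and>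
    (\<forall>x\<in>U. \<forall>u v. dG x (X x) u v + G x (\<D> X x u) v
       + G x u (\<D> X x v) = 0)"

definition Y :: "('e \<Rightarrow> 'e) \<Rightarrow> 'e \<Rightarrow> 'e" where "Y X y = - J (X y)"

context
  fixes X assumes X: "holomorphic_killing X"
begin

lemma X_smooth: "smooth_on U X" using X by (simp add: holomorphic_killing_def)

lemma X_deriv: "x \<in> U \<Longrightarrow> (X has_derivative \<D> X x) (at x)"
  by (rule smooth_on_has_derivative[OF X_smooth])

lemma DX_J: "x \<in> U \<Longrightarrow> \<D> X x (J v) = J (\<D> X x v)"
  using X by (simp add: holomorphic_killing_def)

lemma nabla_linear: assumes x: "x \<in> U" shows "linear (nabla X x)"
  unfolding nabla_def using has_derivative_linear[OF X_deriv[OF x]] \<Gamma>_bilinear[OF x]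
  by (intro linear_compose_add) (auto simp: bilinear_def)

lemma nabla_J: "x \<in> U \<Longrightarrow> nabla X x (J v) = J (nabla X x v)"
  by (simp add: nabla_def DX_J \<Gamma>_J_left J_simps)

lemma nabla_skew: assumes x: "x \<in> U" shows "G x (nabla X x u) v = - G x u (nabla X x v)"
proof -
  have "dG x (X x) u v + G x (\<D> X x u) v + G x u (\<D> X x v) = 0"
    using X x by (simp add: holomorphic_killing_def)
  then show ?thesis unfolding metric_compatible[OF x] nabla_def
    by (simp add: G_simps x \<Gamma>_sym[OF x, of "X x"])
qed

lemma div_X: assumes x: "x \<in> U" shows "tr (nabla X x) = 0"
proof -
  obtain P Q :: "'e \<Rightarrow> 'e" where PQ: "linear P" "linear Q" "\<And>u. P (Q u) = u" "\<And>u. Q (P u) = u" "\<And>u v. G x (P u) (P v) = u \<bullet> v"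
    by (rule orthonormal_frame[OF G_bilinear[OF x] G_sym[OF x] G_pos[OF x]]) (assumption, rule that)
  have "tr (nabla X x) = (\<Sum>e\<in>Basis. G x (nabla X x (P e)) (P e))"
    by (rule tr_orthonormal_frame[OF PQ nabla_linear[OF x]])
  also have "G x (nabla X x u) u = 0" for u
    using nabla_skew[OF x, of u u] G_sym[OF x, of u "nabla X x u"] by linarith
  then have "(\<Sum>e\<in>Basis. G x (nabla X x (P e)) (P e)) = 0" by simp
  finally show ?thesis .
qed

lemma Y_deriv: "x \<in> U \<Longrightarrow> (Y X has_derivative (\<lambda>w. - J (\<D> X x w))) (at x)"
  unfolding Y_def by (intro has_derivative_minus bounded_linear.has_derivative[OF J_bounded] X_deriv)

lemma nabla_Y: "x \<in> U \<Longrightarrow> nabla (Y X) x u = - J (nabla X x u)"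
  unfolding nabla_def frechetI[OF Y_deriv] by (simp add: Y_def \<Gamma>_J \<Gamma>_simps J_simps)

text \<open>\<open>nabla X x\<close> is skew and commutes with \<open>J\<close>, so its product with
  \<open>J\<close> is self-adjoint; when \<open>Y X\<close> is a gradient, this is the Hessian of
  the potential.\<close>

lemma nabla_Y_sym: "x \<in> U \<Longrightarrow> G x (nabla (Y X) x u) v = G x u (nabla (Y X) x v)"
  using nabla_skew[of x u "J v"] by (simp add: nabla_Y nabla_J G_simps G_J_left)

text \<open>Differentiating \<open>tr (nabla X y) = 0\<close> in direction \<open>J w\<close>
  produces the same second derivatives of \<open>X\<close> and the same term
  \<open>\<theta> x (J (\<D> X x w))\<close> as the derivative of \<open>tr (nabla (Y X) y)\<close>
  in direction \<open>w\<close>, with opposite sign. The sum is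
  \<open>d\<theta> x w (Y X x) + d\<theta> x (J w) (J (Y X x))\<close>, which
  \<open>Ric_sum_J\<close> and \<open>Ric_J\<close> evaluate.\<close>

lemma div_Y_derivative:
  assumes x: "x \<in> U"
  shows "((\<lambda>y. tr (nabla (Y X) y)) has_derivative (\<lambda>w. - 2 * Ric x w (Y X x))) (at x)"
proof -
  define D2 where "D2 a e = \<D> (\<lambda>y. \<D> X y e) x a" for a e
  have D2: "((\<lambda>y. \<D> X y e) has_derivative (\<lambda>a. D2 a e)) (at x)" for e
    unfolding D2_def by (rule smooth_on_has_derivative[OF smooth_on_derivative[OF X_smooth] x])
  have D2_sym: "D2 a e = D2 e a" for a e
    unfolding D2_def by (rule symmetric_second_derivative[OF open_U x X_smooth])
  have D2_J: "D2 a (J e) = J (D2 a e)" for a e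
  proof -
    have "((\<lambda>y. J (\<D> X y e)) has_derivative (\<lambda>a. J (D2 a e))) (at x)"
      by (rule bounded_linear.has_derivative[OF J_bounded D2])
    from fun_cong[OF has_derivative_unique[OF D2 frechet_cong_U[OF x this DX_J[symmetric]]], of a]
    show ?thesis by simp
  qed
  have \<theta>': "((\<lambda>y. \<theta> y (Z y)) has_derivative (\<lambda>w. d\<theta> x w (Z x) + \<theta> x (Z' w))) (at x)"
    if "(Z has_derivative Z') (at x)" for Z Z'
    by (rule has_derivative_linear_field[OF open_U x \<theta>_linear \<theta>[OF x] that])
  have "((\<lambda>y. tr (\<D> X y) + \<theta> y (X y)) has_derivative
     (\<lambda>w. tr (D2 w) + (d\<theta> x w (X x) + \<theta> x (\<D> X x w)))) (at x)"
    by (intro has_derivative_add has_derivative_tr \<theta>' X_deriv x D2)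
  moreover have "tr (\<D> X y) + \<theta> y (X y) = 0" if "y \<in> U" for y
    using div_X[OF that] unfolding nabla_def \<theta>_def tr_add .
  ultimately have "((\<lambda>y. 0) has_derivative
     (\<lambda>w. tr (D2 w) + (d\<theta> x w (X x) + \<theta> x (\<D> X x w)))) (at x)"
    by (rule frechet_cong_U[OF x])
  from has_derivative_unique[OF this has_derivative_const]
  have 0: "tr (D2 w) + (d\<theta> x w (X x) + \<theta> x (\<D> X x w)) = 0" for w
    by (rule fun_cong)
  have "((\<lambda>y. tr (\<lambda>e. - J (\<D> X y e)) + \<theta> y (Y X y)) has_derivative
     (\<lambda>w. tr (\<lambda>e. - J (D2 w e)) + (d\<theta> x w (Y X x) + \<theta> x (- J (\<D> X x w))))) (at x)"
    by (intro has_derivative_add has_derivative_tr \<theta>' Y_deriv x has_derivative_minus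
      bounded_linear.has_derivative[OF J_bounded] D2)
  moreover have "tr (\<lambda>e. - J (\<D> X y e)) + \<theta> y (Y X y) = tr (nabla (Y X) y)" if "y \<in> U" for y
    unfolding nabla_def \<theta>_def tr_add frechetI[OF Y_deriv[OF that]] ..
  ultimately have d: "((\<lambda>y. tr (nabla (Y X) y)) has_derivative
     (\<lambda>w. tr (\<lambda>e. - J (D2 w e)) + (d\<theta> x w (Y X x) + \<theta> x (- J (\<D> X x w))))) (at x)"
    by (rule frechet_cong_U[OF x])
  have "tr (\<lambda>e. - J (D2 w e)) + (d\<theta> x w (Y X x) + \<theta> x (- J (\<D> X x w))) = - 2 * Ric x w (Y X x)" for w
  proof -
    have XY: "X x = J (Y X x)" by (simp add: Y_def J_simps)
    \<comment> \<open>Symmetry turns the direction \<open>J w\<close> into an argument, out of which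
      holomorphy pulls \<open>J\<close>.\<close>
    have "D2 (J w) = (\<lambda>e. J (D2 w e))" by (rule ext) (metis D2_sym D2_J)
    then have "tr (\<lambda>e. J (D2 w e)) + (d\<theta> x (J w) (J (Y X x)) + \<theta> x (J (\<D> X x w))) = 0"
      using 0[of "J w"] by (simp add: DX_J x XY)
    then have "tr (\<lambda>e. - J (D2 w e)) + (d\<theta> x w (Y X x) + \<theta> x (- J (\<D> X x w)))
      = d\<theta> x w (Y X x) + d\<theta> x (J w) (J (Y X x))"
      by (simp add: tr_minus linear_neg[OF \<theta>_linear[OF x]])
    also have "\<dots> = - 2 * Ric x w (Y X x)" using Ric_sum_J[OF x, of w "Y X x"] Ric_J[OF x, of w "Y X x"] by simp
    finally show ?thesis .
  qed
  then show ?thesis using d by simp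
qed

text \<open>The left side is the Lie derivative of the Kaehler form along \<open>J (X y)\<close>,
  which is \<open>- Y X y\<close>. Metric compatibility turns it into two covariant terms, which
  agree because \<open>nabla (Y X) x\<close> is self-adjoint.\<close>

lemma lie_derivative_J_X:
  assumes x: "x \<in> U"
  shows "dG x (- Y X x) (J u) v + G x (J (\<D> (\<lambda>y. - Y X y) x u)) v
      + G x (J u) (\<D> (\<lambda>y. - Y X y) x v) = - 2 * G x (nabla (Y X) x (J u)) v"
proof -
  have d: "\<D> (\<lambda>y. - Y X y) x = (\<lambda>w. - \<D> (Y X) x w)"
    using frechetI[OF has_derivative_minus[OF Y_deriv[OF x]]] frechetI[OF Y_deriv[OF x]] by simp
  have J: "J (\<D> (Y X) x u) = \<D> (Y X) x (J u)"
    unfolding frechetI[OF Y_deriv[OF x]] by (simp add: J_simps DX_J x)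
  have "dG x (- Y X x) (J u) v + G x (J (\<D> (\<lambda>y. - Y X y) x u)) v
      + G x (J u) (\<D> (\<lambda>y. - Y X y) x v) = - (G x (nabla (Y X) x (J u)) v + G x (J u) (nabla (Y X) x v))"
    unfolding d nabla_def metric_compatible[OF x]
    by (simp add: J_simps J G_simps \<Gamma>_simps x \<Gamma>_sym[OF x, of "Y X x"])
  then show ?thesis using nabla_Y_sym[OF x, of "J u" v] by simp
qed

lemma lie_derivative_X:
  assumes x: "x \<in> U"
  shows "dG x (X x) (J u) v + G x (J (\<D> X x u)) v
      + G x (J u) (\<D> X x v) = 0"
  using X x unfolding holomorphic_killing_def by (metis DX_J)

end

text \<open>Both terms of the product rule agree: the covariant derivatives of the two gradients are
  self-adjoint, and by \<open>comm\<close> the gradients commute, so the derivative of either along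
  the other is the same vector. Hence only the Hessian belonging to \<open>X1\<close>
  remains.\<close>

lemma inner_gradients_derivative:
  assumes X1: "holomorphic_killing X1" and X2: "holomorphic_killing X2" and x: "x \<in> U"
    and comm: "\<D> X1 x (X2 x) = \<D> X2 x (X1 x)"
  shows "((\<lambda>y. G y (Y X1 y) (Y X2 y)) has_derivative (\<lambda>w. 2 * G x (nabla (Y X1) x w) (Y X2 x))) (at x)"
proof -
  have n: "nabla (Y X1) x (Y X2 x) = nabla (Y X2) x (Y X1 x)"
    unfolding nabla_def frechetI[OF Y_deriv[OF X1 x]] frechetI[OF Y_deriv[OF X2 x]] \<Gamma>_sym[OF x, of "Y X2 x"]
    using comm by (simp add: Y_def DX_J[OF X1 x] DX_J[OF X2 x] J_simps linear_neg[OF has_derivative_linear[OF X_deriv[OF X1 x]]]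
      linear_neg[OF has_derivative_linear[OF X_deriv[OF X2 x]]])
  have d: "(Y X' has_derivative \<D> (Y X') x) (at x)" if "holomorphic_killing X'" for X'
    using Y_deriv[OF that x] by (simp add: frechetI[OF Y_deriv[OF that x]])
  have "((\<lambda>y. G y (Y X1 y) (Y X2 y)) has_derivative (\<lambda>w. dG x w (Y X1 x) (Y X2 x)
      + G x (\<D> (Y X1) x w) (Y X2 x) + G x (Y X1 x) (\<D> (Y X2) x w))) (at x)"
    by (rule has_derivative_G[OF x d[OF X1] d[OF X2]])
  moreover have "dG x w (Y X1 x) (Y X2 x)
      + G x (\<D> (Y X1) x w) (Y X2 x) + G x (Y X1 x) (\<D> (Y X2) x w)
      = 2 * G x (nabla (Y X1) x w) (Y X2 x)" for w
  proof -
    have "dG x w (Y X1 x) (Y X2 x)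
      + G x (\<D> (Y X1) x w) (Y X2 x) + G x (Y X1 x) (\<D> (Y X2) x w)
      = G x (nabla (Y X1) x w) (Y X2 x) + G x (Y X1 x) (nabla (Y X2) x w)"
      unfolding metric_compatible[OF x] nabla_def by (simp add: G_simps x)
    also have "G x (Y X1 x) (nabla (Y X2) x w) = G x (nabla (Y X2) x (Y X1 x)) w"
      using nabla_Y_sym[OF X2 x, of "Y X1 x" w] by simp
    also have "\<dots> = G x (nabla (Y X1) x w) (Y X2 x)"
      using n nabla_Y_sym[OF X1 x, of "Y X2 x" w] G_sym[OF x, of "Y X2 x"] by simp
    finally show ?thesis by simp
  qed
  ultimately show ?thesis by simp
qed

end

section \<open>Rigidity of Killing fields\<close>

text \<open>Bounds \<open>f\<close> by a multiple of \<open>m\<close> with an unspecified constant,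
  so that estimates compose without naming constants.\<close>

definition dominated :: "'a set \<Rightarrow> ('a \<Rightarrow> real) \<Rightarrow> ('a \<Rightarrow> real) \<Rightarrow> bool" where
  "dominated K m f \<longleftrightarrow> (\<exists>C. \<forall>x\<in>K. \<bar>f x\<bar> \<le> C * m x)"

lemma dominated_cong: "dominated K m f \<Longrightarrow> (\<And>x. x \<in> K \<Longrightarrow> f x = g x) \<Longrightarrow> dominated K m g"
  by (simp add: dominated_def)

lemma dominated_add:
  assumes "dominated K m f" "dominated K m g" shows "dominated K m (\<lambda>x. f x + g x)"
proof -
  obtain C D where "\<forall>x\<in>K. \<bar>f x\<bar> \<le> C * m x" "\<forall>x\<in>K. \<bar>g x\<bar> \<le> D * m x"
    using assms by (auto simp: dominated_def)
  then have "\<forall>x\<in>K. \<bar>f x + g x\<bar> \<le> (C + D) * m x" by (force simp: distrib_right)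
  then show ?thesis unfolding dominated_def by blast
qed

lemma dominated_minus: "dominated K m f \<Longrightarrow> dominated K m (\<lambda>x. - f x)"
  by (simp add: dominated_def)

lemma dominated_diff: "dominated K m f \<Longrightarrow> dominated K m g \<Longrightarrow> dominated K m (\<lambda>x. f x - g x)"
  using dominated_add[of K m f "\<lambda>x. - g x"] dominated_minus by auto

lemma dominated_sum:
  assumes "\<And>i. i \<in> I \<Longrightarrow> dominated K m (f i)" shows "dominated K m (\<lambda>x. \<Sum>i\<in>I. f i x)"
  using assms
proof (induction I rule: infinite_finite_induct)
  case (insert i I)
  then show ?case by (auto intro!: dominated_add)
qed (auto simp: dominated_def intro: exI[of _ 0])

lemma dominated_mult_continuous:
  assumes K: "compact K" "continuous_on K a" and f: "dominated K m f" and m: "\<And>x. m x \<ge> 0"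
  shows "dominated K m (\<lambda>x. a x * f x)"
proof -
  obtain C where C: "\<forall>x\<in>K. \<bar>f x\<bar> \<le> C * m x" using f by (auto simp: dominated_def)
  have "bounded (a ` K)" using K by (simp add: compact_continuous_image compact_imp_bounded)
  then obtain D where D: "D > 0" "\<forall>x\<in>K. \<bar>a x\<bar> \<le> D" by (auto simp: bounded_pos)
  have "\<bar>a x * f x\<bar> \<le> (D * C) * m x" if "x \<in> K" for x
  proof -
    have "\<bar>a x * f x\<bar> \<le> D * (C * m x)" unfolding abs_mult using C D that by (intro mult_mono) auto
    then show ?thesis by (simp add: mult.assoc)
  qed
  then show ?thesis unfolding dominated_def by blast
qed

lemma dominated_mult:
  assumes "dominated K m f" "dominated K m g" and m: "\<And>x. m x \<ge> 0"
  shows "dominated K (\<lambda>x. m x * m x) (\<lambda>x. f x * g x)"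
proof -
  obtain C D where CD: "\<forall>x\<in>K. \<bar>f x\<bar> \<le> C * m x" "\<forall>x\<in>K. \<bar>g x\<bar> \<le> D * m x"
    using assms by (auto simp: dominated_def)
  have "\<bar>f x * g x\<bar> \<le> (C * D) * (m x * m x)" if "x \<in> K" for x
  proof -
    have "0 \<le> C * m x" using CD that by (meson abs_ge_zero order_trans)
    then have "\<bar>f x * g x\<bar> \<le> (C * m x) * (D * m x)"
      unfolding abs_mult using CD that by (intro mult_mono) auto
    then show ?thesis by (simp add: mult_ac)
  qed
  then show ?thesis unfolding dominated_def by blast
qed

context local_kaehler
begin

text \<open>Cyclic permutation of the differentiated Killing equation, as in Koszul's formula,
  isolates the second derivative. Here \<open>l\<close> collects the terms that involve only the
  1-jet of \<open>X\<close>, so that the 1-jet determines the second derivatives.\<close>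

lemma killing_second_derivative:
  assumes X: "holomorphic_killing X"
  defines "D2 \<equiv> \<lambda>x a e. \<D> (\<lambda>y. \<D> X y e) x a"
  defines "l \<equiv> \<lambda>x a u v. \<D> (\<lambda>y. dG y (X x) u v) x a
      + dG x (\<D> X x a) u v
      + dG x a (\<D> X x u) v + dG x a u (\<D> X x v)"
  assumes x: "x \<in> U"
  shows "2 * G x (D2 x a u) v = - l x a u v - l x u v a + l x v a u"
proof -
  have D2: "((\<lambda>y. \<D> X y e) has_derivative (\<lambda>a. D2 x a e)) (at x)" for e
    unfolding D2_def by (rule smooth_on_has_derivative[OF smooth_on_derivative[OF X_smooth[OF X]] x])
  have D2_sym: "D2 x a e = D2 x e a" for a e
    unfolding D2_def by (rule symmetric_second_derivative[OF open_U x X_smooth[OF X]])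
  have H: "((\<lambda>y. dG y w u v) has_derivative (\<lambda>a. \<D> (\<lambda>y. dG y w u v) x a)) (at x)" for u v w
    using smooth_on_has_derivative[OF dG_smooth x] .
  have E: "l x a u v + G x (D2 x a u) v + G x (D2 x a v) u = 0" for a u v
  proof -
    have d: "((\<lambda>y. dG y (X y) u v + G y (\<D> X y u) v + G y u (\<D> X y v))
      has_derivative (\<lambda>a. (\<D> (\<lambda>y. dG y (X x) u v) x a + dG x (\<D> X x a) u v)
        + (dG x a (\<D> X x u) v + G x (D2 x a u) v + G x (\<D> X x u) 0)
        + (dG x a u (\<D> X x v) + G x 0 (\<D> X x v) + G x u (D2 x a v)))) (at x)"
      by (intro has_derivative_add has_derivative_G x D2 has_derivative_const
          has_derivative_linear_field[OF open_U x, where L="\<lambda>y w. dG y w u v"] dG_linear H X_deriv[OF X])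
    have d0: "((\<lambda>y. dG y (X y) u v + G y (\<D> X y u) v + G y u (\<D> X y v))
      has_derivative (\<lambda>a. 0)) (at x)"
      by (rule frechet_cong_U[OF x has_derivative_const[of 0]]) (use X in \<open>simp add: holomorphic_killing_def\<close>)
    from fun_cong[OF has_derivative_unique[OF d d0], of a]
    show ?thesis unfolding l_def by (simp add: G_simps x G_sym[OF x, of u])
  qed
  show ?thesis using E[of a u v] E[of u v a] E[of v a u]
    by (simp add: D2_sym[of u a] D2_sym[of v a] D2_sym[of u v])
qed

text \<open>\<open>m\<close> measures the 1-jet of \<open>X\<close>. The expression \<open>l\<close>
  is linear in that jet with continuous coefficients, hence bounded by \<open>m\<close> on a compact
  set; the third claim is what the Gronwall estimate below needs.\<close>

lemma killing_second_derivative_dominated: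
  assumes X: "holomorphic_killing X" and K: "compact K" "K \<subseteq> U"
  defines "m \<equiv> \<lambda>x. norm (X x) + (\<Sum>e\<in>Basis. norm (\<D> X x e))"
  shows "dominated K m (\<lambda>x. X x \<bullet> i)"
    and "dominated K m (\<lambda>x. \<D> X x a \<bullet> i)"
    and "dominated K m (\<lambda>x. \<D> (\<lambda>y. \<D> X y u) x a \<bullet> i)"
proof -
  have m: "m x \<ge> 0" for x unfolding m_def by (intro add_nonneg_nonneg sum_nonneg) auto
  note c = dominated_mult_continuous[OF K(1) _ _ m]
  have cK: "continuous_on K f" if "smooth_on U f" for f :: "'e \<Rightarrow> real"
    using smooth_on_continuous[OF that] continuous_on_subset K(2) by blast
  have DXl: "linear (\<D> X x)" if "x \<in> K" for x
    using has_derivative_linear[OF X_deriv[OF X]] that K by auto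
  have 1: "dominated K m (\<lambda>x. X x \<bullet> i)" for i
  proof -
    have "\<bar>X x \<bullet> i\<bar> \<le> norm i * m x" for x
    proof -
      have "\<bar>X x \<bullet> i\<bar> \<le> norm i * norm (X x)" using Cauchy_Schwarz_ineq2[of "X x" i] by (simp add: mult.commute)
      also have "norm (X x) \<le> m x" unfolding m_def by (simp add: sum_nonneg)
      finally show ?thesis by (simp add: mult_left_mono)
    qed
    then show ?thesis unfolding dominated_def by blast
  qed
  then show "dominated K m (\<lambda>x. X x \<bullet> i)" .
  have 2: "dominated K m (\<lambda>x. \<D> X x a \<bullet> i)" for a i
  proof -
    have e: "dominated K m (\<lambda>x. \<D> X x e \<bullet> i)" if "e \<in> Basis" for e
    proof -
      have "\<bar>\<D> X x e \<bullet> i\<bar> \<le> norm i * m x" for x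
      proof -
        have "\<bar>\<D> X x e \<bullet> i\<bar> \<le> norm i * norm (\<D> X x e)"
          using Cauchy_Schwarz_ineq2[of "\<D> X x e" i] by (simp add: mult.commute)
        also have "norm (\<D> X x e) \<le> (\<Sum>e\<in>Basis. norm (\<D> X x e))"
          using that by (intro member_le_sum) auto
        also have "\<dots> \<le> m x" by (simp add: m_def)
        finally show ?thesis by (simp add: mult_left_mono)
      qed
      then show ?thesis unfolding dominated_def by blast
    qed
    have "dominated K m (\<lambda>x. \<Sum>e\<in>Basis. (a \<bullet> e) * (\<D> X x e \<bullet> i))"
      by (intro dominated_sum c continuous_on_const e)
    moreover have "(\<Sum>e\<in>Basis. (a \<bullet> e) * (\<D> X x e \<bullet> i)) = \<D> X x a \<bullet> i" if "x \<in> K" for x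
    proof -
      have "\<D> X x a = \<D> X x (\<Sum>e\<in>Basis. (a \<bullet> e) *\<^sub>R e)"
        by (simp add: euclidean_representation)
      then show ?thesis by (simp add: linear_sum[OF DXl[OF that]] linear_scale[OF DXl[OF that]] inner_sum_left)
    qed
    ultimately show ?thesis unfolding dominated_def by simp
  qed
  then show "dominated K m (\<lambda>x. \<D> X x a \<bullet> i)" .
  have lin: "dominated K m (\<lambda>x. L x (Z x))"
    if "\<And>x. x \<in> K \<Longrightarrow> linear (L x)" "\<And>i. continuous_on K (\<lambda>x. L x i)" "\<And>i. dominated K m (\<lambda>x. Z x \<bullet> i)"
    for L :: "'e \<Rightarrow> 'e \<Rightarrow> real" and Z
  proof -
    have "dominated K m (\<lambda>x. \<Sum>i\<in>Basis. L x i * (Z x \<bullet> i))"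
      by (intro dominated_sum c that)
    then show ?thesis unfolding dominated_def by (simp add: linear_expand[OF that(1), symmetric])
  qed
  define l where "l x a u v = \<D> (\<lambda>y. dG y (X x) u v) x a
      + dG x (\<D> X x a) u v
      + dG x a (\<D> X x u) v + dG x a u (\<D> X x v)" for x a u v
  have l: "dominated K m (\<lambda>x. l x a u v)" for a u v
    unfolding l_def
  proof (intro dominated_add)
    show "dominated K m (\<lambda>x. \<D> (\<lambda>y. dG y (X x) u v) x a)"
    proof (rule lin[OF _ _ 1])
      show "linear (\<lambda>z. \<D> (\<lambda>y. dG y z u v) x a)" if "x \<in> K" for x
      proof -
        have xU: "x \<in> U" using that K by auto
        have "bilinear (\<lambda>z u. \<D> (\<lambda>y. dG y z u v) x a)"
        proof (rule bilinear_derivative[OF open_U xU])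
          show "bilinear (\<lambda>z u. dG y z u v)" if "y \<in> U" for y
            unfolding bilinear_def using dG_linear[OF that] dG_bilinear[OF that] by (auto simp: bilinear_def)
          show "((\<lambda>y. dG y z u v) has_derivative (\<lambda>w. \<D> (\<lambda>y. dG y z u v) x w)) (at x)" for z u
            using smooth_on_has_derivative[OF dG_smooth xU] .
        qed
        then show ?thesis by (simp add: bilinear_def)
      qed
    qed (intro cK smooth_on_derivative dG_smooth)
    show "dominated K m (\<lambda>x. dG x (\<D> X x a) u v)"
      by (rule lin[OF _ _ 2]) (use dG_linear K cK[OF dG_smooth] in auto)
    show "dominated K m (\<lambda>x. dG x a (\<D> X x u) v)"
      by (rule lin[OF _ _ 2]) (use dG_bilinear K cK[OF dG_smooth] in \<open>auto simp: bilinear_def\<close>)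
    show "dominated K m (\<lambda>x. dG x a u (\<D> X x v))"
      by (rule lin[OF _ _ 2]) (use dG_bilinear K cK[OF dG_smooth] in \<open>auto simp: bilinear_def\<close>)
  qed
  define q where "q x a u v = G x (\<D> (\<lambda>y. \<D> X y u) x a) v" for x a u v
  have q: "dominated K m (\<lambda>x. q x a u v)" for a u v
  proof -
    have "dominated K m (\<lambda>x. (1/2) * (- l x a u v - l x u v a + l x v a u))"
      by (intro c continuous_on_const dominated_add dominated_diff dominated_minus l)
    moreover have "(1/2) * (- l x a u v - l x u v a + l x v a u) = q x a u v" if "x \<in> K" for x
      using killing_second_derivative[OF X, where x=x and a=a and u=u and v=v] that K unfolding l_def q_def by auto
    ultimately show ?thesis by (rule dominated_cong)
  qed
  \<comment> \<open>The metric dual of the functional \<open>w \<bullet> i\<close>: pairing with it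
    recovers Euclidean components from the inner products \<open>q\<close>. As the solution of a
    linear system in \<open>G\<close> it is continuous.\<close>
  define z where "z x = (SOME z. \<forall>w. G x z w = w \<bullet> i)" for x
  have z: "G x (z x) w = w \<bullet> i" if xU: "x \<in> U" for x w
  proof -
    have li: "linear (\<lambda>w. w \<bullet> i)" by (simp add: linearI inner_add_left)
    obtain z' where "\<And>w. G x z' w = w \<bullet> i" by (rule G_represent[OF xU li]) (rule that)
    then have "\<forall>w. G x z' w = w \<bullet> i" by blast
    then have "\<forall>w. G x (z x) w = w \<bullet> i" unfolding z_def by (rule someI)
    then show ?thesis by blast
  qed
  have "z differentiable (at x)" if "x \<in> U" for x
    by (rule G_solution_differentiable[OF _ z that]) simp_all
  then have "continuous_on U z"
    by (meson continuous_at_imp_continuous_on differentiable_imp_continuous_within)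
  then have zc: "continuous_on K z" using K continuous_on_subset by blast
  have "dominated K m (\<lambda>x. \<Sum>j\<in>Basis. (z x \<bullet> j) * q x a u j)"
    by (intro dominated_sum c q continuous_on_inner zc continuous_on_const)
  moreover have "(\<Sum>j\<in>Basis. (z x \<bullet> j) * q x a u j) =
      \<D> (\<lambda>y. \<D> X y u) x a \<bullet> i" if "x \<in> K" for x
  proof -
    have xU: "x \<in> U" using that K by auto
    have lG: "linear (G x w)" for w using G_bilinear[OF xU] by (simp add: bilinear_def)
    show ?thesis unfolding q_def z[OF xU, symmetric] G_sym[OF xU, of "z x"]
      by (subst linear_expand[OF lG, of _ "z x"]) (simp add: mult.commute)
  qed
  ultimately show "dominated K m (\<lambda>x. \<D> (\<lambda>y. \<D> X y u) x a \<bullet> i)"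
    unfolding dominated_def by simp
qed

text \<open>The 1-jet of a Killing field along a segment solves a linear differential equation.\<close>

lemma killing_rigidity:
  assumes X: "holomorphic_killing X" and seg: "closed_segment p y \<subseteq> U"
    and 0: "X p = 0" "\<And>v. \<D> X p v = 0"
  shows "X y = 0"
proof -
  define K where "K = closed_segment p y"
  have K: "compact K" "K \<subseteq> U" using seg by (auto simp: K_def)
  define v where "v = y - p"
  define m where "m x = norm (X x) + (\<Sum>e\<in>Basis. norm (\<D> X x e))" for x
  have m: "m x \<ge> 0" for x unfolding m_def by (intro add_nonneg_nonneg sum_nonneg) auto
  define D2 where "D2 x a e = \<D> (\<lambda>y. \<D> X y e) x a" for x a e
  note dom = killing_second_derivative_dominated[OF X K, folded m_def D2_def]
  define N where "N x = X x \<bullet> X x + (\<Sum>e\<in>Basis. \<D> X x e \<bullet> \<D> X x e)" for x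
  define f where "f x = X x \<bullet> \<D> X x v + (\<Sum>e\<in>Basis. \<D> X x e \<bullet> D2 x v e)" for x
  have N0: "N x \<ge> 0" for x unfolding N_def by (intro add_nonneg_nonneg sum_nonneg) auto
  have "dominated K (\<lambda>x. m x * m x) f" unfolding f_def
    by (intro dominated_add dominated_sum) (subst euclidean_inner, intro dominated_sum dominated_mult dom m)+
  then obtain C where C: "\<And>x. x \<in> K \<Longrightarrow> \<bar>f x\<bar> \<le> C * (m x * m x)" by (auto simp: dominated_def)
  \<comment> \<open>The number of summands of \<open>m\<close>, each of which is at most the square
    root of \<open>N\<close>.\<close>
  define d where "d = real (Suc (DIM('e)))"
  have mN: "m x * m x \<le> (d * d) * N x" for x
  proof -
    have a: "norm (X x) \<le> sqrt (N x)" unfolding N_def norm_eq_sqrt_inner by (simp add: sum_nonneg)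
    have b: "norm (\<D> X x e) \<le> sqrt (N x)" if "e \<in> Basis" for e
    proof -
      have "\<D> X x e \<bullet> \<D> X x e \<le>
        (\<Sum>e\<in>Basis. \<D> X x e \<bullet> \<D> X x e)"
        using member_le_sum[OF that, of "\<lambda>e. \<D> X x e \<bullet> \<D> X x e"] by simp
      also have "\<dots> \<le> N x" by (simp add: N_def)
      finally show ?thesis by (simp add: norm_eq_sqrt_inner)
    qed
    have "(\<Sum>e\<in>(Basis::'e set). norm (\<D> X x e)) \<le> (\<Sum>e\<in>(Basis::'e set). sqrt (N x))"
      by (intro sum_mono b)
    then have "m x \<le> d * sqrt (N x)" using a unfolding m_def d_def by (simp add: algebra_simps)
    then have "m x * m x \<le> (d * sqrt (N x)) * (d * sqrt (N x))"
      using m[of x] by (intro mult_mono) auto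
    also have "\<dots> = (d * d) * (sqrt (N x) * sqrt (N x))" by (simp only: mult_ac)
    also have "sqrt (N x) * sqrt (N x) = N x" using N0[of x] by simp
    finally show ?thesis .
  qed
  define C' where "C' = 2 * \<bar>C\<bar> * (d * d)"
  have fN: "2 * f x \<le> C' * N x" if "x \<in> K" for x
  proof -
    have "2 * f x \<le> 2 * (C * (m x * m x))" using C[OF that] by linarith
    also have "\<dots> \<le> 2 * (\<bar>C\<bar> * (m x * m x))" using m[of x] by (intro mult_left_mono mult_right_mono) auto
    also have "\<dots> \<le> 2 * (\<bar>C\<bar> * ((d * d) * N x))" by (intro mult_left_mono mN) auto
    finally show ?thesis by (simp add: C'_def mult_ac)
  qed
  have in_K: "p + t *\<^sub>R v \<in> K" if "0 \<le> t" "t \<le> 1" for t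
    unfolding K_def closed_segment_def v_def using that by (auto simp: algebra_simps intro!: exI[of _ t])
  \<comment> \<open>Gronwall's argument: \<open>fN\<close> bounds the derivative of \<open>N\<close>
    along the segment by \<open>C'\<close> times \<open>N\<close>, so the exponential weight makes
    \<open>h\<close> nonincreasing, and \<open>h\<close> starts at 0.\<close>
  define h where "h t = N (p + t *\<^sub>R v) * exp (- C' * t)" for t
  have "h 1 \<le> h 0"
  proof (rule DERIV_nonpos_imp_nonincreasing[where f=h and a=0 and b=1])
    fix t :: real assume t: "0 \<le> t" "t \<le> 1"
    define x where "x = p + t *\<^sub>R v"
    have xK: "x \<in> K" "x \<in> U" using in_K[OF t] K by (auto simp: x_def)
    have g: "((\<lambda>t. p + t *\<^sub>R v) has_derivative (\<lambda>r. r *\<^sub>R v)) (at t)" by (auto intro!: derivative_eq_intros)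
    have l: "linear (\<D> X x)" using has_derivative_linear[OF X_deriv[OF X xK(2)]] .
    have D2: "((\<lambda>y. \<D> X y e) has_derivative (\<lambda>a. D2 x a e)) (at x)" for e
      unfolding D2_def by (rule smooth_on_has_derivative[OF smooth_on_derivative[OF X_smooth[OF X]] xK(2)])
    define E where "E w = 2 * (X x \<bullet> \<D> X x w) + 2 * (\<Sum>e\<in>Basis. \<D> X x e \<bullet> D2 x w e)" for w
    have "(N has_derivative (\<lambda>w. (X x \<bullet> \<D> X x w + \<D> X x w \<bullet> X x)
      + (\<Sum>e\<in>Basis. \<D> X x e \<bullet> D2 x w e + D2 x w e \<bullet> \<D> X x e))) (at x)"
      unfolding N_def by (intro has_derivative_add has_derivative_sum has_derivative_inner X_deriv[OF X] D2 xK)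
    moreover have "(\<lambda>w. (X x \<bullet> \<D> X x w + \<D> X x w \<bullet> X x)
      + (\<Sum>e\<in>Basis. \<D> X x e \<bullet> D2 x w e + D2 x w e \<bullet> \<D> X x e))
      = E"
      unfolding E_def by (rule ext) (simp add: inner_commute[of "D2 x _ _"] inner_commute[of _ "X x"] sum_distrib_left)
    ultimately have NN: "(N has_derivative E) (at x)" by simp
    have "((\<lambda>t. N (p + t *\<^sub>R v)) has_derivative (\<lambda>r. E (r *\<^sub>R v))) (at t)"
      using has_derivative_compose[OF g, of N] NN unfolding x_def by blast
    then have "((\<lambda>t. N (p + t *\<^sub>R v)) has_derivative (\<lambda>r. r * (2 * f x))) (at t)"
      unfolding linear_scale[OF has_derivative_linear[OF NN]] by (simp add: E_def f_def distrib_left)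
    then have dN: "((\<lambda>t. N (p + t *\<^sub>R v)) has_real_derivative 2 * f x) (at t)"
      by (simp add: has_field_derivative_def mult.commute[of _ "2 * f x"])
    have "(h has_real_derivative 2 * f x * exp (- C' * t) + N x * (exp (- C' * t) * (- C'))) (at t)"
      unfolding h_def by (rule derivative_eq_intros dN refl | simp add: x_def)+
    moreover have "2 * f x * exp (- C' * t) + N x * (exp (- C' * t) * (- C')) \<le> 0"
    proof -
      have "2 * f x * exp (- C' * t) \<le> (C' * N x) * exp (- C' * t)"
        using fN[OF xK(1)] by (intro mult_right_mono) auto
      then show ?thesis by (simp add: mult_ac)
    qed
    ultimately show "\<exists>y. (h has_real_derivative y) (at t) \<and> y \<le> 0" by blast
  qed simp
  moreover have "h 0 = 0" by (simp add: h_def N_def 0)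
  ultimately have "N (p + 1 *\<^sub>R v) \<le> 0" by (simp add: h_def mult_le_0_iff)
  moreover have "X (p + 1 *\<^sub>R v) \<bullet> X (p + 1 *\<^sub>R v) \<le> N (p + 1 *\<^sub>R v)" by (simp add: N_def sum_nonneg)
  ultimately have "X (p + 1 *\<^sub>R v) \<bullet> X (p + 1 *\<^sub>R v) \<le> 0" by linarith
  then show ?thesis using inner_ge_zero[of "X y"] inner_eq_zero_iff[of "X y"] by (simp add: v_def)
qed

section \<open>Degenerate points of a commuting family\<close>

text \<open>A point \<open>x\<close> with kernel of least dimension is chosen. Unless the
  linearization of \<open>X b\<close> vanishes there, some nearby \<open>x + t *\<^sub>R v\<close>
  has a strictly smaller kernel. To see the strict drop, \<open>X b\<close> has to be rescaled,
  since by itself it tends to 0 at \<open>x\<close>.\<close>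

lemma commuting_killing_trivial_jet:
  fixes X :: "'k::euclidean_space \<Rightarrow> 'e \<Rightarrow> 'e"
  assumes hk: "\<And>b. holomorphic_killing (X b)" and lin: "\<And>x. x \<in> U \<Longrightarrow> linear (\<lambda>b. X b x)"
    and comm: "\<And>x b c. x \<in> U \<Longrightarrow> \<D> (X b) x (X c x) = \<D> (X c) x (X b x)"
    and W: "open W" "W \<subseteq> U" "W \<noteq> {}"
    and deg: "\<And>x. x \<in> W \<Longrightarrow> \<exists>b. b \<noteq> 0 \<and> X b x = 0"
  obtains x b where "x \<in> W" "b \<noteq> 0" "X b x = 0" "\<And>v. \<D> (X b) x v = 0"
proof -
  define ker where "ker x = {b. X b x = 0}" for x
  have sub: "subspace (ker x)" if "x \<in> U" for x
    unfolding ker_def using lin[OF that] by (rule linear_subspace_kernel)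
  obtain x where x: "x \<in> W" "\<And>y. y \<in> W \<Longrightarrow> dim (ker x) \<le> dim (ker y)"
    using ex_has_least_nat[of "\<lambda>x. x \<in> W" _ "\<lambda>x. dim (ker x)"] W(3) by blast
  have xU: "x \<in> U" using x W by auto
  obtain b where b: "b \<noteq> 0" "X b x = 0" using deg x by blast
  have "\<D> (X b) x v = 0" for v
  proof (rule ccontr)
    define w where "w = \<D> (X b) x v"
    assume "\<D> (X b) x v \<noteq> 0"
    then have w0: "w \<noteq> 0" by (simp add: w_def)
    have nab: "nabla (X b) x u = \<D> (X b) x u" for u
      by (simp add: nabla_def b \<Gamma>_simps xU)
    \<comment> \<open>\<open>w\<close> lies in the image of the linearization of \<open>X b\<close>,
      which is skew and, by commutation, annihilates each \<open>X c x\<close>.\<close>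
    have orth: "G x w (X c x) = 0" for c
    proof -
      have "G x w (X c x) = - G x v (\<D> (X b) x (X c x))"
        using nabla_skew[OF hk[of b] xU, of v "X c x"] by (simp add: nab w_def)
      also have "\<D> (X b) x (X c x) = 0"
        using comm[OF xU, of b c] linear_0[OF has_derivative_linear[OF X_deriv[OF hk xU]]] by (simp add: b(2))
      finally show ?thesis by (simp add: G_simps xU)
    qed
    define K' where "K' = {k \<in> ker x. k \<bullet> b = 0}"
    have K': "subspace K'" unfolding K'_def using sub[OF xU]
      by (auto simp: subspace_def inner_add_left)
    have "K' \<subseteq> ker x" "b \<in> ker x" "b \<notin> K'" using b by (auto simp: K'_def ker_def)
    then have "K' \<subset> ker x" by blast
    then have "span K' \<subset> span (ker x)"
      unfolding span_eq_iff[THEN iffD2, OF K'] span_eq_iff[THEN iffD2, OF sub[OF xU]] .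
    then have dimlt: "dim K' < dim (ker x)" by (rule dim_psubset)
    \<comment> \<open>\<open>S\<close> contains \<open>b\<close> and a complement of the kernel, so
      its dimension exceeds the rank at \<open>x\<close>. If the fields from \<open>S\<close> are
      independent at a nearby point, the kernel there is too small.\<close>
    define S where "S = {c \<in> UNIV. \<forall>k\<in>K'. orthogonal k c}"
    have dimS: "dim S + dim K' = DIM('k)"
      unfolding S_def using dim_subspace_orthogonal_to_vectors[OF K' subspace_UNIV] by simp
    have S: "subspace S" unfolding S_def using subspace_orthogonal_to_vectors[of K'] by simp
    define \<rho> where "\<rho> c = (c \<bullet> b) / (b \<bullet> b)" for c
    define \<sigma> where "\<sigma> c = c - \<rho> c *\<^sub>R b" for c
    have \<rho>: "linear \<rho>" by (rule linearI) (simp_all add: \<rho>_def inner_add_left add_divide_distrib)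
    have \<sigma>: "linear \<sigma>" unfolding \<sigma>_def
      by (rule linearI) (simp_all add: linear_add[OF \<rho>] linear_scale[OF \<rho>] algebra_simps)
    \<comment> \<open>The component of the field along \<open>b\<close> is divided by
      \<open>t\<close>, and the quotient has the limit \<open>w\<close>. At \<open>t = 0\<close> the
      map is injective on \<open>S\<close> by \<open>orth\<close>, and injectivity survives small
      perturbations.\<close>
    define M where "M t c = (if t = 0 then X (\<sigma> c) x + \<rho> c *\<^sub>R w
      else X (\<sigma> c) (x + t *\<^sub>R v) + \<rho> c *\<^sub>R (inverse t *\<^sub>R X b (x + t *\<^sub>R v)))" for t c
    have M_lin: "linear (M t)" if "x + t *\<^sub>R v \<in> U" for t
    proof -
      note l = lin[OF that] lin[OF xU]
      show ?thesis unfolding M_def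
        by (rule linearI) (simp_all add: linear_add[OF \<rho>] linear_scale[OF \<rho>] linear_add[OF \<sigma>] linear_scale[OF \<sigma>]
          linear_add[OF l(1)] linear_scale[OF l(1)] linear_add[OF l(2)] linear_scale[OF l(2)] algebra_simps)
    qed
    have inj0: "c = 0" if c: "c \<in> S" "M 0 c = 0" for c
    proof -
      have e: "X (\<sigma> c) x + \<rho> c *\<^sub>R w = 0" using c by (simp add: M_def)
      have "\<rho> c * G x w w = G x w (X (\<sigma> c) x + \<rho> c *\<^sub>R w)" using orth by (simp add: G_simps xU)
      also have "\<dots> = 0" by (simp add: e G_simps xU)
      finally have r0: "\<rho> c = 0" using G_pos[OF xU w0] by simp
      then have "X c x = 0" "c \<bullet> b = 0" using e b by (auto simp: \<sigma>_def \<rho>_def)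
      then have "c \<in> K'" by (simp add: K'_def ker_def)
      then show ?thesis using c(1) by (auto simp: S_def orthogonal_def)
    qed
    have "bounded_linear (M 0)" using M_lin[of 0] xU by (simp add: linear_conv_bounded_linear)
    then obtain \<epsilon> where \<epsilon>: "\<epsilon> > 0" "\<And>c. c \<in> S \<Longrightarrow> \<epsilon> * norm c \<le> norm (M 0 c)"
      using injective_imp_isometric[OF closed_subspace[OF S] S] inj0 by blast
    have line: "((\<lambda>t. x + t *\<^sub>R v) \<longlongrightarrow> x) (at 0)"
    proof -
      have "((\<lambda>t. x + t *\<^sub>R v) \<longlongrightarrow> x + 0 *\<^sub>R v) (at 0)" by (intro tendsto_intros)
      then show ?thesis by simp
    qed
    have lim: "((\<lambda>t. M t c) \<longlongrightarrow> M 0 c) (at 0)" for c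
    proof -
      have "isCont (X (\<sigma> c)) x" using has_derivative_continuous[OF X_deriv[OF hk xU]] .
      then have 1: "((\<lambda>t. X (\<sigma> c) (x + t *\<^sub>R v)) \<longlongrightarrow> X (\<sigma> c) x) (at 0)"
        using isCont_tendsto_compose[OF _ line] by blast
      have "((\<lambda>t. x + t *\<^sub>R v) has_derivative (\<lambda>r. r *\<^sub>R v)) (at 0)" by (auto intro!: derivative_eq_intros)
      moreover have "(X b has_derivative \<D> (X b) x) (at (x + 0 *\<^sub>R v))"
        using X_deriv[OF hk xU] by simp
      ultimately have "((\<lambda>t. X b (x + t *\<^sub>R v)) has_derivative (\<lambda>r. \<D> (X b) x (r *\<^sub>R v))) (at 0)"
        by (rule has_derivative_compose)
      then have "((\<lambda>t. X b (x + t *\<^sub>R v)) has_vector_derivative w) (at 0)"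
        unfolding has_vector_derivative_def w_def
        by (simp add: linear_scale[OF has_derivative_linear[OF X_deriv[OF hk xU]]])
      then have 2: "((\<lambda>t. inverse t *\<^sub>R X b (x + t *\<^sub>R v)) \<longlongrightarrow> w) (at 0)"
      proof -
        assume d: "((\<lambda>t. X b (x + t *\<^sub>R v)) has_vector_derivative w) (at 0)"
        have "((\<lambda>t. norm (X b (x + t *\<^sub>R v) - t *\<^sub>R w) / norm t) \<longlongrightarrow> 0) (at 0)"
          using d by (simp add: has_vector_derivative_def has_derivative_at b(2))
        then have "((\<lambda>t. norm (inverse t *\<^sub>R X b (x + t *\<^sub>R v) - w)) \<longlongrightarrow> 0) (at 0)"
        proof (rule Lim_transform_eventually)
          have "norm (X b (x + t *\<^sub>R v) - t *\<^sub>R w) / norm t = norm (inverse t *\<^sub>R X b (x + t *\<^sub>R v) - w)"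
            if "t \<noteq> 0" for t
          proof -
            have "inverse t *\<^sub>R X b (x + t *\<^sub>R v) - w = inverse t *\<^sub>R (X b (x + t *\<^sub>R v) - t *\<^sub>R w)"
              using that by (simp add: scaleR_diff_right)
            then show ?thesis by (simp add: divide_inverse mult.commute)
          qed
          then show "\<forall>\<^sub>F t in at 0. norm (X b (x + t *\<^sub>R v) - t *\<^sub>R w) / norm t = norm (inverse t *\<^sub>R X b (x + t *\<^sub>R v) - w)"
            by (simp add: eventually_at_filter)
        qed
        then show ?thesis using Lim_null tendsto_norm_zero_iff by blast
      qed
      have "((\<lambda>t. X (\<sigma> c) (x + t *\<^sub>R v) + \<rho> c *\<^sub>R (inverse t *\<^sub>R X b (x + t *\<^sub>R v))) \<longlongrightarrow> X (\<sigma> c) x + \<rho> c *\<^sub>R w) (at 0)"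
        by (intro tendsto_intros 1 2)
      then have "((\<lambda>t. M t c) \<longlongrightarrow> X (\<sigma> c) x + \<rho> c *\<^sub>R w) (at 0)"
        by (rule Lim_transform_eventually) (simp add: M_def eventually_at_filter)
      then show ?thesis by (simp add: M_def)
    qed
    have "((\<lambda>t. \<Sum>i\<in>Basis. norm (M t i - M 0 i)) \<longlongrightarrow> (\<Sum>i\<in>(Basis::'k set). norm (M 0 i - M 0 i))) (at 0)"
      by (intro tendsto_intros lim)
    then have "((\<lambda>t. \<Sum>i\<in>(Basis::'k set). norm (M t i - M 0 i)) \<longlongrightarrow> 0) (at 0)" by simp
    then have ev1: "\<forall>\<^sub>F t in at 0. (\<Sum>i\<in>(Basis::'k set). norm (M t i - M 0 i)) < \<epsilon>"
      using \<epsilon>(1) by (rule order_tendstoD)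
    have ev2: "\<forall>\<^sub>F t in at 0. x + t *\<^sub>R v \<in> W"
      using topological_tendstoD[OF line W(1) x(1)] .
    have ev3: "\<forall>\<^sub>F t in at (0::real). t \<noteq> 0" by (simp add: eventually_at_filter)
    obtain t where t: "(\<Sum>i\<in>(Basis::'k set). norm (M t i - M 0 i)) < \<epsilon>" "x + t *\<^sub>R v \<in> W" "t \<noteq> 0"
      using eventually_happens[OF eventually_conj[OF ev1 eventually_conj[OF ev2 ev3]]] by auto
    define y where "y = x + t *\<^sub>R v"
    have yW: "y \<in> W" and yU: "y \<in> U" using t W by (auto simp: y_def)
    \<comment> \<open>\<open>M t\<close> differs from \<open>M 0\<close> by less than
      \<open>\<epsilon>\<close>, the lower bound of \<open>M 0\<close> on \<open>S\<close>.\<close>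
    have inj: "c = 0" if c: "c \<in> S" "M t c = 0" for c
    proof (rule ccontr)
      assume "c \<noteq> 0"
      have l: "linear (\<lambda>c. M t c - M 0 c)" using M_lin[of t] M_lin[of 0] yU xU
        by (intro linear_compose_sub) (simp_all add: y_def)
      have "M t c - M 0 c = (\<Sum>i\<in>Basis. (c \<bullet> i) *\<^sub>R (M t i - M 0 i))"
      proof -
        have "M t c - M 0 c = (\<lambda>c. M t c - M 0 c) (\<Sum>i\<in>Basis. (c \<bullet> i) *\<^sub>R i)"
          by (simp add: euclidean_representation)
        also have "\<dots> = (\<Sum>i\<in>Basis. (c \<bullet> i) *\<^sub>R (M t i - M 0 i))"
          unfolding linear_sum[OF l] linear_scale[OF l] ..
        finally show ?thesis .
      qed
      also have "norm \<dots> \<le> (\<Sum>i\<in>Basis. norm c * norm (M t i - M 0 i))"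
        by (intro sum_norm_le) (simp add: mult_right_mono Basis_le_norm)
      also have "\<dots> = norm c * (\<Sum>i\<in>Basis. norm (M t i - M 0 i))" by (simp add: sum_distrib_left)
      also have "\<dots> < norm c * \<epsilon>" using t(1) \<open>c \<noteq> 0\<close> by (intro mult_strict_left_mono) auto
      finally have "norm (M 0 c) < norm c * \<epsilon>" using c(2) by simp
      then show False using \<epsilon>(2)[OF c(1)] by (simp add: mult.commute)
    qed
    have "b \<in> S" unfolding S_def K'_def by (auto simp: orthogonal_def)
    have "k = 0" if k: "k \<in> S" "X k y = 0" for k
    proof -
      \<comment> \<open>Multiplying the component along \<open>b\<close> by \<open>t\<close> undoes
        the rescaling, so \<open>M t c\<close> is the value of \<open>X k\<close> at
        \<open>y\<close>.\<close>
      define c where "c = k - \<rho> k *\<^sub>R b + (t * \<rho> k) *\<^sub>R b"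
      have "c \<in> S" unfolding c_def
        by (intro subspace_add[OF S] subspace_diff[OF S] subspace_scale[OF S] k \<open>b \<in> S\<close>)
      moreover have \<rho>c: "\<rho> c = t * \<rho> k"
        using b(1) by (simp add: c_def \<rho>_def inner_add_left inner_diff_left field_simps)
      moreover have "\<sigma> c = k - \<rho> k *\<^sub>R b" by (simp add: \<sigma>_def \<rho>c) (simp add: c_def)
      ultimately have "M t c = X (k - \<rho> k *\<^sub>R b) y + (t * \<rho> k) *\<^sub>R (inverse t *\<^sub>R X b y)"
        using t(3) by (simp add: M_def y_def)
      also have "\<dots> = 0" using t(3) k(2)
        by (simp add: linear_diff[OF lin[OF yU]] linear_scale[OF lin[OF yU]])
      finally have "c = 0" by (rule inj[OF \<open>c \<in> S\<close>])
      then have "\<rho> k = 0" using \<rho>c t(3) by (simp add: \<rho>_def)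
      then show ?thesis using \<open>c = 0\<close> by (simp add: c_def)
    qed
    then have "ker y \<inter> S = {0}"
      using subspace_0[OF S] subspace_0[OF sub[OF yU]] by (auto simp: ker_def)
    then have "dim {a + c |a c. a \<in> ker y \<and> c \<in> S} = dim (ker y) + dim S"
      using dim_sums_Int[OF sub[OF yU] S] by simp
    then have "dim (ker y) + dim S \<le> DIM('k)"
      using dim_subset_UNIV[of "{a + c |a c. a \<in> ker y \<and> c \<in> S}"] by simp
    then have "dim (ker y) \<le> dim K'" using dimS by linarith
    then show False using x(2)[OF yW] dimlt by linarith
  qed
  then show ?thesis using that x(1) b by blast
qed

section \<open>The maximum principle\<close>

text \<open>The second derivative test in terms of the gradient: at a maximum the gradient vanishes,
  so its covariant and coordinate derivatives agree, and this derivative is negative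
  semidefinite.\<close>

lemma divergence_at_max:
  assumes X: "holomorphic_killing X" and x: "x \<in> U"
    and H: "\<And>y. y \<in> U \<Longrightarrow> (H has_derivative (\<lambda>w. G y (Y X y) w)) (at y)"
    and max: "\<And>y. y \<in> U \<Longrightarrow> H y \<le> H x"
  shows "Y X x = 0" "tr (nabla (Y X) x) \<le> 0"
proof -
  have "(\<lambda>w. G x (Y X x) w) = (\<lambda>w. 0)"
    using differential_zero_maxmin[OF x open_U H[OF x]] max by blast
  then show Y0: "Y X x = 0" using G_pos[OF x, of "Y X x"] by (metis less_irrefl)
  have Yd: "(Y X has_derivative \<D> (Y X) x) (at x)"
    using Y_deriv[OF X x] by (simp add: frechetI[OF Y_deriv[OF X x]])
  have neg: "G x (\<D> (Y X) x v) v \<le> 0" for v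
  proof (rule ccontr)
    assume "\<not> ?thesis"
    then have q: "0 < G x (\<D> (Y X) x v) v" by simp
    have g: "((\<lambda>t. x + t *\<^sub>R v) has_derivative (\<lambda>r. r *\<^sub>R v)) (at t)" for t by (auto intro!: derivative_eq_intros)
    \<comment> \<open>\<open>\<psi>\<close> is the derivative of \<open>H\<close> along the line in
      direction \<open>v\<close>. It vanishes at 0, and a positive slope there would lift
      \<open>H\<close> above its maximum by the mean value theorem.\<close>
    define \<psi> where "\<psi> t = G (x + t *\<^sub>R v) (Y X (x + t *\<^sub>R v)) v" for t
    have "((\<lambda>y. G y (Y X y) v) has_derivative (\<lambda>w. dG x w (Y X x) v + G x (\<D> (Y X) x w) v + G x (Y X x) 0)) (at (x + 0 *\<^sub>R v))"
      using has_derivative_G[OF x Yd has_derivative_const] by simp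
    from has_derivative_compose[OF g this]
    have "(\<psi> has_derivative (\<lambda>r. r * G x (\<D> (Y X) x v) v)) (at 0)"
      unfolding \<psi>_def
      by (simp add: Y0 G_simps bilinear_lzero[OF dG_bilinear] x linear_scale[OF has_derivative_linear[OF Yd]])
    then have "(\<psi> has_real_derivative G x (\<D> (Y X) x v) v) (at 0)"
      by (simp add: has_field_derivative_def mult.commute[of _ "G _ _ _"])
    from DERIV_pos_inc_right[OF this q] obtain d where d: "d > 0" "\<And>h. 0 < h \<Longrightarrow> h < d \<Longrightarrow> \<psi> 0 < \<psi> h" by auto
    have \<psi>0: "\<psi> 0 = 0" by (simp add: \<psi>_def Y0 G_simps x)
    have "((\<lambda>t. x + t *\<^sub>R v) \<longlongrightarrow> x + 0 *\<^sub>R v) (at 0)" by (intro tendsto_intros)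
    then have "\<forall>\<^sub>F t in at 0. x + t *\<^sub>R v \<in> U" using topological_tendstoD[OF _ open_U, of _ x] x by simp
    then obtain d' where d': "d' > 0" "\<And>t. t \<noteq> 0 \<Longrightarrow> \<bar>t\<bar> < d' \<Longrightarrow> x + t *\<^sub>R v \<in> U"
      unfolding eventually_at by (auto simp: dist_real_def)
    define s where "s = min d d' / 2"
    have s: "0 < s" "s < d" "s < d'" using d d' by (auto simp: s_def)
    have inU: "x + t *\<^sub>R v \<in> U" if "0 \<le> t" "t \<le> s" for t
      using d'(2)[of t] that s x by (cases "t = 0") auto
    have dH: "((\<lambda>t. H (x + t *\<^sub>R v)) has_real_derivative \<psi> t) (at t)" if "0 \<le> t" "t \<le> s" for t
      using has_derivative_compose[OF g H[OF inU[OF that]]]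
      by (simp add: has_field_derivative_def \<psi>_def G_simps inU[OF that] mult.commute[of _ "G _ _ _"])
    have "\<exists>z>0. z < s \<and> H (x + s *\<^sub>R v) - H (x + 0 *\<^sub>R v) = (s - 0) * \<psi> z"
      by (rule MVT2[OF s(1)]) (use dH in auto)
    then obtain z where z: "0 < z" "z < s" "H (x + s *\<^sub>R v) - H x = s * \<psi> z" by auto
    have "\<psi> z > 0" using d(2)[of z] z s \<psi>0 by simp
    then have "H (x + s *\<^sub>R v) > H x" using z s by (metis diff_gt_0_iff_gt mult_pos_pos)
    then show False using max[OF inU[of s]] s by simp
  qed
  obtain P Q :: "'e \<Rightarrow> 'e" where PQ: "linear P" "linear Q" "\<And>u. P (Q u) = u" "\<And>u. Q (P u) = u" "\<And>u v. G x (P u) (P v) = u \<bullet> v"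
    by (rule orthonormal_frame[OF G_bilinear[OF x] G_sym[OF x] G_pos[OF x]]) (assumption, rule that)
  have nY: "nabla (Y X) x = \<D> (Y X) x"
    by (rule ext) (simp add: nabla_def Y0 \<Gamma>_simps x)
  have "tr (nabla (Y X) x) = (\<Sum>e\<in>Basis. G x (\<D> (Y X) x (P e)) (P e))"
    unfolding nY by (rule tr_orthonormal_frame[OF PQ has_derivative_linear[OF Yd]])
  also have "\<dots> \<le> 0" by (intro sum_nonpos neg)
  finally show "tr (nabla (Y X) x) \<le> 0" .
qed

end

section \<open>Hamiltonian Killing fields\<close>

context local_kaehler
begin

text \<open>A field that is both Hamiltonian and holomorphic is Killing: symmetry of the second
  derivatives of \<open>H\<close> and closedness give invariance of the Kaehler form, and holomorphy
  transfers it to the metric.\<close>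

lemma holomorphic_killing_potential:
  assumes X: "smooth_on U X" and XJ: "\<And>x v. x \<in> U \<Longrightarrow> \<D> X x (J v) = J (\<D> X x v)"
    and H: "smooth_on U H" "\<And>x v. x \<in> U \<Longrightarrow> \<D> H x v = G x (Y X x) v"
  shows "holomorphic_killing X"
proof -
  have "dG x (X x) u v + G x (\<D> X x u) v + G x u (\<D> X x v) = 0"
    if x: "x \<in> U" for x u v
  proof -
    define D where "D = \<D> X x"
    have "(X has_derivative D) (at x)" unfolding D_def by (rule smooth_on_has_derivative[OF X x])
    then have Yd: "(Y X has_derivative (\<lambda>w. - J (D w))) (at x)"
      unfolding Y_def by (intro has_derivative_minus bounded_linear.has_derivative[OF J_bounded])
    have d: "\<D> (\<lambda>y. \<D> H y a) x w = dG x w (Y X x) a + G x (- J (D w)) a" for a w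
    proof -
      have 1: "((\<lambda>y. G y (Y X y) a) has_derivative (\<lambda>w. dG x w (Y X x) a + G x (- J (D w)) a + G x (Y X x) 0)) (at x)"
        by (rule has_derivative_G[OF x Yd has_derivative_const])
      have "((\<lambda>y. \<D> H y a) has_derivative (\<lambda>w. dG x w (Y X x) a + G x (- J (D w)) a + G x (Y X x) 0)) (at x)"
        by (rule frechet_cong_U[OF x 1]) (simp add: H(2))
      from fun_cong[OF frechetI[OF this], of w] show ?thesis by (simp add: G_simps x)
    qed
    have sym: "dG x w (Y X x) a + G x (- J (D w)) a = dG x a (Y X x) w + G x (- J (D a)) w" for a w
      using symmetric_second_derivative[OF open_U x H(1), of a w] unfolding d .
    have cl: "dG x a (J (X x)) b + dG x (X x) (J b) a + dG x b (J a) (X x) = 0" for a b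
      using closed[OF x, of "X x" b a] by (simp add: dG_def)
    \<comment> \<open>The vanishing Lie derivative of the Kaehler form along \<open>X\<close>,
      evaluated on \<open>b\<close> and \<open>a\<close>.\<close>
    have key: "dG x (X x) (J b) a = G x (J (D a)) b - G x (J (D b)) a" for a b
      using sym[of a b] cl[of a b] dG_J_left[OF x, of b a "X x"] dG_sym[OF x, of b a "J (X x)"]
      by (simp add: Y_def dG_simps G_simps x)
    have "dG x (X x) u v = G x (J (D v)) (- J u) - G x (J (D (- J u))) v"
      using key[of "- J u" v] by (simp add: J_simps)
    also have "D (- J u) = - J (D u)"
      using XJ[OF x, of u] linear_neg[OF smooth_on_has_derivative[OF X x, THEN has_derivative_linear]] by (simp add: D_def)
    finally show ?thesis
      using G_sym[OF x, of "D v" u] by (simp add: J_simps G_simps x G_J D_def)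
  qed
  then show ?thesis unfolding holomorphic_killing_def using X XJ by blast
qed

lemma nabla_Y_continuous:
  assumes X: "holomorphic_killing X"
  shows "continuous_on U (\<lambda>x. G x (nabla (Y X) x w) v)"
proof (rule continuous_at_imp_continuous_on, rule ballI)
  fix x assume x: "x \<in> U"
  have 1: "((\<lambda>y. \<D> X y w) has_derivative \<D> (\<lambda>y. \<D> X y w) x) (at x)"
    by (rule smooth_on_has_derivative[OF smooth_on_derivative[OF X_smooth[OF X]] x])
  note 2 = has_derivative_G[OF x has_derivative_minus[OF bounded_linear.has_derivative[OF J_bounded
      has_derivative_add[OF 1 has_derivative_\<Gamma>[OF x has_derivative_const X_deriv[OF X x]]]]] has_derivative_const]
  have eq: "G y (- J (\<D> X y w + \<Gamma> y w (X y))) v = G y (nabla (Y X) y w) v" if "y \<in> U" for y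
    by (subst nabla_Y[OF X that]) (simp add: nabla_def)
  show "isCont (\<lambda>x. G x (nabla (Y X) x w) v) x"
    using frechet_cong_U[OF x 2 eq] by (rule has_derivative_continuous)
qed

lemma G_continuous: "continuous_on U (\<lambda>x. G x u v)"
  by (rule smooth_on_continuous[OF G_smooth])

text \<open>By \<open>iso\<close> the range of \<open>X\<close> is isotropic for the Kaehler form,
  so it meets its image under \<open>J\<close> only in 0; by the dimension hypothesis the two
  together are the whole space.\<close>

lemma lagrangian_span:
  fixes X :: "'k::euclidean_space \<Rightarrow> 'e"
  assumes x: "x \<in> U" and X: "linear X" "inj X" and dims: "DIM('e) = 2 * DIM('k)"
    and iso: "\<And>a b. G x (J (X a)) (X b) = 0"
    and L: "linear L" "\<And>b. L (X b) = 0" "\<And>b. L (J (X b)) = (0::real)"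
  shows "L v = 0"
proof -
  have JX: "linear (\<lambda>b. J (X b))" using linear_compose[OF X(1) J_linear] by (simp add: o_def)
  have inj: "inj (\<lambda>b. J (X b))"
  proof (rule injI)
    fix a b assume "J (X a) = J (X b)"
    then have "J (J (X a)) = J (J (X b))" by simp
    then show "a = b" using injD[OF X(2)] by (simp add: JJ)
  qed
  have s: "subspace (range X)" "subspace (range (\<lambda>b. J (X b)))"
    using linear_subspace_image[OF X(1) subspace_UNIV] linear_subspace_image[OF JX subspace_UNIV] by auto
  have d: "dim (range X) = DIM('k)" "dim (range (\<lambda>b. J (X b))) = DIM('k)"
    using dim_image_eq[OF X(1), of UNIV] dim_image_eq[OF JX, of UNIV] X(2) inj by (simp_all add: inj_on_def)
  have "range X \<inter> range (\<lambda>b. J (X b)) = {0}"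
  proof -
    have "u = 0" if "u = X a" "u = J (X b)" for u a b
      using iso[of b a] G_pos[OF x, of u] that by auto
    then show ?thesis using subspace_0[OF s(1)] subspace_0[OF s(2)] by blast
  qed
  then have "dim {a + b |a b. a \<in> range X \<and> b \<in> range (\<lambda>b. J (X b))} = DIM('e)"
    using dim_sums_Int[OF s] d dims by simp
  then have "span {a + b |a b. a \<in> range X \<and> b \<in> range (\<lambda>b. J (X b))} = UNIV"
    by (simp add: dim_eq_full)
  then have "{a + b |a b. a \<in> range X \<and> b \<in> range (\<lambda>b. J (X b))} = UNIV"
    unfolding span_eq_iff[THEN iffD2, OF subspace_sums[OF s]] .
  then obtain a b where "v = X a + J (X b)" by blast
  then show ?thesis using L by (simp add: linear_add[OF L(1)])
qed

end

section \<open>Complex manifolds\<close>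

lemma linear_ii: "linear (\<lambda>u. \<i> *s (u :: complex^'n::finite))"
  by (rule linearI) (simp_all add: vec_eq_iff algebra_simps)

locale atlas =
  fixes A :: "('m::t2_space, 'n::finite) chart set"
  assumes atlas: "complex_atlas A"
begin

definition overlap :: "('m, 'n) chart \<Rightarrow> ('m, 'n) chart \<Rightarrow> (complex^'n) set" where
  "overlap c c' = coord c ` (cdom c \<inter> cdom c')"

definition T :: "('m, 'n) chart \<Rightarrow> ('m, 'n) chart \<Rightarrow> complex^'n \<Rightarrow> complex^'n \<Rightarrow> complex^'n" where
  "T c c' x u = \<D> (coord c' \<circ> cinv c) x u"

lemma charts_at_iff: "c \<in> charts_at A p \<longleftrightarrow> c \<in> A \<and> p \<in> cdom c"
  by (simp add: charts_at_def)

lemma chart_at: "chart_at A p \<in> charts_at A p"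
proof -
  have "p \<in> (\<Union>c\<in>A. cdom c)" using atlas by (simp add: complex_atlas_def)
  then have "\<exists>c. c \<in> charts_at A p" unfolding charts_at_def by blast
  then show ?thesis unfolding chart_at_def by (rule someI_ex)
qed

lemma open_cdom: "c \<in> A \<Longrightarrow> open (cdom c)" and open_cran: "c \<in> A \<Longrightarrow> open (cran c)"
  and chart_homeo: "c \<in> A \<Longrightarrow> homeomorphism (cdom c) (cran c) (coord c) (cinv c)"
  using atlas by (auto simp: complex_atlas_def)

lemma cinv_coord: "c \<in> A \<Longrightarrow> p \<in> cdom c \<Longrightarrow> cinv c (coord c p) = p"
  using chart_homeo by (auto simp: homeomorphism_def)

lemma coord_cinv: "x \<in> cran c \<Longrightarrow> coord c (cinv c x) = x" by (rule f_inv_into_f)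

lemma cinv_in: "x \<in> cran c \<Longrightarrow> cinv c x \<in> cdom c" by (rule inv_into_into)

lemma continuous_cinv: "c \<in> A \<Longrightarrow> continuous_on (cran c) (cinv c)"
  and continuous_coord: "c \<in> A \<Longrightarrow> continuous_on (cdom c) (coord c)"
  using chart_homeo by (auto simp: homeomorphism_def)

lemma overlap_iff: "c \<in> A \<Longrightarrow> x \<in> overlap c c' \<longleftrightarrow> x \<in> cran c \<and> cinv c x \<in> cdom c'"
  unfolding overlap_def by (auto simp: cinv_coord intro!: image_eqI[of _ _ "cinv c x"])

lemma open_overlap: assumes "c \<in> A" "c' \<in> A" shows "open (overlap c c')"
proof -
  have "overlap c c' = cran c \<inter> cinv c -` cdom c'" by (rule set_eqI) (simp add: overlap_iff[OF assms(1)])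
  then show ?thesis
    using continuous_open_preimage[OF continuous_cinv open_cran open_cdom] assms by simp
qed

lemma coord_overlap: "c \<in> charts_at A p \<Longrightarrow> c' \<in> charts_at A p \<Longrightarrow> coord c p \<in> overlap c c'"
  by (auto simp: overlap_def charts_at_iff)

lemma transition_smooth: "c \<in> A \<Longrightarrow> c' \<in> A \<Longrightarrow> smooth_on (overlap c c') (coord c' \<circ> cinv c)"
  and T_ii: "c \<in> A \<Longrightarrow> c' \<in> A \<Longrightarrow> x \<in> overlap c c' \<Longrightarrow> T c c' x (\<i> *s u) = \<i> *s T c c' x u"
  using atlas unfolding complex_atlas_def holomorphic_map_on_def overlap_def T_def by blast+

lemma T_deriv: "c \<in> A \<Longrightarrow> c' \<in> A \<Longrightarrow> x \<in> overlap c c' \<Longrightarrow> ((coord c' \<circ> cinv c) has_derivative T c c' x) (at x)"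
  unfolding T_def using smooth_on_has_derivative[OF transition_smooth] by simp

lemma T_linear: "c \<in> A \<Longrightarrow> c' \<in> A \<Longrightarrow> x \<in> overlap c c' \<Longrightarrow> linear (T c c' x)"
  using T_deriv has_derivative_linear by blast

section \<open>Change of chart for differentials, tangent vectors and tensors\<close>

lemma has_derivative_chart_change:
  assumes c: "c \<in> charts_at A p" "c' \<in> charts_at A p"
    and f: "((f \<circ> cinv c') has_derivative D) (at (coord c' p))"
  shows "((f \<circ> cinv c) has_derivative (\<lambda>u. D (T c c' (coord c p) u))) (at (coord c p))"
proof -
  have cA: "c \<in> A" "c' \<in> A" "p \<in> cdom c" "p \<in> cdom c'" using c by (auto simp: charts_at_iff)
  have x: "coord c p \<in> overlap c c'" by (rule coord_overlap[OF c])
  have f': "((f \<circ> cinv c') has_derivative D) (at ((coord c' \<circ> cinv c) (coord c p)))"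
    using f cA by (simp add: cinv_coord)
  have 1: "((\<lambda>y. (f \<circ> cinv c') ((coord c' \<circ> cinv c) y)) has_derivative (\<lambda>u. D (T c c' (coord c p) u))) (at (coord c p))"
    by (rule has_derivative_compose[OF T_deriv[OF cA(1,2) x] f'])
  show ?thesis
    by (rule has_derivative_transform_within_open[OF 1 open_overlap[OF cA(1,2)] x])
      (auto simp: overlap_iff cA cinv_coord)
qed

lemma T_comp:
  assumes c: "c \<in> charts_at A p" "c' \<in> charts_at A p" "c'' \<in> charts_at A p"
  shows "T c' c'' (coord c' p) (T c c' (coord c p) u) = T c c'' (coord c p) u"
proof -
  have cA: "c \<in> A" "c' \<in> A" "c'' \<in> A" using c by (auto simp: charts_at_iff)
  have "((coord c'' \<circ> cinv c) has_derivative (\<lambda>u. T c' c'' (coord c' p) (T c c' (coord c p) u))) (at (coord c p))"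
    by (rule has_derivative_chart_change[OF c(1,2) T_deriv[OF cA(2,3) coord_overlap[OF c(2,3)]]])
  from fun_cong[OF has_derivative_unique[OF this T_deriv[OF cA(1,3) coord_overlap[OF c(1,3)]]]] show ?thesis .
qed

lemma T_id: assumes c: "c \<in> charts_at A p" shows "T c c (coord c p) u = u"
proof -
  have cA: "c \<in> A" using c by (auto simp: charts_at_iff)
  have 1: "((\<lambda>y. y) has_derivative (\<lambda>u. u)) (at (coord c p))" by simp
  have "((coord c \<circ> cinv c) has_derivative (\<lambda>u. u)) (at (coord c p))"
    by (rule has_derivative_transform_within_open[OF 1 open_overlap[OF cA cA] coord_overlap[OF c c]])
      (auto simp: overlap_iff cA coord_cinv)
  from fun_cong[OF has_derivative_unique[OF T_deriv[OF cA cA coord_overlap[OF c c]] this]] show ?thesis .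
qed

lemma chart_vec_eq: "chart_vec A p c u = (\<lambda>c'. if c' \<in> charts_at A p then T c c' (coord c p) u else 0)"
  unfolding chart_vec_def T_def by simp

lemma tangent_iff: "v \<in> tangent_space A p \<longleftrightarrow>
    (\<forall>c\<in>charts_at A p. \<forall>c'\<in>charts_at A p. v c' = T c c' (coord c p) (v c)) \<and> (\<forall>c. c \<notin> charts_at A p \<longrightarrow> v c = 0)"
  unfolding tangent_space_def T_def by simp

lemma chart_vec_tangent: "c \<in> charts_at A p \<Longrightarrow> chart_vec A p c u \<in> tangent_space A p"
  unfolding tangent_iff chart_vec_eq by (simp add: T_comp)

lemma chart_vec_same: "c \<in> charts_at A p \<Longrightarrow> chart_vec A p c u c = u"
  by (simp add: chart_vec_eq T_id)

lemma chart_vec_component: "c \<in> charts_at A p \<Longrightarrow> v \<in> tangent_space A p \<Longrightarrow> chart_vec A p c (v c) = v"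
  unfolding tangent_iff chart_vec_eq by (rule ext) metis

lemma chart_vec_change: "c \<in> charts_at A p \<Longrightarrow> c' \<in> charts_at A p \<Longrightarrow>
    chart_vec A p c' (T c c' (coord c p) u) = chart_vec A p c u"
  unfolding chart_vec_eq by (rule ext) (simp add: T_comp)

lemma tangent_eqI:
  "c \<in> charts_at A p \<Longrightarrow> v \<in> tangent_space A p \<Longrightarrow> w \<in> tangent_space A p \<Longrightarrow> v c = w c \<Longrightarrow> v = w"
  by (metis chart_vec_component)

lemma cplx_chart_vec: assumes c: "c \<in> charts_at A p"
  shows "cplx_struct (chart_vec A p c u) = chart_vec A p c (\<i> *s u)"
proof
  fix c'
  show "cplx_struct (chart_vec A p c u) c' = chart_vec A p c (\<i> *s u) c'"
    using T_ii[OF _ _ coord_overlap[OF c, of c'], of u] c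
    by (auto simp: cplx_struct_def chart_vec_eq charts_at_iff)
qed

lemma cplx_tangent: assumes v: "v \<in> tangent_space A p" shows "cplx_struct v \<in> tangent_space A p"
  using cplx_chart_vec[OF chart_at, of p "v (chart_at A p)"] chart_vec_tangent[OF chart_at]
  by (simp add: chart_vec_component[OF chart_at v])

lemma minus_tangent: assumes v: "v \<in> tangent_space A p" shows "(\<lambda>c. - v c) \<in> tangent_space A p"
  unfolding tangent_iff
proof (intro conjI ballI allI impI)
  fix c c' assume c: "c \<in> charts_at A p" "c' \<in> charts_at A p"
  then have l: "linear (T c c' (coord c p))" using T_linear[OF _ _ coord_overlap[OF c]] by (simp add: charts_at_iff)
  have eq: "v c' = T c c' (coord c p) (v c)" using v c unfolding tangent_iff by blast
  show "- v c' = T c c' (coord c p) (- v c)" unfolding linear_neg[OF l] eq[symmetric] ..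
next
  fix c assume "c \<notin> charts_at A p"
  then have "v c = 0" using v unfolding tangent_iff by blast
  then show "- v c = 0" by simp
qed

text \<open>\<open>differential\<close> is defined through the chart chosen at \<open>p\<close>; the
  chain rule allows it to be computed in any chart.\<close>

lemma differential_eq:
  assumes c: "c \<in> charts_at A p" and v: "v \<in> tangent_space A p"
    and f: "((f \<circ> cinv c) has_derivative D) (at (coord c p))"
  shows "differential A f p v = D (v c)"
proof -
  let ?c = "chart_at A p"
  have "((f \<circ> cinv ?c) has_derivative (\<lambda>u. D (T ?c c (coord ?c p) u))) (at (coord ?c p))"
    by (rule has_derivative_chart_change[OF chart_at c f])
  then have "differential A f p v = D (T ?c c (coord ?c p) (v ?c))"
    unfolding differential_def Let_def by (simp add: frechetI)
  also have "T ?c c (coord ?c p) (v ?c) = v c" using v c chart_at unfolding tangent_iff by metis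
  finally show ?thesis .
qed

lemma cinv_charts_at: "c \<in> A \<Longrightarrow> x \<in> cran c \<Longrightarrow> c \<in> charts_at A (cinv c x)"
  by (simp add: charts_at_iff cinv_in)

lemma loc2_tensor:
  assumes "c \<in> charts_at A p" "u \<in> tangent_space A p" "v \<in> tangent_space A p"
  shows "loc2 A c \<tau> (coord c p) (u c) (v c) = \<tau> p u v"
  using assms by (simp add: loc2_def charts_at_iff cinv_coord chart_vec_component)

lemma loc2_change:
  assumes c: "c \<in> A" "c' \<in> A" and x: "x \<in> overlap c c'"
  shows "loc2 A c \<tau> x u v = loc2 A c' \<tau> (coord c' (cinv c x)) (T c c' x u) (T c c' x v)"
proof -
  define p where "p = cinv c x"
  have p: "c \<in> charts_at A p" "c' \<in> charts_at A p" "coord c p = x" "cinv c' (coord c' p) = p"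
    using c x by (auto simp: p_def charts_at_iff overlap_iff cinv_in coord_cinv cinv_coord)
  show ?thesis unfolding loc2_def p_def[symmetric] p(4)
    using chart_vec_change[OF p(1,2)] p(3) by simp
qed

end

locale kaehler_manifold = atlas A for A :: "('m::t2_space, 'n::finite) chart set" +
  fixes g \<omega> :: "('m, 'n) tensor2"
  assumes kaehler: "kaehler A g \<omega>"
begin

lemma g_tensor: "smooth_tensor2 A g" and \<omega>_closed: "closed_form2 A \<omega>"
  using kaehler by (simp_all add: kaehler_def riemannian_metric_def)

lemma g_bilinear: "c \<in> A \<Longrightarrow> x \<in> cran c \<Longrightarrow> bilinear (loc2 A c g x)"
  and g_smooth: "c \<in> A \<Longrightarrow> smooth_on (cran c) (\<lambda>x. loc2 A c g x u v)"
  using g_tensor unfolding smooth_tensor2_def by blast+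

lemma g_sym: "u \<in> tangent_space A p \<Longrightarrow> v \<in> tangent_space A p \<Longrightarrow> g p u v = g p v u"
  and g_pos: "u \<in> tangent_space A p \<Longrightarrow> u \<noteq> (\<lambda>_. 0) \<Longrightarrow> g p u u > 0"
  and g_cplx: "u \<in> tangent_space A p \<Longrightarrow> v \<in> tangent_space A p \<Longrightarrow> g p (cplx_struct u) (cplx_struct v) = g p u v"
  and g_\<omega>: "u \<in> tangent_space A p \<Longrightarrow> v \<in> tangent_space A p \<Longrightarrow> g p u v = \<omega> p u (cplx_struct v)"
  using kaehler unfolding kaehler_def riemannian_metric_def by blast+

lemma loc2_\<omega>:
  assumes c: "c \<in> A" and x: "x \<in> cran c"
  shows "loc2 A c \<omega> x u v = loc2 A c g x (\<i> *s u) v"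
proof -
  define p where "p = cinv c x"
  have cp: "c \<in> charts_at A p" using cinv_charts_at[OF c x] by (simp add: p_def)
  note t = chart_vec_tangent[OF cp]
  have 1: "loc2 A c g x a b = loc2 A c \<omega> x a (\<i> *s b)" for a b
    using g_\<omega>[OF t t] unfolding loc2_def p_def[symmetric] cplx_chart_vec[OF cp, symmetric] .
  have 2: "loc2 A c g x (\<i> *s a) (\<i> *s b) = loc2 A c g x a b" for a b
    using g_cplx[OF t t] unfolding loc2_def p_def[symmetric] cplx_chart_vec[OF cp, symmetric] .
  have m: "\<i> *s (- (\<i> *s v)) = v" "\<i> *s (\<i> *s v) = - v" for v :: "complex^'n" by (simp_all add: vec_eq_iff)
  have "loc2 A c \<omega> x u v = loc2 A c g x u (- (\<i> *s v))" using 1[of u "- (\<i> *s v)"] m(1)[of v] by simp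
  also have "\<dots> = loc2 A c g x (\<i> *s u) v" using 2[of u "- (\<i> *s v)"] by (simp add: m(1))
  finally show ?thesis .
qed

lemma local_kaehler: assumes c: "c \<in> A" shows "local_kaehler (cran c) (loc2 A c g) (\<lambda>u. \<i> *s u)"
proof (intro local_kaehler.intro local_metric.intro local_kaehler_axioms.intro)
  show "open (cran c)" by (rule open_cran[OF c])
  show "linear (\<lambda>u::complex^'n. \<i> *s u)" by (rule linear_ii)
  show "\<i> *s (\<i> *s u) = - u" for u :: "complex^'n" by (simp add: vec_eq_iff)
  show "smooth_on (cran c) (\<lambda>x. loc2 A c g x u v)" for u v by (rule g_smooth[OF c])
  fix x assume x: "x \<in> cran c"
  define p where "p = cinv c x"
  have cp: "c \<in> charts_at A p" using cinv_charts_at[OF c x] by (simp add: p_def)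
  note t = chart_vec_tangent[OF cp]
  show "bilinear (loc2 A c g x)" by (rule g_bilinear[OF c x])
  show "loc2 A c g x u v = loc2 A c g x v u" for u v
    unfolding loc2_def p_def[symmetric] by (rule g_sym[OF t t])
  show "loc2 A c g x u u > 0" if "u \<noteq> 0" for u
  proof -
    have "chart_vec A p c u \<noteq> (\<lambda>_. 0)" using chart_vec_same[OF cp, of u] that by auto
    then show ?thesis unfolding loc2_def p_def[symmetric] by (rule g_pos[OF t])
  qed
  show "loc2 A c g x (\<i> *s u) (\<i> *s v) = loc2 A c g x u v" for u v
    unfolding loc2_def p_def[symmetric] cplx_chart_vec[OF cp, symmetric] by (rule g_cplx[OF t t])
  have f: "\<D> (\<lambda>y. loc2 A c g y (\<i> *s a) b) x w = \<D> (\<lambda>y. loc2 A c \<omega> y a b) x w" for a b w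
  proof -
    have s: "smooth_on (cran c) (\<lambda>x. loc2 A c g x (\<i> *s a) b)" by (rule g_smooth[OF c])
    have "\<D> (\<lambda>y. loc2 A c g y (\<i> *s a) b) x = \<D> (\<lambda>y. loc2 A c \<omega> y a b) x"
      by (rule frechet_derivative_transform_within_open[OF smooth_on_differentiable[OF s x] open_cran[OF c] x])
        (simp add: loc2_\<omega>[OF c])
    then show ?thesis by simp
  qed
  show "\<D> (\<lambda>y. loc2 A c g y (\<i> *s v) w) x u +
       \<D> (\<lambda>y. loc2 A c g y (\<i> *s w) u) x v +
       \<D> (\<lambda>y. loc2 A c g y (\<i> *s u) v) x w = 0" for u v w
    unfolding f using \<omega>_closed c x unfolding closed_form2_def by blast
qed

end

section \<open>Torus actions\<close>

lemma torus_exp_add: "torus_exp (a + b) = torus_exp a * torus_exp b"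
  by (simp add: torus_exp_def vec_eq_iff cis_mult)

lemma torus_exp_0: "torus_exp 0 = 1"
  by (simp add: torus_exp_def vec_eq_iff)

lemma torus_exp_in_torus: "torus_exp b \<in> torus"
  by (simp add: torus_exp_def torus_def)

lemma continuous_torus_exp: "continuous_on S (\<lambda>x. torus_exp (f x))" if "continuous_on S f"
  unfolding torus_exp_def
  by (intro continuous_on_vec_lambda continuous_intros that)

locale toric_manifold = kaehler_manifold A g \<omega>
  for A :: "('m::t2_space, 'n::finite) chart set" and g \<omega> +
  fixes act :: "complex^'n \<Rightarrow> 'm \<Rightarrow> 'm" and \<mu> :: "'m \<Rightarrow> (real^'n) \<Rightarrow>\<^sub>L real"
  assumes compact_M: "compact (UNIV :: 'm set)" and connected_M: "connected (UNIV :: 'm set)"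
    and action: "smooth_torus_action A act" and effective: "effective_action act"
    and preserves: "preserves_cplx_struct A act" and moment: "moment_map A act \<omega> \<mu>"
begin

text \<open>Lifting the torus action to the Lie algebra gives an action of a vector group, so that
  derivatives at the identity are ordinary derivatives at 0.\<close>

definition flow :: "real^'n \<Rightarrow> 'm \<Rightarrow> 'm" where "flow b p = act (torus_exp b) p"

lemma flow_0: "flow 0 p = p"
  using action by (simp add: flow_def torus_exp_0 smooth_torus_action_def)

lemma flow_add: "flow (a + b) p = flow a (flow b p)"
proof -
  have "\<forall>s\<in>torus. \<forall>t\<in>torus. \<forall>p. act (s * t) p = act s (act t p)"
    using action by (simp add: smooth_torus_action_def)
  then show ?thesis unfolding flow_def torus_exp_add using torus_exp_in_torus by blast
qed

lemma continuous_flow: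
  assumes "continuous_on S f" "continuous_on S h"
  shows "continuous_on S (\<lambda>x. flow (f x) (h x))"
proof -
  have "continuous_on (torus \<times> UNIV) (\<lambda>(t, p). act t p)" using action by (simp add: smooth_torus_action_def)
  moreover have "continuous_on S (\<lambda>x. (torus_exp (f x), h x))"
    by (intro continuous_on_Pair continuous_torus_exp assms)
  moreover have "(\<lambda>x. (torus_exp (f x), h x)) ` S \<subseteq> torus \<times> UNIV" using torus_exp_in_torus by blast
  ultimately have "continuous_on S (\<lambda>x. (\<lambda>(t, p). act t p) (torus_exp (f x), h x))"
    by (rule continuous_on_compose2)
  then show ?thesis by (simp add: flow_def)
qed

definition Fdom :: "('m, 'n) chart \<Rightarrow> ('m, 'n) chart \<Rightarrow> ((real^'n) \<times> (complex^'n)) set" where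
  "Fdom c c' = {(b, x). x \<in> cran c \<and> flow b (cinv c x) \<in> cdom c'}"

definition F :: "('m, 'n) chart \<Rightarrow> ('m, 'n) chart \<Rightarrow> (real^'n) \<times> (complex^'n) \<Rightarrow> complex^'n" where
  "F c c' = (\<lambda>(b, x). coord c' (flow b (cinv c x)))"

lemma F_smooth: "c \<in> A \<Longrightarrow> c' \<in> A \<Longrightarrow> smooth_on (Fdom c c') (F c c')"
  using action unfolding smooth_torus_action_def Fdom_def F_def flow_def by blast

lemma open_Fdom: assumes c: "c \<in> A" "c' \<in> A" shows "open (Fdom c c')"
proof -
  have eq: "Fdom c c' = (UNIV \<times> cran c) \<inter> (\<lambda>z. flow (fst z) (cinv c (snd z))) -` cdom c'"
    by (auto simp: Fdom_def)
  have "continuous_on (UNIV \<times> cran c) (\<lambda>z. flow (fst z) (cinv c (snd z)))"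
    by (intro continuous_flow continuous_intros continuous_on_compose2[OF continuous_cinv[OF c(1)]]) auto
  then show ?thesis unfolding eq
    by (rule continuous_open_preimage[OF _ open_Times[OF open_UNIV open_cran[OF c(1)]] open_cdom[OF c(2)]])
qed

lemma F_deriv: "c \<in> A \<Longrightarrow> c' \<in> A \<Longrightarrow> z \<in> Fdom c c' \<Longrightarrow> (F c c' has_derivative \<D> (F c c') z) (at z)"
  by (rule smooth_on_has_derivative[OF F_smooth])

text \<open>The coordinate expression of the fundamental field, as a partial derivative of the
  jointly smooth action at time 0: linearity in \<open>b\<close> and smoothness in \<open>x\<close>
  are then immediate.\<close>

definition X :: "('m, 'n) chart \<Rightarrow> real^'n \<Rightarrow> complex^'n \<Rightarrow> complex^'n" where
  "X c b x = \<D> (F c c) (0, x) (b, 0)"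

lemma zero_in_Fdom: "c \<in> A \<Longrightarrow> x \<in> cran c \<Longrightarrow> (0, x) \<in> Fdom c c"
  by (simp add: Fdom_def flow_0 cinv_in)

lemma X_smooth: assumes c: "c \<in> A" shows "smooth_on (cran c) (X c b)"
proof -
  have "smooth_on (cran c) (\<lambda>x. \<D> (F c c) (0 + (0, x)) (b, 0))"
  proof (rule smooth_on_affine_comp[OF _ open_cran[OF c] smooth_on_derivative[OF F_smooth[OF c c]]])
    show "bounded_linear (\<lambda>x. (0::real^'n, x::complex^'n))"
      by (intro bounded_linear_Pair bounded_linear_zero bounded_linear_ident)
  qed (simp add: zero_in_Fdom c)
  then show ?thesis by (simp add: X_def[abs_def])
qed

lemma X_linear: assumes "c \<in> A" "x \<in> cran c" shows "linear (\<lambda>b. X c b x)"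
proof -
  have l: "linear (\<D> (F c c) (0, x))"
    using has_derivative_linear[OF F_deriv[OF assms(1,1) zero_in_Fdom[OF assms]]] .
  show ?thesis unfolding X_def
    by (rule linearI) (simp_all flip: linear_add[OF l] linear_scale[OF l])
qed

lemma flow_curve_derivative:
  assumes c: "c \<in> charts_at A p"
  shows "((\<lambda>s. coord c (flow (s *\<^sub>R b) p)) has_vector_derivative X c b (coord c p)) (at 0)"
proof -
  have cA: "c \<in> A" "coord c p \<in> cran c" "cinv c (coord c p) = p" using c by (auto simp: charts_at_iff cinv_coord)
  have l: "linear (\<D> (F c c) (0, coord c p))"
    using has_derivative_linear[OF F_deriv[OF cA(1,1) zero_in_Fdom[OF cA(1,2)]]] .
  have "((\<lambda>s. (s *\<^sub>R b, coord c p)) has_derivative (\<lambda>s. (s *\<^sub>R b, 0))) (at 0)"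
    by (auto intro!: derivative_eq_intros)
  moreover have "(F c c has_derivative \<D> (F c c) (0, coord c p)) (at (0 *\<^sub>R b, coord c p))"
    using F_deriv[OF cA(1,1) zero_in_Fdom[OF cA(1,2)]] by simp
  ultimately have "((\<lambda>s. F c c (s *\<^sub>R b, coord c p)) has_derivative (\<lambda>s. \<D> (F c c) (0, coord c p) (s *\<^sub>R b, 0))) (at 0)"
    by (rule has_derivative_compose)
  moreover have "\<D> (F c c) (0, coord c p) (s *\<^sub>R b, 0) = s *\<^sub>R X c b (coord c p)" for s
    unfolding X_def by (simp flip: linear_scale[OF l])
  ultimately show ?thesis unfolding has_vector_derivative_def F_def by (simp add: cA)
qed

lemma fundamental_field_component:
  assumes c: "c \<in> charts_at A p"
  shows "fundamental_field A act b p c = X c b (coord c p)"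
  unfolding fundamental_field_def
  using vector_derivative_at[OF flow_curve_derivative[OF c, of b]] c by (simp add: flow_def)

lemma fundamental_field_tangent: "fundamental_field A act b p \<in> tangent_space A p"
  unfolding tangent_iff
proof (intro conjI ballI allI impI)
  fix c c' assume c: "c \<in> charts_at A p" "c' \<in> charts_at A p"
  have cA: "c \<in> A" "p \<in> cdom c" "c' \<in> A" "p \<in> cdom c'" using c by (auto simp: charts_at_iff)
  have "((\<lambda>s. coord c (flow (s *\<^sub>R b) p)) has_derivative (\<lambda>s. s *\<^sub>R X c b (coord c p))) (at 0)"
    using flow_curve_derivative[OF c(1)] by (simp add: has_vector_derivative_def)
  moreover have "((coord c' \<circ> cinv c) has_derivative T c c' (coord c p)) (at (coord c (flow (0 *\<^sub>R b) p)))"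
    using T_deriv[OF cA(1,3) coord_overlap[OF c]] by (simp add: flow_0)
  ultimately have 1: "((\<lambda>s. (coord c' \<circ> cinv c) (coord c (flow (s *\<^sub>R b) p))) has_derivative (\<lambda>s. T c c' (coord c p) (s *\<^sub>R X c b (coord c p)))) (at 0)"
    by (rule has_derivative_compose)
  have cont: "continuous_on UNIV (\<lambda>s. flow (s *\<^sub>R b) p)" by (intro continuous_flow continuous_intros)
  have op: "open ((\<lambda>s. flow (s *\<^sub>R b) p) -` cdom c)" using open_vimage[OF open_cdom[OF cA(1)] cont] .
  have "((\<lambda>s. coord c' (flow (s *\<^sub>R b) p)) has_derivative (\<lambda>s. T c c' (coord c p) (s *\<^sub>R X c b (coord c p)))) (at 0)"
    by (rule has_derivative_transform_within_open[OF 1 op]) (simp_all add: flow_0 cA cinv_coord)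
  then have "((\<lambda>s. coord c' (flow (s *\<^sub>R b) p)) has_vector_derivative T c c' (coord c p) (X c b (coord c p))) (at 0)"
    unfolding has_vector_derivative_def
    by (simp add: linear_scale[OF T_linear[OF cA(1,3) coord_overlap[OF c]]])
  from vector_derivative_unique_at[OF this flow_curve_derivative[OF c(2)]]
  show "fundamental_field A act b p c' = T c c' (coord c p) (fundamental_field A act b p c)"
    by (simp add: fundamental_field_component c)
qed (simp add: fundamental_field_def)

lemma X_change:
  assumes c: "c \<in> A" "c' \<in> A" and x: "x \<in> overlap c c'"
  shows "X c' b (coord c' (cinv c x)) = T c c' x (X c b x)"
proof -
  define p where "p = cinv c x"
  have p: "c \<in> charts_at A p" "c' \<in> charts_at A p" "coord c p = x"
    using c x by (auto simp: p_def charts_at_iff overlap_iff cinv_in coord_cinv)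
  show ?thesis
    using fundamental_field_tangent[of b p] p unfolding tangent_iff p_def[symmetric]
    by (metis fundamental_field_component)
qed

text \<open>\<open>pushforward\<close> is computed in the chart chosen at \<open>p\<close>. The
  proof passes from \<open>c\<close> to that chart \<open>c0\<close> by a holomorphic transition map
  and applies the invariance of the complex structure there.\<close>

lemma F_deriv_ii:
  assumes c: "c \<in> A" and z: "(b, x) \<in> Fdom c c"
  shows "\<D> (F c c) (b, x) (0, \<i> *s v) = \<i> *s \<D> (F c c) (b, x) (0, v)"
proof -
  define p where "p = cinv c x"
  have x: "x \<in> cran c" and q: "flow b p \<in> cdom c" using z by (auto simp: Fdom_def p_def)
  have cp: "c \<in> charts_at A p" and xp: "coord c p = x" using cinv_charts_at[OF c x] x by (auto simp: p_def coord_cinv)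
  define c0 where "c0 = chart_at A p"
  have c0: "c0 \<in> charts_at A p" "c0 \<in> A" "p \<in> cdom c0" using chart_at[of p] by (auto simp: c0_def charts_at_iff)
  have p0: "cinv c0 (coord c0 p) = p" by (rule cinv_coord[OF c0(2,3)])
  have slice: "((\<lambda>y. F c' c (b, y)) has_derivative (\<lambda>u. \<D> (F c' c) (b, y) (0, u))) (at y)"
    if "c' \<in> A" "(b, y) \<in> Fdom c' c" for c' y
  proof -
    have "((\<lambda>y. (b, y)) has_derivative (\<lambda>u. (0, u))) (at y)" by (auto intro!: derivative_eq_intros)
    from has_derivative_compose[OF this F_deriv[OF that(1) c that(2)]] show ?thesis .
  qed
  define D where "D u = \<D> (F c0 c) (b, coord c0 p) (0, u)" for u
  have z0: "(b, coord c0 p) \<in> Fdom c0 c" using c0 q by (simp add: Fdom_def p0)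
  have d0: "((coord c \<circ> flow b \<circ> cinv c0) has_derivative D) (at (coord c0 p))"
    using slice[OF c0(2) z0] unfolding D_def F_def by (simp add: o_def)
  then have d0': "(((coord c \<circ> flow b) \<circ> cinv c0) has_derivative D) (at (coord c0 p))" by (simp add: o_assoc)
  from has_derivative_chart_change[OF cp c0(1) d0']
  have d1: "((\<lambda>y. F c c (b, y)) has_derivative (\<lambda>u. D (T c c0 x u))) (at x)"
    by (simp add: o_def F_def xp)
  have eq: "\<D> (F c c) (b, x) (0, u) = D (T c c0 x u)" for u
    using fun_cong[OF has_derivative_unique[OF slice[OF c z] d1], of u] .
  have D_ii: "D (\<i> *s u) = \<i> *s D u" for u
  proof -
    have t: "chart_vec A p c0 u \<in> tangent_space A p" by (rule chart_vec_tangent[OF c0(1)])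
    have "pushforward A (act (torus_exp b)) p (cplx_struct (chart_vec A p c0 u)) c
       = cplx_struct (pushforward A (act (torus_exp b)) p (chart_vec A p c0 u)) c"
      using preserves torus_exp_in_torus[of b] t unfolding preserves_cplx_struct_def by metis
    moreover have "act (torus_exp b) = flow b" by (simp add: flow_def[abs_def])
    moreover have "c \<in> charts_at A (flow b p)" using c q by (simp add: charts_at_iff)
    ultimately show ?thesis
      unfolding pushforward_def Let_def c0_def[symmetric] cplx_chart_vec[OF c0(1)]
      using frechetI[OF d0] chart_vec_same[OF c0(1)] by (simp add: cplx_struct_def)
  qed
  show ?thesis unfolding eq
    using T_ii[OF c c0(2), of x v] coord_overlap[OF cp c0(1)] D_ii xp by simp
qed

lemma X_deriv_eq:
  assumes c: "c \<in> A" and x: "x \<in> cran c"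
  shows "\<D> (X c b) x v = \<D> (\<lambda>z. \<D> (F c c) z (b, 0)) (0, x) (0, v)"
proof -
  have "((\<lambda>y. (0::real^'n, y)) has_derivative (\<lambda>v. (0, v))) (at x)" by (auto intro!: derivative_eq_intros)
  from has_derivative_compose[OF this smooth_on_has_derivative[OF smooth_on_derivative[OF F_smooth[OF c c]] zero_in_Fdom[OF c x]]]
  have "(X c b has_derivative (\<lambda>v. \<D> (\<lambda>z. \<D> (F c c) z (b, 0)) (0, x) (0, v))) (at x)"
    unfolding X_def[abs_def] .
  then show ?thesis by (simp add: frechetI)
qed

text \<open>Differentiates the holomorphy of the flow maps at time 0; symmetry of second derivatives
  exchanges the time and space directions.\<close>

lemma X_deriv_ii:
  assumes c: "c \<in> A" and x: "x \<in> cran c"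
  shows "\<D> (X c b) x (\<i> *s v) = \<i> *s \<D> (X c b) x v"
proof -
  note z = zero_in_Fdom[OF c x] and op = open_Fdom[OF c c]
  note d = smooth_on_has_derivative[OF smooth_on_derivative[OF F_smooth[OF c c]] z]
  note sym = symmetric_second_derivative[OF op z F_smooth[OF c c]]
  have bl: "bounded_linear (\<lambda>u. \<i> *s (u :: complex^'n))" using linear_ii by (simp add: linear_conv_bounded_linear)
  have "((\<lambda>z. \<i> *s \<D> (F c c) z (0, v)) has_derivative
    (\<lambda>h. \<i> *s \<D> (\<lambda>z. \<D> (F c c) z (0, v)) (0, x) h)) (at (0, x))"
    by (rule bounded_linear.has_derivative[OF bl d])
  then have "((\<lambda>z. \<D> (F c c) z (0, \<i> *s v)) has_derivative
    (\<lambda>h. \<i> *s \<D> (\<lambda>z. \<D> (F c c) z (0, v)) (0, x) h)) (at (0, x))"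
    by (rule has_derivative_transform_within_open[OF _ op z]) (auto simp: F_deriv_ii[OF c])
  from fun_cong[OF frechetI[OF this], of "(b, 0)"]
  show ?thesis unfolding X_deriv_eq[OF c x] sym[of "(b, 0)"] .
qed

text \<open>By the group law, the second time derivative of the action in the directions
  \<open>a\<close> and \<open>b\<close> is the derivative of \<open>X c a\<close> along
  \<open>X c b\<close>; its symmetry is the vanishing of the bracket.\<close>

lemma X_commute:
  assumes c: "c \<in> A" and x: "x \<in> cran c"
  shows "\<D> (X c a) x (X c b x) = \<D> (X c b) x (X c a x)"
proof -
  note z = zero_in_Fdom[OF c x] and op = open_Fdom[OF c c]
  \<comment> \<open>The flow equation at an arbitrary time \<open>b'\<close>, obtained by shifting
    time to 0.\<close>
  have F1: "\<D> (F c c) (b', x) (a, 0) = X c a (F c c (b', x))" if b': "(b', x) \<in> Fdom c c" for a b'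
  proof -
    define y where "y = F c c (b', x)"
    have fl: "flow b' (cinv c x) \<in> cdom c" using b' by (simp add: Fdom_def)
    have y: "y \<in> cran c" "cinv c y = flow b' (cinv c x)" using fl c by (auto simp: y_def F_def cinv_coord)
    have "((\<lambda>d. (d, y)) has_derivative (\<lambda>d. (d, 0))) (at 0)" by (auto intro!: derivative_eq_intros)
    from has_derivative_compose[OF this F_deriv[OF c c zero_in_Fdom[OF c y(1)]]]
    have 1: "((\<lambda>d. F c c (d, y)) has_derivative (\<lambda>d. \<D> (F c c) (0, y) (d, 0))) (at 0)" .
    have g2: "((\<lambda>d. (d + b', x)) has_derivative (\<lambda>d. (d, 0))) (at 0)" by (auto intro!: derivative_eq_intros)
    have "(F c c has_derivative \<D> (F c c) (b', x)) (at (0 + b', x))" using F_deriv[OF c c b'] by simp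
    from has_derivative_compose[OF g2 this]
    have 2: "((\<lambda>d. F c c (d + b', x)) has_derivative (\<lambda>d. \<D> (F c c) (b', x) (d, 0))) (at 0)" .
    have "F c c (d + b', x) = F c c (d, y)" for d by (simp add: F_def flow_add y(2))
    then have "((\<lambda>d. F c c (d, y)) has_derivative (\<lambda>d. \<D> (F c c) (b', x) (d, 0))) (at 0)"
      using 2 by simp
    from fun_cong[OF has_derivative_unique[OF this 1], of a] show ?thesis by (simp add: X_def y_def)
  qed
  have key: "\<D> (\<lambda>z. \<D> (F c c) z (a, 0)) (0, x) (b, 0)
    = \<D> (X c a) x (X c b x)" for a b
  proof -
    have g: "((\<lambda>d. (d, x)) has_derivative (\<lambda>d. (d, 0))) (at 0)" by (auto intro!: derivative_eq_intros)
    from has_derivative_compose[OF g smooth_on_has_derivative[OF smooth_on_derivative[OF F_smooth[OF c c]] z]]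
    have 1: "((\<lambda>d. \<D> (F c c) (d, x) (a, 0)) has_derivative
      (\<lambda>d. \<D> (\<lambda>z. \<D> (F c c) z (a, 0)) (0, x) (d, 0))) (at 0)" .
    have F0: "F c c (0, x) = x" using x by (simp add: F_def flow_0 coord_cinv)
    have "(X c a has_derivative \<D> (X c a) x) (at (F c c (0, x)))"
      using smooth_on_has_derivative[OF X_smooth[OF c] x] by (simp add: F0)
    from has_derivative_compose[OF has_derivative_compose[OF g F_deriv[OF c c z]] this]
    have 2: "((\<lambda>d. X c a (F c c (d, x))) has_derivative (\<lambda>d. \<D> (X c a) x (\<D> (F c c) (0, x) (d, 0)))) (at 0)" .
    have op': "open ((\<lambda>d. (d, x)) -` Fdom c c)"
      by (rule open_vimage[OF op]) (intro continuous_intros)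
    have "((\<lambda>d. \<D> (F c c) (d, x) (a, 0)) has_derivative (\<lambda>d. \<D> (X c a) x (\<D> (F c c) (0, x) (d, 0)))) (at 0)"
      by (rule has_derivative_transform_within_open[OF 2 op']) (use z F1 in auto)
    from fun_cong[OF has_derivative_unique[OF 1 this], of b] show ?thesis by (simp add: X_def)
  qed
  show ?thesis
    using symmetric_second_derivative[OF op z F_smooth[OF c c], of "(a, 0)" "(b, 0)"] unfolding key .
qed

end

section \<open>Solitons and the weighted Laplacian\<close>

context toric_manifold
begin

abbreviation pot :: "real^'n \<Rightarrow> real \<Rightarrow> 'm \<Rightarrow> real" where
  "pot b k \<equiv> (\<lambda>q. blinfun_apply (\<mu> q) b + k)"

abbreviation wlap :: "real^'n \<Rightarrow> real^'n \<Rightarrow> real \<Rightarrow> 'm \<Rightarrow> real" where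
  "wlap a b k \<equiv> weighted_laplacian A g \<mu> a (pot b k)"

abbreviation nab where "nab c \<equiv> local_metric.nabla (loc2 A c g)"

definition Y :: "('m, 'n) chart \<Rightarrow> real^'n \<Rightarrow> complex^'n \<Rightarrow> complex^'n" where
  "Y c b x = - (\<i> *s X c b x)"

definition H :: "('m, 'n) chart \<Rightarrow> real^'n \<Rightarrow> complex^'n \<Rightarrow> real" where
  "H c b x = blinfun_apply (\<mu> (cinv c x)) b"

lemma Y_eq: "c \<in> A \<Longrightarrow> local_kaehler.Y (\<lambda>u. \<i> *s u) (X c b) = Y c b"
  by (rule ext) (simp add: Y_def local_kaehler.Y_def[OF local_kaehler])

lemma Y_scale: assumes "c \<in> A" "x \<in> cran c" shows "Y c (r *\<^sub>R b) x = r *\<^sub>R Y c b x"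
  using linear_scale[OF X_linear[OF assms], of r b] linear_scale[OF linear_ii, of r "X c b x"] by (simp add: Y_def)

lemma H_smooth: assumes c: "c \<in> A" shows "smooth_on (cran c) (H c b)"
proof -
  have "smooth_on (cran c) (\<mu> \<circ> cinv c)" using moment c unfolding moment_map_def smooth_fun_def by blast
  from smooth_on_bounded_linear_comp[OF blinfun.bounded_linear_left open_cran[OF c] this]
  show ?thesis by (simp add: H_def[abs_def])
qed

lemma H_derivative:
  assumes c: "c \<in> A" and x: "x \<in> cran c"
  shows "\<D> (H c b) x v = loc2 A c g x (Y c b x) v"
proof -
  interpret K: local_kaehler "cran c" "loc2 A c g" "\<lambda>u. \<i> *s u" by (rule local_kaehler[OF c])
  define p where "p = cinv c x"
  have cp: "c \<in> charts_at A p" "coord c p = x" using cinv_charts_at[OF c x] x by (simp_all add: p_def coord_cinv)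
  define w where "w = chart_vec A p c v"
  have w: "w \<in> tangent_space A p" "w c = v" using chart_vec_tangent chart_vec_same cp by (auto simp: w_def)
  have d: "(((\<lambda>q. blinfun_apply (\<mu> q) b) \<circ> cinv c) has_derivative \<D> (H c b) x) (at (coord c p))"
    using smooth_on_has_derivative[OF H_smooth[OF c] x] by (simp add: H_def[abs_def] o_def cp)
  have "- differential A (\<lambda>q. blinfun_apply (\<mu> q) b) p w = \<omega> p (fundamental_field A act b p) w"
    using moment w(1) unfolding moment_map_def by blast
  then have "- \<D> (H c b) x v = loc2 A c \<omega> x (X c b x) v"
    using differential_eq[OF cp(1) w(1) d] loc2_tensor[OF cp(1) fundamental_field_tangent[of b] w(1), of \<omega>]
    by (simp add: w cp fundamental_field_component[OF cp(1)])
  then show ?thesis by (simp add: loc2_\<omega>[OF c x] Y_def K.G_simps x)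
qed

lemma X_killing: assumes c: "c \<in> A"
  shows "local_kaehler.holomorphic_killing (cran c) (loc2 A c g) (\<lambda>u. \<i> *s u) (X c b)"
proof -
  interpret K: local_kaehler "cran c" "loc2 A c g" "\<lambda>u. \<i> *s u" by (rule local_kaehler[OF c])
  show ?thesis
    by (rule K.holomorphic_killing_potential[OF X_smooth[OF c] X_deriv_ii[OF c] H_smooth[OF c]])
      (simp_all add: Y_eq[OF c] H_derivative[OF c])
qed

section \<open>Gradient, divergence and weighted Laplacian of the potentials\<close>

lemma potential_derivative:
  assumes c: "c \<in> charts_at A p"
  shows "(((pot b k) \<circ> cinv c) has_derivative (\<lambda>v. loc2 A c g (coord c p) (Y c b (coord c p)) v)) (at (coord c p))"
proof -
  have x: "c \<in> A" "coord c p \<in> cran c" using c by (auto simp: charts_at_iff)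
  have "((\<lambda>y. H c b y + k) has_derivative \<D> (H c b) (coord c p)) (at (coord c p))"
    using has_derivative_add[OF smooth_on_has_derivative[OF H_smooth[OF x(1)] x(2)] has_derivative_const[of k]] by simp
  moreover have "\<D> (H c b) (coord c p) = (\<lambda>v. loc2 A c g (coord c p) (Y c b (coord c p)) v)"
    by (rule ext) (rule H_derivative[OF x])
  ultimately show ?thesis by (simp add: H_def o_def)
qed

lemma grad_potential:
  "grad A g (pot b k) p = (\<lambda>c. - cplx_struct (fundamental_field A act b p) c)"
  unfolding grad_def
proof (rule the_equality)
  define V where "V = (\<lambda>c. - cplx_struct (fundamental_field A act b p) c)"
  define c where "c = chart_at A p"
  have c: "c \<in> charts_at A p" "c \<in> A" "coord c p \<in> cran c" using chart_at[of p] by (auto simp: c_def charts_at_iff)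
  interpret K: local_kaehler "cran c" "loc2 A c g" "\<lambda>u. \<i> *s u" by (rule local_kaehler[OF c(2)])
  have V: "V \<in> tangent_space A p" unfolding V_def by (intro minus_tangent cplx_tangent fundamental_field_tangent)
  have Vc: "V c = Y c b (coord c p)" by (simp add: V_def cplx_struct_def Y_def fundamental_field_component[OF c(1)])
  have gV: "g p V w = differential A (pot b k) p w" if w: "w \<in> tangent_space A p" for w
    using loc2_tensor[OF c(1) V w, of g] differential_eq[OF c(1) w potential_derivative[OF c(1)]] by (simp add: Vc)
  show "(\<lambda>c. - cplx_struct (fundamental_field A act b p) c) \<in> tangent_space A p \<and>
    (\<forall>w\<in>tangent_space A p. g p (\<lambda>c. - cplx_struct (fundamental_field A act b p) c) w = differential A (pot b k) p w)"
    using V gV unfolding V_def by blast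
  fix v assume v: "v \<in> tangent_space A p \<and> (\<forall>w\<in>tangent_space A p. g p v w = differential A (pot b k) p w)"
  have "v c = V c"
  proof (rule K.G_eqI[OF c(3)])
    fix u
    have t: "chart_vec A p c u \<in> tangent_space A p" by (rule chart_vec_tangent[OF c(1)])
    have "g p v (chart_vec A p c u) = g p V (chart_vec A p c u)" using v t gV[OF t] by simp
    then show "loc2 A c g (coord c p) (v c) u = loc2 A c g (coord c p) (V c) u"
      using loc2_tensor[OF c(1) _ t, of v g] loc2_tensor[OF c(1) V t, of g] v chart_vec_same[OF c(1), of u] by simp
  qed
  then show "v = (\<lambda>c. - cplx_struct (fundamental_field A act b p) c)"
    using tangent_eqI[OF c(1) _ V] v unfolding V_def by blast
qed

lemma local_metric_subset: "local_metric U G \<Longrightarrow> open V \<Longrightarrow> V \<subseteq> U \<Longrightarrow> local_metric V G"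
  unfolding local_metric_def by (meson smooth_on_subset subsetD)

lemma Y_derivative:
  assumes c: "c \<in> A" and x: "x \<in> cran c"
  shows "(Y c b has_derivative \<D> (Y c b) x) (at x)"
proof -
  interpret K: local_kaehler "cran c" "loc2 A c g" "\<lambda>u. \<i> *s u" by (rule local_kaehler[OF c])
  have "Y c b differentiable (at x)"
    using K.Y_deriv[OF X_killing[OF c] x, of b] unfolding Y_eq[OF c] differentiable_def by blast
  then show ?thesis by (simp add: frechet_derivative_works)
qed

text \<open>\<open>divergence\<close> uses a chart chosen separately at each point, while
  differentiating it requires one chart on a whole neighbourhood.\<close>

lemma divergence_chart_independent:
  assumes c: "c \<in> charts_at A p" "c' \<in> charts_at A p"
  shows "tr (nab c (Y c b) (coord c p)) = tr (nab c' (Y c' b) (coord c' p))"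
proof -
  have cA: "c \<in> A" "c' \<in> A" "p \<in> cdom c" "p \<in> cdom c'" using c by (auto simp: charts_at_iff)
  interpret K: local_kaehler "cran c" "loc2 A c g" "\<lambda>u. \<i> *s u" by (rule local_kaehler[OF cA(1)])
  interpret K': local_kaehler "cran c'" "loc2 A c' g" "\<lambda>u. \<i> *s u" by (rule local_kaehler[OF cA(2)])
  have x: "coord c p \<in> overlap c c'" "coord c' p \<in> overlap c' c" using coord_overlap c by auto
  have sub: "overlap c c' \<subseteq> cran c" by (auto simp: overlap_def)
  have m: "local_metric (overlap c c') (loc2 A c g)"
    by (rule local_metric_subset[OF K.local_metric_axioms open_overlap[OF cA(1,2)] sub])
  have "tr (nab c (Y c b) (coord c p)) = tr (nab c' (Y c' b) ((coord c' \<circ> cinv c) (coord c p)))"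
  proof (rule chart_change_divergence[OF m K'.local_metric_axioms transition_smooth[OF cA(1,2)] _ _ T_linear[OF cA(2,1) x(2)] _ _ x(1)])
    show "(coord c' \<circ> cinv c) y \<in> cran c'" if "y \<in> overlap c c'" for y
      using that by (auto simp: overlap_iff[OF cA(1)])
    show "loc2 A c g y u v = loc2 A c' g ((coord c' \<circ> cinv c) y) (\<D> (coord c' \<circ> cinv c) y u)
      (\<D> (coord c' \<circ> cinv c) y v)" if "y \<in> overlap c c'" for y u v
      using loc2_change[OF cA(1,2) that, of g u v] by (simp add: T_def)
    show "\<D> (coord c' \<circ> cinv c) (coord c p) (T c' c (coord c' p) u) = u" for u
      using T_comp[OF c(2,1,2), of u] T_id[OF c(2)] by (simp add: T_def)
    show "T c' c (coord c' p) (\<D> (coord c' \<circ> cinv c) (coord c p) u) = u" for u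
      using T_comp[OF c(1,2,1), of u] T_id[OF c(1)] by (simp add: T_def)
    show "Y c b differentiable at (coord c p)"
      using Y_derivative[OF cA(1)] x(1) sub unfolding differentiable_def by blast
    show "Y c' b differentiable at ((coord c' \<circ> cinv c) (coord c p))"
      using Y_derivative[OF cA(2), of "coord c' p"] cA unfolding differentiable_def by (auto simp: cinv_coord)
    show "Y c' b ((coord c' \<circ> cinv c) y) = \<D> (coord c' \<circ> cinv c) y (Y c b y)" if "y \<in> overlap c c'" for y
      using X_change[OF cA(1,2) that, of b] linear_neg[OF T_linear[OF cA(1,2) that]] T_ii[OF cA(1,2) that]
      by (simp add: Y_def T_def)
  qed
  then show ?thesis using cA by (simp add: cinv_coord)
qed

lemma laplacian_potential:
  assumes c: "c \<in> charts_at A p"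
  shows "laplacian A g (pot b k) p = - tr (nab c (Y c b) (coord c p))"
proof -
  define c0 where "c0 = chart_at A p"
  have c0: "c0 \<in> charts_at A p" "c0 \<in> A" "coord c0 p \<in> cran c0" using chart_at[of p] by (auto simp: c0_def charts_at_iff)
  interpret K: local_kaehler "cran c0" "loc2 A c0 g" "\<lambda>u. \<i> *s u" by (rule local_kaehler[OF c0(2)])
  define V where "V = grad A g (pot b k)"
  have lV: "loc_vec c0 V y = Y c0 b y" if "y \<in> cran c0" for y
    using fundamental_field_component[OF cinv_charts_at[OF c0(2) that], of b]
    by (simp add: loc_vec_def V_def grad_potential cplx_struct_def Y_def coord_cinv that)
  have Vp: "V p c0 = Y c0 b (coord c0 p)"
    by (simp add: V_def grad_potential cplx_struct_def Y_def fundamental_field_component[OF c0(1)])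
  have "(loc_vec c0 V has_derivative \<D> (Y c0 b) (coord c0 p)) (at (coord c0 p))"
    by (rule has_derivative_transform_within_open[OF Y_derivative[OF c0(2,3)] open_cran[OF c0(2)] c0(3)]) (simp add: lV)
  from frechetI[OF this]
  have "divergence A g V p = tr (nab c0 (Y c0 b) (coord c0 p))"
    unfolding divergence_def Let_def c0_def[symmetric] tr_def K.nabla_def Vp by simp
  then show ?thesis unfolding laplacian_def V_def[symmetric]
    using divergence_chart_independent[OF c0(1) c] by simp
qed

lemma weighted_laplacian_potential:
  assumes c: "c \<in> charts_at A p"
  shows "wlap a b k p =
    - tr (nab c (Y c b) (coord c p)) + 2 * loc2 A c g (coord c p) (Y c a (coord c p)) (Y c b (coord c p))"
proof -
  have x: "c \<in> A" "coord c p \<in> cran c" using c by (auto simp: charts_at_iff)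
  interpret K: local_kaehler "cran c" "loc2 A c g" "\<lambda>u. \<i> *s u" by (rule local_kaehler[OF x(1)])
  define V where "V = grad A g (\<lambda>q. blinfun_apply (\<mu> q) (2 *\<^sub>R a)) p"
  have V: "V = (\<lambda>c. - cplx_struct (fundamental_field A act (2 *\<^sub>R a) p) c)"
    using grad_potential[of "2 *\<^sub>R a" 0 p] by (simp add: V_def)
  have Vt: "V \<in> tangent_space A p" unfolding V by (intro minus_tangent cplx_tangent fundamental_field_tangent)
  have "V c = Y c (2 *\<^sub>R a) (coord c p)" by (simp add: V cplx_struct_def Y_def fundamental_field_component[OF c])
  then have Vc: "V c = 2 *\<^sub>R Y c a (coord c p)" using Y_scale[OF x] by simp
  show ?thesis unfolding weighted_laplacian_def laplacian_potential[OF c] V_def[symmetric]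
      differential_eq[OF c Vt potential_derivative[OF c]] Vc
    using K.G_sym[OF x(2), of "Y c b (coord c p)"] by (simp add: K.G_simps x)
qed

text \<open>The coordinate form of the tensor \<open>S\<close> of the overview: the inner product of
  \<open>nab c (Y c a) x u\<close> with \<open>v\<close> is the Hessian of the potential of
  \<open>a\<close>.\<close>

definition S :: "real^'n \<Rightarrow> real \<Rightarrow> ('m, 'n) chart \<Rightarrow> complex^'n \<Rightarrow> complex^'n \<Rightarrow> complex^'n \<Rightarrow> real" where
  "S a lam c x u v = ricci_loc (loc2 A c g) x u v + 2 * loc2 A c g x (nab c (Y c a) x u) v - lam * loc2 A c g x u v"

text \<open>The divergence, the inner product of the gradients and the potential contribute the
  three terms of \<open>S\<close>, all with the common factor 2.\<close>

lemma weighted_laplacian_derivative: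
  assumes c: "c \<in> A" and x: "x \<in> cran c"
  shows "(((\<lambda>p. wlap a b k p - 2 * lam * blinfun_apply (\<mu> p) b) \<circ> cinv c)
    has_derivative (\<lambda>w. 2 * S a lam c x w (Y c b x))) (at x)"
proof -
  interpret K: local_kaehler "cran c" "loc2 A c g" "\<lambda>u. \<i> *s u" by (rule local_kaehler[OF c])
  have 1: "((\<lambda>y. - tr (nab c (Y c b) y) + 2 * loc2 A c g y (Y c a y) (Y c b y) - 2 * lam * H c b y) has_derivative
    (\<lambda>w. - (- 2 * K.Ric x w (Y c b x)) + 2 * (2 * loc2 A c g x (nab c (Y c a) x w) (Y c b x)) - 2 * lam * \<D> (H c b) x w)) (at x)"
    using K.div_Y_derivative[OF X_killing[OF c, of b] x]
      K.inner_gradients_derivative[OF X_killing[OF c, of a] X_killing[OF c, of b] x X_commute[OF c x]]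
    unfolding Y_eq[OF c]
    by (intro has_derivative_diff has_derivative_add has_derivative_minus has_derivative_mult_right
      smooth_on_has_derivative[OF H_smooth[OF c] x])
  have 2: "(\<lambda>w. - (- 2 * K.Ric x w (Y c b x)) + 2 * (2 * loc2 A c g x (nab c (Y c a) x w) (Y c b x)) - 2 * lam * \<D> (H c b) x w)
    = (\<lambda>w. 2 * S a lam c x w (Y c b x))"
    by (rule ext) (simp add: S_def H_derivative[OF c x] K.G_sym[OF x, of "Y c b x"] algebra_simps)
  show ?thesis
    by (rule has_derivative_transform_within_open[OF 1[unfolded 2] open_cran[OF c] x])
      (simp add: weighted_laplacian_potential[OF cinv_charts_at[OF c]] coord_cinv H_def)
qed

lemma lie_deriv_\<omega>:
  assumes c_def: "c = chart_at A p" and x_def: "x = coord c p"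
    and V: "\<And>y. y \<in> cran c \<Longrightarrow> loc_vec c V y = Z y"
    and Z: "(Z has_derivative Z') (at x)"
    and u: "u \<in> tangent_space A p" "v \<in> tangent_space A p"
  shows "lie_deriv A V \<omega> p u v = local_metric.dG (loc2 A c g) x (Z x) (\<i> *s u c) (v c)
      + loc2 A c g x (\<i> *s Z' (u c)) (v c) + loc2 A c g x (\<i> *s u c) (Z' (v c))"
proof -
  have c: "c \<in> charts_at A p" "c \<in> A" "x \<in> cran c" "cinv c x = p"
    using chart_at[of p] by (auto simp: c_def x_def charts_at_iff cinv_coord)
  interpret K: local_kaehler "cran c" "loc2 A c g" "\<lambda>u. \<i> *s u" by (rule local_kaehler[OF c(2)])
  have "(loc_vec c V has_derivative Z') (at x)"
    by (rule has_derivative_transform_within_open[OF Z open_cran[OF c(2)] c(3)]) (simp add: V)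
  note D = frechetI[OF this]
  have "((\<lambda>y. loc2 A c \<omega> y (u c) (v c)) has_derivative (\<lambda>w. K.dG x w (\<i> *s u c) (v c))) (at x)"
    by (rule has_derivative_transform_within_open[OF K.dG[OF c(3)] open_cran[OF c(2)] c(3)]) (simp add: loc2_\<omega>[OF c(2)])
  note D\<omega> = frechetI[OF this]
  have "V p c = Z x" using V[OF c(3)] c(4) by (simp add: loc_vec_def)
  then show ?thesis
    unfolding lie_deriv_def Let_def c_def[symmetric] x_def[symmetric] D D\<omega> by (simp add: loc2_\<omega>[OF c(2,3)])
qed

text \<open>The imaginary part of the equation is the Lie derivative of \<open>\<omega>\<close>
  along a holomorphic Killing field and vanishes. The real part reads \<open>S\<close> at
  \<open>\<i> *s u\<close> and \<open>v\<close>, because the Ricci form, \<open>\<omega>\<close> and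
  the Lie derivative along \<open>J X\<close> all carry \<open>J\<close> in the first slot.\<close>

lemma soliton_iff:
  "kaehler_ricci_soliton A act g \<omega> a lam \<longleftrightarrow>
    (\<forall>p u v. S a lam (chart_at A p) (coord (chart_at A p) p) u v = 0)"
proof -
  have main: "complex_of_real (ricci_form A g p u v - lam * \<omega> p u v) =
        lie_deriv_complex A (\<lambda>q. cplx_struct (fundamental_field A act a q)) (fundamental_field A act a) \<omega> p u v
      \<longleftrightarrow> S a lam (chart_at A p) (coord (chart_at A p) p) (\<i> *s u (chart_at A p)) (v (chart_at A p)) = 0"
    if u: "u \<in> tangent_space A p" "v \<in> tangent_space A p" for p u v
  proof -
    define c where "c = chart_at A p"
    define x where "x = coord c p"
    have c: "c \<in> charts_at A p" "c \<in> A" "x \<in> cran c" using chart_at[of p] by (auto simp: c_def x_def charts_at_iff)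
    interpret K: local_kaehler "cran c" "loc2 A c g" "\<lambda>u. \<i> *s u" by (rule local_kaehler[OF c(2)])
    have \<omega>: "\<omega> p u v = loc2 A c g x (\<i> *s u c) (v c)"
      using loc2_tensor[OF c(1) u, of \<omega>] loc2_\<omega>[OF c(2,3)] by (simp add: x_def)
    have X1: "loc_vec c (fundamental_field A act a) y = X c a y" if "y \<in> cran c" for y
      using fundamental_field_component[OF cinv_charts_at[OF c(2), of y], of a] that
      by (simp add: loc_vec_def coord_cinv)
    have Y1: "loc_vec c (\<lambda>q. cplx_struct (fundamental_field A act a q)) y = - Y c a y" if "y \<in> cran c" for y
      using X1[OF that] by (simp add: loc_vec_def cplx_struct_def Y_def)
    have "lie_deriv A (fundamental_field A act a) \<omega> p u v = 0"
      using lie_deriv_\<omega>[OF c_def x_def X1 K.X_deriv[OF X_killing[OF c(2)] c(3)] u]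
        K.lie_derivative_X[OF X_killing[OF c(2), of a] c(3)] by simp
    moreover have "lie_deriv A (\<lambda>q. cplx_struct (fundamental_field A act a q)) \<omega> p u v = - 2 * loc2 A c g x (nab c (Y c a) x (\<i> *s u c)) (v c)"
    proof -
      have d: "((\<lambda>y. - Y c a y) has_derivative \<D> (\<lambda>y. - Y c a y) x) (at x)"
        using has_derivative_minus[OF Y_derivative[OF c(2,3), of a]] frechetI[OF has_derivative_minus[OF Y_derivative[OF c(2,3), of a]]] by simp
      show ?thesis
        using lie_deriv_\<omega>[OF c_def x_def Y1 d u]
          K.lie_derivative_J_X[OF X_killing[OF c(2), of a] c(3), unfolded Y_eq[OF c(2)]] by simp
    qed
    moreover have "ricci_form A g p u v = K.Ric x (\<i> *s u c) (v c)"
      by (simp add: ricci_form_def ricci_def Let_def c_def x_def cplx_struct_def)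
    ultimately show ?thesis
      unfolding lie_deriv_complex_def c_def[symmetric] x_def[symmetric] S_def \<omega>
      by (simp flip: of_real_diff of_real_mult of_real_minus) (simp add: complex_eq_iff algebra_simps)
  qed
  show ?thesis
  proof
    assume sol: "kaehler_ricci_soliton A act g \<omega> a lam"
    show "\<forall>p u v. S a lam (chart_at A p) (coord (chart_at A p) p) u v = 0"
    proof (intro allI)
      fix p and u v :: "complex^'n"
      define c where "c = chart_at A p"
      have c: "c \<in> charts_at A p" using chart_at by (simp add: c_def)
      have t: "chart_vec A p c (- (\<i> *s u)) \<in> tangent_space A p" "chart_vec A p c v \<in> tangent_space A p"
        using chart_vec_tangent[OF c] by auto
      \<comment> \<open>The equation carries \<open>\<i> *s\<close> in its first slot, so it is
        applied to \<open>- (\<i> *s u)\<close>.\<close>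
      have m: "\<i> *s (- (\<i> *s u)) = u" by (simp add: vec_eq_iff)
      show "S a lam (chart_at A p) (coord (chart_at A p) p) u v = 0"
        using sol main[OF t] t unfolding kaehler_ricci_soliton_def c_def[symmetric] chart_vec_same[OF c] m by blast
    qed
  qed (use main in \<open>simp add: kaehler_ricci_soliton_def\<close>)
qed

end

lemma (in local_kaehler) Ric_linear: assumes x: "x \<in> U" shows "linear (Ric x v)"
proof -
  note d = bilinear_radd[OF d\<Gamma>_bilinear[OF x]] bilinear_rmul[OF d\<Gamma>_bilinear[OF x]]
  show ?thesis
    by (rule linearI) (simp_all add: Ric_eq[OF x] d\<theta>_def d \<Gamma>_simps x tr_add tr_scale algebra_simps)
qed

context toric_manifold
begin

section \<open>From local identities to the whole manifold\<close>

lemma chart_ball: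
  assumes "c \<in> A" "x \<in> cran c" obtains r where "r > 0" "ball x r \<subseteq> cran c"
  using open_cran[OF assms(1)] assms(2) open_contains_ball_eq by blast

text \<open>The hypothesis speaks of the chart chosen at each point, as \<open>soliton_iff\<close>
  does; the change of chart transfers it to one fixed chart, where balls are convex.\<close>

lemma constant_if_derivative_zero:
  fixes f :: "'m \<Rightarrow> real"
  assumes f: "\<And>p. ((f \<circ> cinv (chart_at A p)) has_derivative (\<lambda>_. 0)) (at (coord (chart_at A p) p))"
  obtains k where "\<And>p. f p = k"
proof -
  have d: "((f \<circ> cinv c) has_derivative (\<lambda>_. 0)) (at x)" if "c \<in> A" "x \<in> cran c" for c x
    using has_derivative_chart_change[OF cinv_charts_at[OF that] chart_at f] that by (simp add: coord_cinv)
  have "f constant_on UNIV"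
  proof (rule locally_constant_imp_constant[OF connected_M])
    fix p :: 'm
    define c where "c = chart_at A p"
    have c: "c \<in> A" "p \<in> cdom c" using chart_at[of p] by (auto simp: c_def charts_at_iff)
    obtain r where r: "r > 0" "ball (coord c p) r \<subseteq> cran c"
      using chart_ball[OF c(1)] c(2) by blast
    define N where "N = cdom c \<inter> coord c -` ball (coord c p) r"
    have "open N" unfolding N_def
      by (rule continuous_open_preimage[OF continuous_coord[OF c(1)] open_cdom[OF c(1)] open_ball])
    then have oN: "openin (top_of_set UNIV) N" by (rule open_subset[OF subset_UNIV])
    have pN: "p \<in> N" using c r by (simp add: N_def)
    have fN: "f q = f p" if q: "q \<in> N" for q
    proof -
      have "((f \<circ> cinv c) has_derivative (\<lambda>_. 0)) (at y within ball (coord c p) r)" if "y \<in> ball (coord c p) r" for y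
        by (rule has_derivative_at_withinI[OF d[OF c(1)]]) (use that r in blast)
      from has_derivative_zero_constant[OF convex_ball this]
      have "(f \<circ> cinv c) (coord c q) = (f \<circ> cinv c) (coord c p)" using q r by (auto simp: N_def)
      then show ?thesis using q c by (simp add: N_def cinv_coord)
    qed
    show "\<exists>N. openin (top_of_set UNIV) N \<and> p \<in> N \<and> (\<forall>q\<in>N. f q = f p)"
      by (intro exI[of _ N] conjI oN pN ballI fN)
  qed
  then show ?thesis using that by (auto simp: constant_on_def)
qed

text \<open>Since \<open>\<mu>\<close> is constant along orbits, the differential of a potential
  kills \<open>X c a\<close>; that differential is the inner product with
  \<open>- (\<i> *s X c b x)\<close>.\<close>

lemma isotropic_orbits:
  assumes c: "c \<in> A" and x: "x \<in> cran c"
  shows "loc2 A c g x (\<i> *s X c b x) (X c a x) = 0"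
proof -
  interpret K: local_kaehler "cran c" "loc2 A c g" "\<lambda>u. \<i> *s u" by (rule local_kaehler[OF c])
  define p where "p = cinv c x"
  have p: "c \<in> charts_at A p" "coord c p = x" "p \<in> cdom c" using cinv_charts_at[OF c x] x by (simp_all add: p_def coord_cinv cinv_in)
  have "((\<lambda>s. coord c (flow (s *\<^sub>R a) p)) has_derivative (\<lambda>s. s *\<^sub>R X c a x)) (at 0)"
    using flow_curve_derivative[OF p(1), of a] by (simp add: p has_vector_derivative_def)
  moreover have "(H c b has_derivative \<D> (H c b) x) (at (coord c (flow (0 *\<^sub>R a) p)))"
    using smooth_on_has_derivative[OF H_smooth[OF c] x] by (simp add: flow_0 p)
  ultimately have 1: "((\<lambda>s. H c b (coord c (flow (s *\<^sub>R a) p))) has_derivative (\<lambda>s. \<D> (H c b) x (s *\<^sub>R X c a x))) (at 0)"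
    by (rule has_derivative_compose)
  have cont: "continuous_on UNIV (\<lambda>s. flow (s *\<^sub>R a) p)" by (intro continuous_flow continuous_intros)
  have op: "open ((\<lambda>s. flow (s *\<^sub>R a) p) -` cdom c)" using open_vimage[OF open_cdom[OF c] cont] .
  have inv: "\<mu> (flow s p) = \<mu> p" for s
    using moment torus_exp_in_torus unfolding moment_map_def flow_def by blast
  have "((\<lambda>s. blinfun_apply (\<mu> p) b) has_derivative (\<lambda>s. \<D> (H c b) x (s *\<^sub>R X c a x))) (at 0)"
    by (rule has_derivative_transform_within_open[OF 1 op]) (simp_all add: flow_0 p H_def cinv_coord c inv)
  from fun_cong[OF has_derivative_unique[OF this has_derivative_const], of 1]
  show ?thesis by (simp add: H_derivative[OF c x] Y_def K.G_simps x)
qed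

text \<open>The zero set of a fundamental field with a trivial 1-jet at one point is open and closed.\<close>

lemma no_trivial_jet:
  assumes c0: "c0 \<in> A" and x0: "x0 \<in> cran c0" and b: "b \<noteq> 0"
    and jet: "X c0 b x0 = 0" "\<And>v. \<D> (X c0 b) x0 v = 0"
  shows False
proof -
  define V where "V = fundamental_field A act b"
  have zero_iff: "V q = (\<lambda>_. 0) \<longleftrightarrow> X c b (coord c q) = 0" if c: "c \<in> charts_at A q" for c q
  proof
    assume "X c b (coord c q) = 0"
    then have "V q c = 0" by (simp add: V_def fundamental_field_component[OF c])
    moreover have "(\<lambda>_. 0) \<in> tangent_space A q"
      unfolding tangent_iff using linear_0[OF T_linear[OF _ _ coord_overlap]] by (auto simp: charts_at_iff)
    ultimately show "V q = (\<lambda>_. 0)"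
      using tangent_eqI[OF c, of "V q" "\<lambda>_. 0"] fundamental_field_tangent by (simp add: V_def)
  qed (use fundamental_field_component[OF c, of b] in \<open>simp add: V_def\<close>)
  \<comment> \<open>The interior is taken because on it the field vanishes near each point, so that
    its 1-jet vanishes as well.\<close>
  define Z where "Z = interior {q. V q = (\<lambda>_. 0)}"
  have ball_Z: "cinv c ` ball x r \<subseteq> Z \<and> open (cinv c ` ball x r)"
    if c: "c \<in> A" and r: "ball x r \<subseteq> cran c" and y: "y \<in> ball x r" "X c b y = 0"
      "\<And>v. \<D> (X c b) y v = 0" for c x r y
  proof -
    interpret K: local_kaehler "cran c" "loc2 A c g" "\<lambda>u. \<i> *s u" by (rule local_kaehler[OF c])
    have "cinv c ` ball x r = cdom c \<inter> coord c -` ball x r"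
    proof (intro set_eqI iffI)
      fix q assume "q \<in> cinv c ` ball x r"
      then obtain z where z: "z \<in> ball x r" "q = cinv c z" by blast
      then have zc: "z \<in> cran c" using r by blast
      show "q \<in> cdom c \<inter> coord c -` ball x r" using z cinv_in[OF zc] coord_cinv[OF zc] by simp
    next
      fix q assume "q \<in> cdom c \<inter> coord c -` ball x r"
      then show "q \<in> cinv c ` ball x r"
        using imageI[of "coord c q" "ball x r" "cinv c"] cinv_coord[OF c, of q] by simp
    qed
    then have op: "open (cinv c ` ball x r)"
      using continuous_open_preimage[OF continuous_coord[OF c] open_cdom[OF c] open_ball] by simp
    have "V (cinv c z) = (\<lambda>_. 0)" if z: "z \<in> ball x r" for z
    proof -
      have zc: "z \<in> cran c" using z r by blast
      have "closed_segment y z \<subseteq> cran c"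
        using closed_segment_subset[OF y(1) z convex_ball] r by blast
      then have "X c b z = 0" by (rule K.killing_rigidity[OF X_killing[OF c] _ y(2,3)])
      then show ?thesis using zero_iff[OF cinv_charts_at[OF c zc]] by (simp add: coord_cinv[OF zc])
    qed
    then have "cinv c ` ball x r \<subseteq> {q. V q = (\<lambda>_. 0)}" by blast
    then show ?thesis using op unfolding Z_def by (simp add: interior_maximal)
  qed
  have "Z \<noteq> {}"
  proof -
    obtain r where r: "r > 0" "ball x0 r \<subseteq> cran c0" using chart_ball[OF c0 x0] by blast
    then show ?thesis using ball_Z[OF c0 r(2) _ jet] by auto
  qed
  moreover have "open Z" by (simp add: Z_def)
  moreover have "closed Z"
  proof -
    have "p \<in> Z" if p: "p \<in> closure Z" for p
    proof -
      define c where "c = chart_at A p"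
      have c: "c \<in> A" "p \<in> cdom c" using chart_at[of p] by (auto simp: c_def charts_at_iff)
      obtain r where r: "r > 0" "ball (coord c p) r \<subseteq> cran c"
        using chart_ball[OF c(1)] c(2) by blast
      define N where "N = cdom c \<inter> coord c -` ball (coord c p) r"
      have N: "open N" unfolding N_def
        by (rule continuous_open_preimage[OF continuous_coord[OF c(1)] open_cdom[OF c(1)] open_ball])
      have "p \<in> N" using c r by (simp add: N_def)
      \<comment> \<open>Near \<open>q\<close> the field vanishes identically, so its 1-jet at
        \<open>q\<close> is trivial, and rigidity carries the zero along segments of the coordinate
        ball to its centre \<open>p\<close>.\<close>
      then obtain q where q: "q \<in> N" "q \<in> Z" using p N open_Int_closure_eq_empty[of N Z] by blast
      define y where "y = coord c q"
      have y: "y \<in> ball (coord c p) r" "y \<in> cran c" "cinv c y = q" using q c by (auto simp: N_def y_def cinv_coord)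
      define W where "W = cran c \<inter> cinv c -` Z"
      have W: "open W" "y \<in> W" unfolding W_def
        using continuous_open_preimage[OF continuous_cinv[OF c(1)] open_cran[OF c(1)] \<open>open Z\<close>] y q by auto
      have X0: "X c b z = 0" if "z \<in> W" for z
        using that zero_iff[OF cinv_charts_at[OF c(1), of z]] interior_subset[of "{q. V q = (\<lambda>_. 0)}"]
        by (auto simp: W_def Z_def coord_cinv)
      have "(X c b has_derivative (\<lambda>_. 0)) (at y)"
        by (rule has_derivative_transform_within_open[OF has_derivative_const[of 0] W]) (simp add: X0)
      then have "\<D> (X c b) y v = 0" for v by (simp add: frechetI)
      from ball_Z[OF c(1) r(2) y(1) X0[OF W(2)] this]
      have "cinv c (coord c p) \<in> Z" using r by auto
      then show ?thesis using c by (simp add: cinv_coord)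
    qed
    then show ?thesis using closure_subset_eq[of Z] by blast
  qed
  ultimately have "Z = UNIV" using connected_M connected_clopen[of "UNIV::'m set"] by auto
  then have V0: "V q = (\<lambda>_. 0)" for q using interior_subset[of "{q. V q = (\<lambda>_. 0)}"] unfolding Z_def by auto
  \<comment> \<open>The field vanishes everywhere, so by the group law every orbit curve has zero
    velocity at all times and is locally constant.\<close>
  have triv: "flow (s *\<^sub>R b) p = p" for s :: real and p
  proof -
    have cont: "continuous_on UNIV (\<lambda>s. flow (s *\<^sub>R b) p)" by (intro continuous_flow continuous_intros)
    have "(\<lambda>s. flow (s *\<^sub>R b) p) constant_on (UNIV :: real set)"
    proof (rule locally_constant_imp_constant[OF connected_UNIV])
      fix s0 :: real
      define c where "c = chart_at A (flow (s0 *\<^sub>R b) p)"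
      have c: "c \<in> A" "flow (s0 *\<^sub>R b) p \<in> cdom c" using chart_at[of "flow (s0 *\<^sub>R b) p"] by (auto simp: c_def charts_at_iff)
      have "open ((\<lambda>s. flow (s *\<^sub>R b) p) -` cdom c)" using open_vimage[OF open_cdom[OF c(1)] cont] .
      then obtain r where r: "r > 0" "ball s0 r \<subseteq> (\<lambda>s. flow (s *\<^sub>R b) p) -` cdom c"
        using c(2) open_contains_ball_eq[of "(\<lambda>s. flow (s *\<^sub>R b) p) -` cdom c" s0] by auto
      have d: "((\<lambda>s. coord c (flow (s *\<^sub>R b) p)) has_derivative (\<lambda>_. 0)) (at s)" if s: "s \<in> ball s0 r" for s
      proof -
        define q where "q = flow (s *\<^sub>R b) p"
        have q: "c \<in> charts_at A q" using r s c by (auto simp: q_def charts_at_iff)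
        have "X c b (coord c q) = 0" using zero_iff[OF q] V0 by simp
        then have "((\<lambda>h. coord c (flow (h *\<^sub>R b) q)) has_derivative (\<lambda>_. 0)) (at (s - s))"
          using flow_curve_derivative[OF q, of b] by (simp add: has_vector_derivative_def)
        moreover have "((\<lambda>t. t - s) has_derivative (\<lambda>h. h)) (at s)" by (auto intro!: derivative_eq_intros)
        ultimately have "((\<lambda>t. coord c (flow ((t - s) *\<^sub>R b) q)) has_derivative (\<lambda>_. 0)) (at s)"
          using has_derivative_compose[of "\<lambda>t. t - s" "\<lambda>h. h" s UNIV "\<lambda>h. coord c (flow (h *\<^sub>R b) q)" "\<lambda>_. 0"] by simp
        moreover have "flow ((t - s) *\<^sub>R b) q = flow (t *\<^sub>R b) p" for t
          unfolding q_def flow_add[symmetric] by (simp add: algebra_simps)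
        ultimately show ?thesis by simp
      qed
      have "((\<lambda>s. coord c (flow (s *\<^sub>R b) p)) has_derivative (\<lambda>_. 0)) (at s within ball s0 r)" if "s \<in> ball s0 r" for s
        by (rule has_derivative_at_withinI[OF d[OF that]])
      from has_derivative_zero_constant[OF convex_ball this]
      obtain k where k: "\<forall>s\<in>ball s0 r. coord c (flow (s *\<^sub>R b) p) = k" ..
      have "flow (s *\<^sub>R b) p = cinv c k" if s: "s \<in> ball s0 r" for s
      proof -
        have "flow (s *\<^sub>R b) p \<in> cdom c" using r(2) s by blast
        then show ?thesis using cinv_coord[OF c(1)] k s by metis
      qed
      then have ct: "\<forall>s\<in>ball s0 r. flow (s *\<^sub>R b) p = flow (s0 *\<^sub>R b) p" using r(1) by simp
      have "s0 \<in> ball s0 r" using r(1) by simp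
      then show "\<exists>N. openin (top_of_set UNIV) N \<and> s0 \<in> N \<and> (\<forall>s\<in>N. flow (s *\<^sub>R b) p = flow (s0 *\<^sub>R b) p)"
        by (intro exI[of _ "ball s0 r"] conjI open_subset[OF subset_UNIV] open_ball ct)
    qed
    then obtain k where "\<And>s::real. flow (s *\<^sub>R b) p = k" by (auto simp: constant_on_def)
    then show ?thesis using flow_0[of p] by (metis scaleR_zero_left)
  qed
  obtain i where i: "b $ i \<noteq> 0" using b by (auto simp: vec_eq_iff)
  \<comment> \<open>At this time the coordinate \<open>i\<close> of
    \<open>torus_exp (s *\<^sub>R b)\<close> is -1, although a trivially acting element has to be
    1.\<close>
  define s where "s = pi / (b $ i)"
  have "act (torus_exp (s *\<^sub>R b)) p = p" for p using triv[of s p] by (simp add: flow_def)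
  then have "torus_exp (s *\<^sub>R b) = 1" using effective torus_exp_in_torus unfolding effective_action_def by blast
  then have "torus_exp (s *\<^sub>R b) $ i = 1" by simp
  then show False using i by (simp add: torus_exp_def s_def)
qed

lemma S_linear: assumes c: "c \<in> A" and x: "x \<in> cran c" shows "linear (S a lam c x w)"
proof -
  interpret K: local_kaehler "cran c" "loc2 A c g" "\<lambda>u. \<i> *s u" by (rule local_kaehler[OF c])
  show ?thesis unfolding S_def
    by (rule linearI) (simp_all add: linear_add[OF K.Ric_linear[OF x]] linear_scale[OF K.Ric_linear[OF x]] K.G_simps x algebra_simps)
qed

lemma S_ii: assumes c: "c \<in> A" and x: "x \<in> cran c" shows "S a lam c x (\<i> *s u) (\<i> *s v) = S a lam c x u v"
proof -
  interpret K: local_kaehler "cran c" "loc2 A c g" "\<lambda>u. \<i> *s u" by (rule local_kaehler[OF c])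
  have "nab c (Y c a) x (\<i> *s u) = \<i> *s nab c (Y c a) x u"
    using K.nabla_Y[OF X_killing[OF c, of a] x] K.nabla_J[OF X_killing[OF c, of a] x]
    unfolding Y_eq[OF c] by (simp add: K.J_simps)
  then show ?thesis unfolding S_def by (simp add: K.Ric_J x K.G_J)
qed

lemma S_continuous: assumes c: "c \<in> A" shows "continuous_on (cran c) (\<lambda>x. S a lam c x u v)"
proof -
  interpret K: local_kaehler "cran c" "loc2 A c g" "\<lambda>u. \<i> *s u" by (rule local_kaehler[OF c])
  show ?thesis unfolding S_def
    using K.nabla_Y_continuous[OF X_killing[OF c, of a], of u v] unfolding Y_eq[OF c]
    by (intro continuous_intros K.Ric_continuous K.G_continuous)
qed

text \<open>An open set on which \<open>S\<close> is nonzero would consist of degenerate points,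
  since \<open>lagrangian_span\<close> forces \<open>S\<close> to vanish at all others;
  \<open>commuting_killing_trivial_jet\<close> and \<open>no_trivial_jet\<close> exclude such a
  set.\<close>

lemma S_zero_if_gradient_zero:
  assumes c: "c \<in> A" and z: "\<And>x w b. x \<in> cran c \<Longrightarrow> S a lam c x w (Y c b x) = 0" and x: "x \<in> cran c"
  shows "S a lam c x u v = 0"
proof (rule ccontr)
  assume ne: "S a lam c x u v \<noteq> 0"
  interpret K: local_kaehler "cran c" "loc2 A c g" "\<lambda>u. \<i> *s u" by (rule local_kaehler[OF c])
  define W where "W = cran c \<inter> (\<lambda>y. S a lam c y u v) -` (- {0})"
  have W: "open W" "W \<subseteq> cran c" "W \<noteq> {}"
    using continuous_open_preimage[OF S_continuous[OF c] open_cran[OF c], of "- {0}" a lam u v] ne x by (auto simp: W_def)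
  have deg: "\<exists>b. b \<noteq> 0 \<and> X c b y = 0" if y: "y \<in> W" for y
  proof (rule ccontr)
    assume "\<not> ?thesis"
    then have nd: "\<And>b. X c b y = 0 \<Longrightarrow> b = 0" by blast
    have yc: "y \<in> cran c" using y W by blast
    note l = X_linear[OF c yc]
    have inj: "inj (\<lambda>b. X c b y)" using linear_injective_0[OF l] nd by blast
    \<comment> \<open>The hypothesis kills \<open>\<i> *s X c b y\<close> directly, being about
      \<open>Y\<close>; that \<open>X c b y\<close> itself is killed follows from the
      \<open>J\<close>-invariance of \<open>S\<close>, with \<open>u\<close> replaced by
      \<open>\<i> *s u\<close>.\<close>
    have SX: "S a lam c y u (X c b y) = 0" for b
      using z[OF yc, of "\<i> *s u" b] S_ii[OF c yc, of a lam u "X c b y"] linear_neg[OF S_linear[OF c yc]] by (simp add: Y_def)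
    have SJX: "S a lam c y u (\<i> *s X c b y) = 0" for b
      using z[OF yc, of u b] linear_neg[OF S_linear[OF c yc]] by (simp add: Y_def)
    have "DIM(complex^'n) = 2 * DIM(real^'n)" by simp
    from K.lagrangian_span[OF yc l inj this isotropic_orbits[OF c yc] S_linear[OF c yc] SX SJX]
    have "S a lam c y u v = 0" .
    then show False using y by (simp add: W_def)
  qed
  obtain y b where "y \<in> W" "b \<noteq> 0" "X c b y = 0" "\<And>v. \<D> (X c b) y v = 0"
    by (rule K.commuting_killing_trivial_jet[where X="X c", OF X_killing[OF c] X_linear[OF c] X_commute[OF c] W deg])
      (assumption+, rule that)
  then show False using no_trivial_jet[OF c, of y b] W by blast
qed

text \<open>At a maximum of the potential its gradient vanishes, which removes the weight term, and
  the Laplacian, with its nonnegative sign convention, is at least 0 there.\<close>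

lemma constant_nonneg:
  assumes k: "\<And>p. wlap a b 0 p = k"
  shows "k \<ge> 0"
proof -
  have "continuous_on UNIV (\<lambda>q. blinfun_apply (\<mu> q) b)"
  proof (rule continuous_at_imp_continuous_on, rule ballI)
    fix p :: 'm
    define c where "c = chart_at A p"
    have c: "c \<in> A" "p \<in> cdom c" using chart_at[of p] by (auto simp: c_def charts_at_iff)
    have "continuous_on (cdom c) (\<lambda>q. H c b (coord c q))"
      by (rule continuous_on_compose2[OF smooth_on_continuous[OF H_smooth[OF c(1)]] continuous_coord[OF c(1)]]) auto
    then have "continuous_on (cdom c) (\<lambda>q. blinfun_apply (\<mu> q) b)"
      by (rule continuous_on_eq) (simp add: H_def cinv_coord c)
    then show "isCont (\<lambda>q. blinfun_apply (\<mu> q) b) p"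
      using c open_cdom[OF c(1)] by (simp add: continuous_on_eq_continuous_at)
  qed
  then obtain p where p: "\<And>q. blinfun_apply (\<mu> q) b \<le> blinfun_apply (\<mu> p) b"
    using continuous_attains_sup[OF compact_M] by blast
  define c where "c = chart_at A p"
  define x where "x = coord c p"
  have c: "c \<in> charts_at A p" "c \<in> A" "x \<in> cran c" "cinv c x = p"
    using chart_at[of p] by (auto simp: c_def x_def charts_at_iff cinv_coord)
  interpret K: local_kaehler "cran c" "loc2 A c g" "\<lambda>u. \<i> *s u" by (rule local_kaehler[OF c(2)])
  have "(H c b has_derivative (\<lambda>w. loc2 A c g y (Y c b y) w)) (at y)" if "y \<in> cran c" for y
    using smooth_on_has_derivative[OF H_smooth[OF c(2)] that, of b] unfolding H_derivative[OF c(2) that, symmetric] .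
  then have "Y c b x = 0" "tr (nab c (Y c b) x) \<le> 0"
    using K.divergence_at_max[OF X_killing[OF c(2), of b] c(3), of "H c b"] p unfolding Y_eq[OF c(2)]
    by (simp_all add: H_def c(4))
  then show "k \<ge> 0"
    using k[of p] unfolding weighted_laplacian_potential[OF c(1)] x_def[symmetric] by (simp add: K.G_simps c(3))
qed

lemma weighted_laplacian_shift:
  "wlap a b k p = wlap a b 0 p"
  unfolding weighted_laplacian_potential[OF chart_at] ..

text \<open>Passing from \<open>b\<close> to \<open>- b\<close> gives the estimate at the minimum of
  the potential.\<close>

lemma weighted_laplacian_minus:
  "wlap a (- b) 0 p = - wlap a b 0 p"
proof -
  define c where "c = chart_at A p"
  define x where "x = coord c p"
  have c: "c \<in> charts_at A p" "c \<in> A" "x \<in> cran c"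
    using chart_at[of p] by (auto simp: c_def x_def charts_at_iff)
  interpret K: local_kaehler "cran c" "loc2 A c g" "\<lambda>u. \<i> *s u" by (rule local_kaehler[OF c(2)])
  have Ym: "Y c (- b) y = - Y c b y" if "y \<in> cran c" for y
    using Y_scale[OF c(2) that, of "-1" b] by simp
  have "(Y c (- b) has_derivative (\<lambda>w. - \<D> (Y c b) x w)) (at x)"
    by (rule has_derivative_transform_within_open[OF has_derivative_minus[OF Y_derivative[OF c(2,3)]] open_cran[OF c(2)] c(3)]) (simp add: Ym)
  then have "nab c (Y c (- b)) x = (\<lambda>e. - nab c (Y c b) x e)"
    by (intro ext) (simp add: K.nabla_def frechetI Ym c K.\<Gamma>_simps)
  then show ?thesis unfolding weighted_laplacian_potential[OF c(1)] x_def[symmetric]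
    by (simp add: Ym c K.G_simps tr_minus)
qed

lemma soliton_iff_eigenfunctions:
  "kaehler_ricci_soliton A act g \<omega> a lam \<longleftrightarrow>
    (\<forall>b. \<exists>c. \<forall>p. wlap a b c p =
      2 * lam * (blinfun_apply (\<mu> p) b + c))"
proof
  assume "kaehler_ricci_soliton A act g \<omega> a lam"
  then have S0: "S a lam (chart_at A p) (coord (chart_at A p) p) u v = 0" for p u v
    unfolding soliton_iff by blast
  have const: "\<exists>k. \<forall>p. wlap a b 0 p = 2 * lam * blinfun_apply (\<mu> p) b + k" for b
  proof -
    define f where "f p = wlap a b 0 p - 2 * lam * blinfun_apply (\<mu> p) b" for p
    have "((f \<circ> cinv (chart_at A p)) has_derivative (\<lambda>_. 0)) (at (coord (chart_at A p) p))" for p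
    proof -
      have c: "chart_at A p \<in> A" "coord (chart_at A p) p \<in> cran (chart_at A p)" using chart_at[of p] by (auto simp: charts_at_iff)
      show ?thesis using weighted_laplacian_derivative[OF c, of a b 0 lam] unfolding f_def[abs_def] S0 by simp
    qed
    then obtain k where "\<And>p. f p = k" using constant_if_derivative_zero by metis
    then show ?thesis unfolding f_def by (intro exI[of _ k]) (simp add: algebra_simps)
  qed
  show "\<forall>b. \<exists>c. \<forall>p. wlap a b c p = 2 * lam * (blinfun_apply (\<mu> p) b + c)"
  proof
    fix b
    obtain k where k: "\<And>p. wlap a b 0 p = 2 * lam * blinfun_apply (\<mu> p) b + k"
      using const by blast
    show "\<exists>c. \<forall>p. wlap a b c p = 2 * lam * (blinfun_apply (\<mu> p) b + c)"
    proof (cases "lam = 0")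
      case True
      have "k \<ge> 0" by (rule constant_nonneg[of a b]) (use k True in simp)
      moreover have "- k \<ge> 0" by (rule constant_nonneg[of a "- b"]) (use k True weighted_laplacian_minus in simp)
      ultimately have "k = 0" by simp
      then show ?thesis using k True by (intro exI[of _ 0]) simp
    next
      case False
      \<comment> \<open>The shift \<open>k / (2 * lam)\<close> absorbs \<open>k\<close> on the
        right; the left side does not change, since a constant has no gradient.\<close>
      then have eq: "2 * lam * blinfun_apply (\<mu> p) b + k = 2 * lam * (blinfun_apply (\<mu> p) b + k / (2 * lam))" for p
        by (simp add: field_simps)
      have "wlap a b (k / (2 * lam)) p
        = 2 * lam * (blinfun_apply (\<mu> p) b + k / (2 * lam))" for p
        using weighted_laplacian_shift[of a b "k / (2 * lam)" p] k[of p] eq[of p] by (rule trans[OF _ trans])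
      then show ?thesis by blast
    qed
  qed
next
  assume eig: "\<forall>b. \<exists>c. \<forall>p. wlap a b c p = 2 * lam * (blinfun_apply (\<mu> p) b + c)"
  have grad0: "S a lam c x w (Y c b x) = 0" if c: "c \<in> A" and x: "x \<in> cran c" for c x w b
  proof -
    obtain k where k: "\<And>p. wlap a b k p = 2 * lam * (blinfun_apply (\<mu> p) b + k)"
      using eig by blast
    have "(\<lambda>p. wlap a b k p - 2 * lam * blinfun_apply (\<mu> p) b) = (\<lambda>p. 2 * lam * k)"
      unfolding k by (simp add: algebra_simps)
    then have "((\<lambda>x. 2 * lam * k) has_derivative (\<lambda>w. 2 * S a lam c x w (Y c b x))) (at x)"
      using weighted_laplacian_derivative[OF c x, of a b k lam] by (simp add: o_def)
    from fun_cong[OF has_derivative_unique[OF this has_derivative_const], of w] show ?thesis by simp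
  qed
  show "kaehler_ricci_soliton A act g \<omega> a lam"
    unfolding soliton_iff
  proof (intro allI)
    fix p and u v :: "complex^'n"
    have c: "chart_at A p \<in> A" "coord (chart_at A p) p \<in> cran (chart_at A p)" using chart_at[of p] by (auto simp: charts_at_iff)
    show "S a lam (chart_at A p) (coord (chart_at A p) p) u v = 0"
      by (rule S_zero_if_gradient_zero[OF c(1) grad0[OF c(1)] c(2)])
  qed
qed

end

theorem mainTheorem2:
  fixes A :: "('m::t2_space, 'n::finite) chart set"
    and act :: "complex^'n \<Rightarrow> 'm \<Rightarrow> 'm"
    and g0 \<omega>0 g \<omega> :: "('m, 'n) tensor2"
    and \<mu> :: "'m \<Rightarrow> (real^'n) \<Rightarrow>\<^sub>L real"
    and a :: "real^'n"
    and lam :: real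
  assumes "toric_kaehler_manifold A act g0 \<omega>0"
    and "fano A"
    and "kaehler A g \<omega>"
    and "invariant_tensor2 A act g"
    and "moment_map A act \<omega> \<mu>"
  shows "kaehler_ricci_soliton A act g \<omega> a lam \<longleftrightarrow>
    (\<forall>b. \<exists>c. \<forall>p. weighted_laplacian A g \<mu> a (\<lambda>q. blinfun_apply (\<mu> q) b + c) p =
      2 * lam * (blinfun_apply (\<mu> p) b + c))"
proof -
  interpret toric_manifold A g \<omega> act \<mu>
    using assms by unfold_locales (simp_all add: toric_kaehler_manifold_def)
  show ?thesis by (rule soliton_iff_eigenfunctions)
qed

end
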